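(* Let $E$ be a holomorphic vector bundle over a closed Kähler manifold $(M,\omega)$. For any fixed $H\in Herm^+(E)$ and any $G\in Herm^+(E)$, the Donaldson type functional and the Donaldson functional agree: $$\mathcal{L}(G,H)=\mathcal{M}(G,H).$$
   Context: $M$ is a closed (compact, without boundary) Kähler manifold of complex dimension $n$ with Kähler form $\omega=\sqrt{-1}\,g_{\alpha\bar\beta}\,dz^\alpha\wedge d\bar z^\beta$; $\pi:E\to M$ is a holomorphic vector bundle of rank $r$; $E^o$ is $E$ minus its zero section; $P(E)\to M$ is the projectivization with fibres $P(E_z)=(E_z\setminus\{0\})/\mathbb{C}^*$, and $\int_{P(E)/M}$ is integration along its fibres. Forms on $M$ are pulled back to $P(E)$ when needed. $F^+(E)$ is the space of strongly pseudo-convex complex Finsler metrics on $E$: continuous functions $G:E\to[0,\infty)$, smooth on $E^o$, with $G(z,v)=0$ iff $v=0$, $G(z,\lambda v)=|\lambda|^2G(z,v)$ for $\lambda\in\mathbb{C}$, and with $\sqrt{-1}\partial\bar\partial G$ on $E^o$ positive definite along each fibre $E_z$. $Herm^+(E)$ is the space of (smooth) Hermitian metrics on $E$, regarded as a subset of $F^+(E)$ by identifying a Hermitian metric $h$ with the function $G(z,v)=h_z(v,v)=G_{i\bar j}(z)v^i\bar v^j$. A smooth curve $G_t$ in $F^+(E)$ is one depending smoothly on $(t,\cdot)$ on $E^o$; then $v_t=\partial_t\log G_t$ is a function on $P(E)$. Let $z^\alpha$ be local coordinates on $M$ and $v^i$ linear fibre coordinates on $E$ (homogeneous fibre coordinates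 on $P(E)$). With subscripts on $G$ denoting partial derivatives in $v^i,\bar v^j,z^\alpha,\bar z^\beta$ and $(G^{k\bar l})$ the inverse matrix of $(G_{i\bar j})$, $G_{j\bar l}G^{k\bar l}=\delta_j^k$, put $K_{i\bar j\alpha\bar\beta}=-G_{i\bar j\alpha\bar\beta}+G^{k\bar l}G_{i\bar l\alpha}G_{k\bar j\bar\beta}$. The Kobayashi curvature of $G$ is $\Psi=\Psi(G)=\sqrt{-1}K_{i\bar j\alpha\bar\beta}\frac{v^i\bar v^j}{G}dz^\alpha\wedge d\bar z^\beta$, a form on $P(E)$. Put $\Xi=\Xi(G)=\frac{\sqrt{-1}}{2\pi}\partial\bar\partial\log G$, a closed $(1,1)$-form on $P(E)$. Let $\lambda=\frac{2\pi n}{r}\frac{\int_Mc_1(E)\wedge\omega^{n-1}}{\int_M\omega^n}$. For $G,H\in F^+(E)$ choose a smooth curve $G_t$, $0\le t\le1$, in $F^+(E)$ with $G_0=H$, $G_1=G$, for example $G_t=(1-t)H+tG$, and put (with $v_t=\partial_t\log G_t$, $\Xi=\Xi(G_t)$, $\Psi=\Psi(G_t)$) $$Q_1(G,H)=r\int_0^1\Big[\int_{P(E)/M}v_t\,\Xi^{r-1}\Big]dt,\qquad Q_2(G,H)=r(r+1)\int_0^1\int_{P(E)/M}v_t\,\Psi\wedge\Xi^{r-1}\,dt,$$ $$Q_3(G,H)=-r^2\int_0^1\Big[\int_{P(E)/M}v_t\,\Xi^{r-1}\int_{P(E)/M}\Psi\wedge\Xi^{r-1}\Big]dt.$$ The Donaldson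 type functional is $$\mathcal{L}(G,H)=\int_M\Big(Q_2(G,H)+Q_3(G,H)-\frac{\lambda}{n}Q_1(G,H)\,\omega\Big)\wedge\frac{\omega^{n-1}}{(n-1)!};$$ its value does not depend on the chosen curve. The (original) Donaldson functional: for $G,H\in Herm^+(E)$ and any smooth curve $G_t$, $0\le t\le1$, in $Herm^+(E)$ with $G_0=H$, $G_1=G$, $$\mathcal{M}(G,H)=\int_M\Big(\int_0^1\mathrm{tr}(\sqrt{-1}\,V_t\cdot R_t)\,dt-\frac{\lambda}{n}\log\det\frac{G}{H}\;\omega\Big)\wedge\frac{\omega^{n-1}}{(n-1)!},$$ where $V_t=(\partial_tG_t)G_t^{-1}$ is the endomorphism of $E$ determined by $G_t(V_t\xi,\eta)=(\partial_tG_t)(\xi,\eta)$, $R_t$ is the curvature of the Chern connection of $(E,G_t)$, and $\det\frac GH=\det(G_{i\bar j})/\det(H_{i\bar j})$; its value does not depend on the chosen curve in $Herm^+(E)$. *)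

theory Defs
  imports "HOL-Analysis.Analysis" "HOL-Combinatorics.Permutations"
begin

section \<open>Calculus on \<open>\<complex>\<^sup>k\<close>\<close>

primrec C_k_on :: "nat \<Rightarrow> 'a::real_normed_vector set \<Rightarrow> ('a \<Rightarrow> 'b::real_normed_vector) \<Rightarrow> bool" where
  "C_k_on 0 S f \<longleftrightarrow> continuous_on S f"
| "C_k_on (Suc k) S f \<longleftrightarrow> (\<forall>x\<in>S. f differentiable (at x)) \<and>
     (\<forall>v. C_k_on k S (\<lambda>x. frechet_derivative f (at x) v))"

text \<open>Only meant for open \<open>S\<close> (and finite-dimensional domains).\<close>
definition smooth_on :: "'a::real_normed_vector set \<Rightarrow> ('a \<Rightarrow> 'b::real_normed_vector) \<Rightarrow> bool" where
  "smooth_on S f \<longleftrightarrow> (\<forall>k. C_k_on k S f)"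

definition holo_on :: "(complex^'k) set \<Rightarrow> (complex^'k \<Rightarrow> complex) \<Rightarrow> bool" where
  "holo_on S f \<longleftrightarrow> (\<forall>x\<in>S. \<exists>D. (f has_derivative D) (at x) \<and> (\<forall>c v. D (c *s v) = c * D v))"

text \<open>The Wirtinger derivatives with respect to the \<open>a\<close>-th coordinate and its conjugate.\<close>
definition wd :: "'k::finite \<Rightarrow> (complex^'k \<Rightarrow> complex) \<Rightarrow> complex^'k \<Rightarrow> complex" where
  "wd a f x = (frechet_derivative f (at x) (axis a 1)
      - \<i> * frechet_derivative f (at x) (axis a \<i>)) / 2"

definition wdbar :: "'k::finite \<Rightarrow> (complex^'k \<Rightarrow> complex) \<Rightarrow> complex^'k \<Rightarrow> complex" where
  "wdbar a f x = (frechet_derivative f (at x) (axis a 1)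
      + \<i> * frechet_derivative f (at x) (axis a \<i>)) / 2"

definition sesq :: "complex^'k^'k \<Rightarrow> complex^'k \<Rightarrow> complex^'k \<Rightarrow> complex" where
  "sesq A X Y = (\<Sum>a\<in>UNIV. \<Sum>b\<in>UNIV. A $ a $ b * X $ a * cnj (Y $ b))"

definition pos_def_hermitian :: "complex^'k^'k \<Rightarrow> bool" where
  "pos_def_hermitian A \<longleftrightarrow> (\<forall>a b. A $ a $ b = cnj (A $ b $ a)) \<and> (\<forall>X. X \<noteq> 0 \<longrightarrow> 0 < Re (sesq A X X))"


section \<open>Exterior algebra and exterior derivative\<close>

text \<open>A complex-valued alternating \<open>p\<close>-form on the real vector space \<open>\<complex>\<^sup>k\<close> is a function on lists of
  vectors, of which only the values on lists of length \<open>p\<close> matter.\<close>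
type_synonym 'k covec = "(complex^'k) list \<Rightarrow> complex"

definition wedge :: "nat \<Rightarrow> nat \<Rightarrow> 'k covec \<Rightarrow> 'k covec \<Rightarrow> 'k covec" where
  "wedge p q \<alpha> \<beta> = (\<lambda>X. (\<Sum>\<sigma> | \<sigma> permutes {..<p + q}. of_int (sign \<sigma>)
      * \<alpha> (map (\<lambda>i. X ! \<sigma> i) [0..<p]) * \<beta> (map (\<lambda>i. X ! \<sigma> i) [p..<p + q]))
      / (fact p * fact q))"

text \<open>The \<open>m\<close>-th exterior power of a 2-form.\<close>
primrec wedge_power :: "'k covec \<Rightarrow> nat \<Rightarrow> 'k covec" where
  "wedge_power \<alpha> 0 = (\<lambda>_. 1)"
| "wedge_power \<alpha> (Suc m) = wedge 2 (2 * m) \<alpha> (wedge_power \<alpha> m)"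

definition dz :: "'k::finite \<Rightarrow> 'k covec" where "dz a = (\<lambda>X. hd X $ a)"

definition dzbar :: "'k::finite \<Rightarrow> 'k covec" where "dzbar a = (\<lambda>X. cnj (hd X $ a))"

text \<open>\<open>\<Sum> A a b dz\<^sup>a \<and> d\<zeta>\<^sup>b\<close> with \<open>\<zeta>\<^sup>b\<close> the conjugate of \<open>z\<^sup>b\<close>.\<close>
definition form11 :: "('k \<Rightarrow> 'k \<Rightarrow> complex) \<Rightarrow> 'k::finite covec" where
  "form11 A = (\<lambda>X. \<Sum>a\<in>UNIV. \<Sum>b\<in>UNIV. A a b * wedge 1 1 (dz a) (dzbar b) X)"

text \<open>The exterior derivative of a \<open>p\<close>-form, on \<open>p + 1\<close> constant vector fields.\<close>
definition ext_deriv :: "nat \<Rightarrow> (complex^'k \<Rightarrow> 'k covec) \<Rightarrow> complex^'k \<Rightarrow> 'k covec" where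
  "ext_deriv p \<eta> x = (\<lambda>X. \<Sum>i\<le>p. (- 1) ^ i *
      frechet_derivative (\<lambda>y. \<eta> y (take i X @ drop (Suc i) X)) (at x) (X ! i))"

definition enumeration :: "'k::finite set \<Rightarrow> 'k list" where
  "enumeration S = (SOME xs. distinct xs \<and> set xs = S)"

text \<open>The frame \<open>\<partial>/\<partial>x\<^sup>1, \<partial>/\<partial>y\<^sup>1, \<partial>/\<partial>x\<^sup>2, \<partial>/\<partial>y\<^sup>2, \<dots>\<close>, positive for the complex orientation
  in whichever order the indices are listed.\<close>
definition real_frame :: "'k::finite list \<Rightarrow> (complex^'k) list" where
  "real_frame xs = concat (map (\<lambda>a. [axis a 1, axis a \<i>]) xs)"


section \<open>Complex manifolds and holomorphic vector bundles\<close>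

type_synonym ('m, 'n) chart = "'m set \<times> ('m \<Rightarrow> complex^'n)"
type_synonym ('e, 'm, 'r) triv = "'m set \<times> ('e \<Rightarrow> complex^'r)"

text \<open>The base manifold \<open>M\<close> with a holomorphic atlas, and the set \<open>E\<close> with its projection to \<open>M\<close> and
  local trivialisations; a trivialisation over \<open>W\<close> maps a vector to its fibre coordinates
  \<open>(v\<^sup>1, \<dots>, v\<^sup>r)\<close>. The linear structure of the fibres and the complex structure of \<open>E\<close> are those
  transported by the trivialisations.\<close>
record ('m, 'n::finite, 'e, 'r::finite) vbundle =
  base :: "'m topology"
  charts :: "('m, 'n) chart set"
  total :: "'e set"
  proj :: "'e \<Rightarrow> 'm"
  trivs :: "('e, 'm, 'r) triv set"

definition chart_inv :: "('m, 'n::finite) chart \<Rightarrow> complex^'n \<Rightarrow> 'm" where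
  "chart_inv c = inv_into (fst c) (snd c)"

definition closed_complex_manifold :: "('m, 'n::finite, 'e, 'r::finite) vbundle \<Rightarrow> bool" where
  "closed_complex_manifold B \<longleftrightarrow>
     compact_space (base B) \<and> Hausdorff_space (base B) \<and>
     (\<Union>(U, \<phi>)\<in>charts B. U) = topspace (base B) \<and>
     (\<forall>(U, \<phi>)\<in>charts B. openin (base B) U \<and> open (\<phi> ` U) \<and>
        homeomorphic_map (subtopology (base B) U) (top_of_set (\<phi> ` U)) \<phi>) \<and>
     (\<forall>(U, \<phi>)\<in>charts B. \<forall>(U', \<phi>')\<in>charts B. \<forall>a.
        holo_on (\<phi> ` (U \<inter> U')) (\<lambda>z. \<phi>' (chart_inv (U, \<phi>) z) $ a))"

definition fibre :: "('m, 'n::finite, 'e, 'r::finite) vbundle \<Rightarrow> 'm \<Rightarrow> 'e set" where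
  "fibre B p = {e \<in> total B. proj B e = p}"

definition holomorphic_vector_bundle :: "('m, 'n::finite, 'e, 'r::finite) vbundle \<Rightarrow> bool" where
  "holomorphic_vector_bundle B \<longleftrightarrow>
     proj B ` total B \<subseteq> topspace (base B) \<and>
     (\<Union>(W, \<tau>)\<in>trivs B. W) = topspace (base B) \<and>
     (\<forall>(W, \<tau>)\<in>trivs B. openin (base B) W \<and> (\<forall>p\<in>W. bij_betw \<tau> (fibre B p) UNIV)) \<and>
     (\<forall>(W, \<tau>)\<in>trivs B. \<forall>(W', \<tau>')\<in>trivs B. \<exists>A :: 'm \<Rightarrow> complex^'r^'r.
        (\<forall>p\<in>W \<inter> W'. \<forall>e\<in>fibre B p. \<tau>' e = A p *v \<tau> e) \<and>
        (\<forall>(U, \<phi>)\<in>charts B. \<forall>i j.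
           holo_on (\<phi> ` (U \<inter> W \<inter> W')) (\<lambda>z. A (chart_inv (U, \<phi>) z) $ i $ j)))"

text \<open>The local coordinates \<open>(z, v)\<close> on \<open>E\<close> form one vector, indexed by the disjoint sum of the two
  index types.\<close>
definition zpart :: "complex^('n::finite + 'r::finite) \<Rightarrow> complex^'n" where
  "zpart x = (\<chi> a. x $ Inl a)"

definition vpart :: "complex^('n::finite + 'r::finite) \<Rightarrow> complex^'r" where
  "vpart x = (\<chi> i. x $ Inr i)"

definition join :: "complex^'n \<Rightarrow> complex^'r \<Rightarrow> complex^('n::finite + 'r::finite)" where
  "join z v = (\<chi> k. case k of Inl a \<Rightarrow> z $ a | Inr i \<Rightarrow> v $ i)"

definition point :: "('m, 'n::finite, 'e, 'r::finite) vbundle \<Rightarrow> ('m, 'n) chart \<Rightarrow> ('e, 'm, 'r) triv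
    \<Rightarrow> complex^('n + 'r) \<Rightarrow> 'e" where
  "point B c t x = (THE e. e \<in> fibre B (chart_inv c (zpart x)) \<and> snd t e = vpart x)"

definition coord_dom :: "('m, 'n::finite) chart \<Rightarrow> ('e, 'm, 'r::finite) triv \<Rightarrow> (complex^('n + 'r)) set" where
  "coord_dom c t = {x. zpart x \<in> snd c ` (fst c \<inter> fst t)}"

definition coord_dom_o :: "('m, 'n::finite) chart \<Rightarrow> ('e, 'm, 'r::finite) triv \<Rightarrow> (complex^('n + 'r)) set" where
  "coord_dom_o c t = {x \<in> coord_dom c t. vpart x \<noteq> 0}"


section \<open>Integration over the base\<close>

text \<open>A differential form on \<open>M\<close> is given by its coordinate expressions in all charts.\<close>
type_synonym ('m, 'n) mform = "('m, 'n) chart \<Rightarrow> complex^'n \<Rightarrow> 'n covec"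

definition partition_of_unity ::
    "('m, 'n::finite, 'e, 'r::finite) vbundle \<Rightarrow> (('m, 'n) chart \<times> ('m \<Rightarrow> real)) set \<Rightarrow> bool" where
  "partition_of_unity B P \<longleftrightarrow> finite P \<and>
     (\<forall>(c, \<rho>)\<in>P. c \<in> charts B \<and> (\<forall>p. 0 \<le> \<rho> p) \<and>
        (base B) closure_of {p \<in> topspace (base B). \<rho> p \<noteq> 0} \<subseteq> fst c \<and>
        (\<forall>(U, \<phi>)\<in>charts B. smooth_on (\<phi> ` U) (\<lambda>z. \<rho> (chart_inv (U, \<phi>) z)))) \<and>
     (\<forall>p\<in>topspace (base B). (\<Sum>(c, \<rho>)\<in>P. \<rho> p) = 1)"

text \<open>The integral of a form of top degree \<open>2n\<close>: the common value for all smooth partitions of unity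
  subordinate to the atlas.\<close>
definition integral_M :: "('m, 'n::finite, 'e, 'r::finite) vbundle \<Rightarrow> ('m, 'n) mform \<Rightarrow> complex" where
  "integral_M B \<eta> = (THE I. \<forall>P. partition_of_unity B P \<longrightarrow>
     I = (\<Sum>(c, \<rho>)\<in>P. set_lebesgue_integral lborel (snd c ` fst c)
           (\<lambda>z. of_real (\<rho> (chart_inv c z)) * \<eta> c z (real_frame (enumeration UNIV)))))"


section \<open>Kaehler metrics\<close>

text \<open>\<open>g c z\<close> is the matrix of the metric coefficients in the chart \<open>c\<close> at the point with
  coordinates \<open>z\<close>.\<close>
definition kaehler_form :: "(('m, 'n::finite) chart \<Rightarrow> complex^'n \<Rightarrow> complex^'n^'n) \<Rightarrow> ('m, 'n) mform" where
  "kaehler_form g c z = form11 (\<lambda>a b. \<i> * g c z $ a $ b)"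

definition kaehler_metric :: "('m, 'n::finite, 'e, 'r::finite) vbundle
    \<Rightarrow> (('m, 'n) chart \<Rightarrow> complex^'n \<Rightarrow> complex^'n^'n) \<Rightarrow> bool" where
  "kaehler_metric B g \<longleftrightarrow>
     (\<forall>(U, \<phi>)\<in>charts B. smooth_on (\<phi> ` U) (g (U, \<phi>)) \<and>
        (\<forall>z\<in>\<phi> ` U. pos_def_hermitian (g (U, \<phi>) z) \<and>
           (\<forall>X. length X = 3 \<longrightarrow> ext_deriv 2 (kaehler_form g (U, \<phi>)) z X = 0))) \<and>
     (\<forall>(U, \<phi>)\<in>charts B. \<forall>(U', \<phi>')\<in>charts B. \<forall>z\<in>\<phi> ` (U \<inter> U').
        let T = \<phi>' \<circ> chart_inv (U, \<phi>); D = frechet_derivative T (at z) in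
        \<forall>X Y. sesq (g (U, \<phi>) z) X Y = sesq (g (U', \<phi>') (T z)) (D X) (D Y))"


section \<open>Finsler and Hermitian metrics on \<open>E\<close>\<close>

definition coord_expr :: "('m, 'n::finite, 'e, 'r::finite) vbundle \<Rightarrow> ('m, 'n) chart \<Rightarrow> ('e, 'm, 'r) triv
    \<Rightarrow> ('e \<Rightarrow> real) \<Rightarrow> complex^('n + 'r) \<Rightarrow> complex" where
  "coord_expr B c t G x = of_real (G (point B c t x))"

text \<open>\<open>F\<^sup>+(E)\<close>.\<close>
definition finsler_metric :: "('m, 'n::finite, 'e, 'r::finite) vbundle \<Rightarrow> ('e \<Rightarrow> real) \<Rightarrow> bool" where
  "finsler_metric B G \<longleftrightarrow> (\<forall>c\<in>charts B. \<forall>t\<in>trivs B.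
     continuous_on (coord_dom c t) (coord_expr B c t G) \<and>
     smooth_on (coord_dom_o c t) (coord_expr B c t G) \<and>
     (\<forall>x\<in>coord_dom c t. 0 \<le> G (point B c t x) \<and> (G (point B c t x) = 0 \<longleftrightarrow> vpart x = 0) \<and>
        (\<forall>l. G (point B c t (join (zpart x) (l *s vpart x))) = (cmod l)\<^sup>2 * G (point B c t x))) \<and>
     (\<forall>x\<in>coord_dom_o c t. pos_def_hermitian
        (\<chi> i j. wd (Inr i) (wdbar (Inr j) (coord_expr B c t G)) x)))"

text \<open>A smooth curve \<open>G\<^sub>t\<close>, \<open>0 \<le> t \<le> 1\<close>, in \<open>F\<^sup>+(E)\<close>. Smoothness up to the end points means that the
  curve extends smoothly to an open neighbourhood of \<open>[0, 1]\<close>; the extension need not stay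
  in \<open>F\<^sup>+(E)\<close>.\<close>
definition smooth_finsler_curve :: "('m, 'n::finite, 'e, 'r::finite) vbundle \<Rightarrow> (real \<Rightarrow> 'e \<Rightarrow> real) \<Rightarrow> bool" where
  "smooth_finsler_curve B \<Gamma> \<longleftrightarrow> (\<forall>s\<in>{0..1}. finsler_metric B (\<Gamma> s)) \<and>
     (\<exists>I \<Gamma>'. open I \<and> {0..1} \<subseteq> I \<and> (\<forall>s\<in>{0..1}. \<forall>e\<in>total B. \<Gamma>' s e = \<Gamma> s e) \<and>
        (\<forall>c\<in>charts B. \<forall>t\<in>trivs B.
           smooth_on (I \<times> coord_dom_o c t) (\<lambda>(s, x). coord_expr B c t (\<Gamma>' s) x)))"

definition hermitian_metric :: "('m, 'n::finite, 'e, 'r::finite) vbundle \<Rightarrow> ('e \<Rightarrow> 'e \<Rightarrow> complex) \<Rightarrow> bool" where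
  "hermitian_metric B h \<longleftrightarrow> (\<forall>(W, \<tau>)\<in>trivs B. \<exists>A :: 'm \<Rightarrow> complex^'r^'r.
     (\<forall>p\<in>W. pos_def_hermitian (A p) \<and>
        (\<forall>e\<in>fibre B p. \<forall>e'\<in>fibre B p. h e e' = sesq (A p) (\<tau> e) (\<tau> e'))) \<and>
     (\<forall>(U, \<phi>)\<in>charts B. smooth_on (\<phi> ` (U \<inter> W)) (\<lambda>z. A (chart_inv (U, \<phi>) z))))"

text \<open>The identification of a Hermitian metric with an element of \<open>F\<^sup>+(E)\<close>.\<close>
definition finsler_of :: "('e \<Rightarrow> 'e \<Rightarrow> complex) \<Rightarrow> 'e \<Rightarrow> real" where
  "finsler_of h e = Re (h e e)"

text \<open>A smooth curve in \<open>Herm\<^sup>+(E)\<close> is a smooth curve in \<open>F\<^sup>+(E)\<close> that consists of Hermitian metrics.\<close>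
definition smooth_hermitian_curve ::
    "('m, 'n::finite, 'e, 'r::finite) vbundle \<Rightarrow> (real \<Rightarrow> 'e \<Rightarrow> 'e \<Rightarrow> complex) \<Rightarrow> bool" where
  "smooth_hermitian_curve B \<Gamma> \<longleftrightarrow> (\<forall>s\<in>{0..1}. hermitian_metric B (\<Gamma> s)) \<and>
     smooth_finsler_curve B (\<lambda>s. finsler_of (\<Gamma> s))"

definition herm_matrix :: "('m, 'n::finite, 'e, 'r::finite) vbundle \<Rightarrow> ('m, 'n) chart \<Rightarrow> ('e, 'm, 'r) triv
    \<Rightarrow> ('e \<Rightarrow> 'e \<Rightarrow> complex) \<Rightarrow> complex^'n \<Rightarrow> complex^'r^'r" where
  "herm_matrix B c t h z =
     (\<chi> i j. h (point B c t (join z (axis i 1))) (point B c t (join z (axis j 1))))"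

text \<open>Endomorphisms of \<open>E\<close> are written as matrices acting on row vectors: row \<open>i\<close> of the matrix of
  \<open>V\<close> consists of the coefficients of \<open>V e\<^sub>i\<close>. So the connection matrix is \<open>\<partial>h h\<inverse>\<close>, and its curvature
  is the result of applying \<open>\<partial>\<close>-bar to it; \<open>chern_curvature B c t h z a b\<close> is the coefficient of
  \<open>dz\<^sup>a \<and> d\<zeta>\<^sup>b\<close>, \<open>\<zeta>\<^sup>b\<close> the conjugate of \<open>z\<^sup>b\<close>, hence the sign.\<close>
definition chern_connection :: "('m, 'n::finite, 'e, 'r::finite) vbundle \<Rightarrow> ('m, 'n) chart \<Rightarrow> ('e, 'm, 'r) triv
    \<Rightarrow> ('e \<Rightarrow> 'e \<Rightarrow> complex) \<Rightarrow> complex^'n \<Rightarrow> 'n \<Rightarrow> complex^'r^'r" where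
  "chern_connection B c t h z a =
     (\<chi> i j. wd a (\<lambda>y. herm_matrix B c t h y $ i $ j) z) ** matrix_inv (herm_matrix B c t h z)"

definition chern_curvature :: "('m, 'n::finite, 'e, 'r::finite) vbundle \<Rightarrow> ('m, 'n) chart \<Rightarrow> ('e, 'm, 'r) triv
    \<Rightarrow> ('e \<Rightarrow> 'e \<Rightarrow> complex) \<Rightarrow> complex^'n \<Rightarrow> 'n \<Rightarrow> 'n \<Rightarrow> complex^'r^'r" where
  "chern_curvature B c t h z a b =
     (\<chi> i j. - wdbar b (\<lambda>y. chern_connection B c t h y a $ i $ j) z)"

text \<open>Forms on \<open>M\<close> built from \<open>E\<close> are computed in some trivialisation around the point; they do not
  depend on which one.\<close>
definition triv_at :: "('m, 'n::finite, 'e, 'r::finite) vbundle \<Rightarrow> ('m, 'n) chart \<Rightarrow> complex^'n \<Rightarrow> ('e, 'm, 'r) triv" where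
  "triv_at B c z = (SOME t. t \<in> trivs B \<and> chart_inv c z \<in> fst t)"

text \<open>The form \<open>(\<i> / 2\<pi>) tr R\<close>, which represents \<open>c\<^sub>1(E)\<close>.\<close>
definition chern_form1 :: "('m, 'n::finite, 'e, 'r::finite) vbundle \<Rightarrow> ('e \<Rightarrow> 'e \<Rightarrow> complex) \<Rightarrow> ('m, 'n) mform" where
  "chern_form1 B h c z = form11 (\<lambda>a b. \<i> / (2 * of_real pi) *
     trace (chern_curvature B c (triv_at B c z) h z a b))"

text \<open>The constant \<open>\<lambda>\<close>; any Hermitian metric on \<open>E\<close> may be used to represent \<open>c\<^sub>1(E)\<close>.\<close>
definition einstein_constant :: "('m, 'n::finite, 'e, 'r::finite) vbundle
    \<Rightarrow> (('m, 'n) chart \<Rightarrow> complex^'n \<Rightarrow> complex^'n^'n) \<Rightarrow> complex" where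
  "einstein_constant B g = 2 * of_real pi * of_nat CARD('n) / of_nat CARD('r) *
     (integral_M B (\<lambda>c z. wedge 2 (2 * (CARD('n) - 1))
          (chern_form1 B (SOME h. hermitian_metric B h) c z)
          (wedge_power (kaehler_form g c z) (CARD('n) - 1)))
      / integral_M B (\<lambda>c z. wedge_power (kaehler_form g c z) CARD('n)))"


section \<open>Forms on \<open>P(E)\<close> and integration along the fibres\<close>

text \<open>A form on \<open>P(E)\<close> is given by its pull-back to \<open>E\<^sup>o\<close>, in the coordinates \<open>(z, v)\<close>.\<close>

definition Xi :: "('m, 'n::finite, 'e, 'r::finite) vbundle \<Rightarrow> ('m, 'n) chart \<Rightarrow> ('e, 'm, 'r) triv
    \<Rightarrow> ('e \<Rightarrow> real) \<Rightarrow> complex^('n + 'r) \<Rightarrow> ('n + 'r) covec" where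
  "Xi B c t G x = form11 (\<lambda>a b. \<i> / (2 * of_real pi) *
     wd a (wdbar b (\<lambda>y. of_real (ln (G (point B c t y))))) x)"

text \<open>The entry \<open>(k, l)\<close> of the matrix with upper indices is the entry \<open>(l, k)\<close> of the inverse, by the
  convention \<open>G\<^bsub>j\<lambda>\<^esub> G\<^bsup>k\<lambda>\<^esup> = \<delta>\<^bsub>j\<^esub>\<^bsup>k\<^esup>\<close>.\<close>
definition kobayashi_coeff :: "('m, 'n::finite, 'e, 'r::finite) vbundle \<Rightarrow> ('m, 'n) chart \<Rightarrow> ('e, 'm, 'r) triv
    \<Rightarrow> ('e \<Rightarrow> real) \<Rightarrow> complex^('n + 'r) \<Rightarrow> 'r \<Rightarrow> 'r \<Rightarrow> 'n \<Rightarrow> 'n \<Rightarrow> complex" where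
  "kobayashi_coeff B c t G x i j a b =
     (let F = coord_expr B c t G;
          Gup = (\<lambda>k l. matrix_inv (\<chi> p q. wd (Inr p) (wdbar (Inr q) F) x) $ l $ k)
      in - wd (Inr i) (wdbar (Inr j) (wd (Inl a) (wdbar (Inl b) F))) x
         + (\<Sum>k\<in>UNIV. \<Sum>l\<in>UNIV. Gup k l
              * wd (Inr i) (wdbar (Inr l) (wd (Inl a) F)) x
              * wd (Inr k) (wdbar (Inr j) (wdbar (Inl b) F)) x))"

definition Psi :: "('m, 'n::finite, 'e, 'r::finite) vbundle \<Rightarrow> ('m, 'n) chart \<Rightarrow> ('e, 'm, 'r) triv
    \<Rightarrow> ('e \<Rightarrow> real) \<Rightarrow> complex^('n + 'r) \<Rightarrow> ('n + 'r) covec" where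
  "Psi B c t G x = (\<lambda>X. \<Sum>a\<in>UNIV. \<Sum>b\<in>UNIV.
     \<i> * (\<Sum>i\<in>UNIV. \<Sum>j\<in>UNIV. kobayashi_coeff B c t G x i j a b
            * vpart x $ i * cnj (vpart x $ j) / coord_expr B c t G x)
       * wedge 1 1 (dz (Inl a)) (dzbar (Inl b)) X)"

text \<open>Integration along the fibres of \<open>P(E) \<rightarrow> M\<close> of a form of degree at least \<open>2(r - 1)\<close>. Up to a null
  set the fibre is the affine chart \<open>v\<^sup>k = 1\<close>, \<open>k = proj_index\<close>, with coordinates \<open>v\<^sup>i\<close>, \<open>i \<noteq> k\<close>, and the
  form on \<open>P(E)\<close> is the restriction of its pull-back to the image of the section \<open>v\<^sup>k = 1\<close> of
  \<open>E\<^sup>o \<rightarrow> P(E)\<close>. The real dimension of the fibre being even, the order of horizontal and vertical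
  arguments does not matter.\<close>
definition proj_index :: "'r::finite" where
  "proj_index = (SOME k. True)"

definition affine_vec :: "('r \<Rightarrow> complex) \<Rightarrow> complex^'r::finite" where
  "affine_vec w = (\<chi> i. if i = proj_index then 1 else w i)"

definition fibre_integral :: "(complex^('n::finite + 'r::finite) \<Rightarrow> ('n + 'r) covec)
    \<Rightarrow> complex^'n \<Rightarrow> 'n covec" where
  "fibre_integral \<eta> z = (\<lambda>X.
     \<integral>w. \<eta> (join z (affine_vec w))
          (map (\<lambda>Y. join Y 0) X @ map (join 0) (real_frame (enumeration (UNIV - {proj_index :: 'r}))))
       \<partial>(\<Pi>\<^sub>M i\<in>UNIV - {proj_index :: 'r}. lborel))"


section \<open>The two functionals\<close>

definition v_fun :: "(real \<Rightarrow> 'e \<Rightarrow> real) \<Rightarrow> real \<Rightarrow> 'e \<Rightarrow> real" where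
  "v_fun \<Gamma> s e = vector_derivative (\<lambda>u. ln (\<Gamma> u e)) (at s within {0..1})"

definition fibre_int_v :: "('m, 'n::finite, 'e, 'r::finite) vbundle \<Rightarrow> ('m, 'n) chart \<Rightarrow> ('e, 'm, 'r) triv
    \<Rightarrow> (real \<Rightarrow> 'e \<Rightarrow> real) \<Rightarrow> real \<Rightarrow> complex^'n \<Rightarrow> complex" where
  "fibre_int_v B c t \<Gamma> s z = fibre_integral (\<lambda>x X. of_real (v_fun \<Gamma> s (point B c t x))
     * wedge_power (Xi B c t (\<Gamma> s) x) (CARD('r) - 1) X) z []"

definition fibre_int_Psi :: "('m, 'n::finite, 'e, 'r::finite) vbundle \<Rightarrow> ('m, 'n) chart \<Rightarrow> ('e, 'm, 'r) triv
    \<Rightarrow> (real \<Rightarrow> 'e \<Rightarrow> real) \<Rightarrow> real \<Rightarrow> complex^'n \<Rightarrow> 'n covec" where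
  "fibre_int_Psi B c t \<Gamma> s z = fibre_integral (\<lambda>x. wedge 2 (2 * (CARD('r) - 1))
     (Psi B c t (\<Gamma> s) x) (wedge_power (Xi B c t (\<Gamma> s) x) (CARD('r) - 1))) z"

definition fibre_int_v_Psi :: "('m, 'n::finite, 'e, 'r::finite) vbundle \<Rightarrow> ('m, 'n) chart \<Rightarrow> ('e, 'm, 'r) triv
    \<Rightarrow> (real \<Rightarrow> 'e \<Rightarrow> real) \<Rightarrow> real \<Rightarrow> complex^'n \<Rightarrow> 'n covec" where
  "fibre_int_v_Psi B c t \<Gamma> s z = fibre_integral (\<lambda>x X. of_real (v_fun \<Gamma> s (point B c t x))
     * wedge 2 (2 * (CARD('r) - 1))
         (Psi B c t (\<Gamma> s) x) (wedge_power (Xi B c t (\<Gamma> s) x) (CARD('r) - 1)) X) z"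

definition Q1 :: "('m, 'n::finite, 'e, 'r::finite) vbundle \<Rightarrow> (real \<Rightarrow> 'e \<Rightarrow> real)
    \<Rightarrow> ('m, 'n) chart \<Rightarrow> complex^'n \<Rightarrow> complex" where
  "Q1 B \<Gamma> c z = of_nat CARD('r) * integral {0..1} (\<lambda>s. fibre_int_v B c (triv_at B c z) \<Gamma> s z)"

definition Q2 :: "('m, 'n::finite, 'e, 'r::finite) vbundle \<Rightarrow> (real \<Rightarrow> 'e \<Rightarrow> real) \<Rightarrow> ('m, 'n) mform" where
  "Q2 B \<Gamma> c z = (\<lambda>X. of_nat (CARD('r) * (CARD('r) + 1))
     * integral {0..1} (\<lambda>s. fibre_int_v_Psi B c (triv_at B c z) \<Gamma> s z X))"

definition Q3 :: "('m, 'n::finite, 'e, 'r::finite) vbundle \<Rightarrow> (real \<Rightarrow> 'e \<Rightarrow> real) \<Rightarrow> ('m, 'n) mform" where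
  "Q3 B \<Gamma> c z = (\<lambda>X. - (of_nat CARD('r))\<^sup>2
     * integral {0..1} (\<lambda>s. fibre_int_v B c (triv_at B c z) \<Gamma> s z
                           * fibre_int_Psi B c (triv_at B c z) \<Gamma> s z X))"

text \<open>The Donaldson type functional, computed along a curve from \<open>H\<close> to \<open>G\<close>.\<close>
definition donaldson_type_along :: "('m, 'n::finite, 'e, 'r::finite) vbundle
    \<Rightarrow> (('m, 'n) chart \<Rightarrow> complex^'n \<Rightarrow> complex^'n^'n) \<Rightarrow> (real \<Rightarrow> 'e \<Rightarrow> real) \<Rightarrow> complex" where
  "donaldson_type_along B g \<Gamma> = integral_M B (\<lambda>c z X.
     wedge 2 (2 * (CARD('n) - 1))
       (\<lambda>Y. Q2 B \<Gamma> c z Y + Q3 B \<Gamma> c z Y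
            - einstein_constant B g / of_nat CARD('n) * Q1 B \<Gamma> c z * kaehler_form g c z Y)
       (wedge_power (kaehler_form g c z) (CARD('n) - 1)) X
     / fact (CARD('n) - 1))"

text \<open>\<open>L(G, H)\<close>: the value does not depend on the curve in \<open>F\<^sup>+(E)\<close>, so the segment is used.\<close>
definition donaldson_type :: "('m, 'n::finite, 'e, 'r::finite) vbundle
    \<Rightarrow> (('m, 'n) chart \<Rightarrow> complex^'n \<Rightarrow> complex^'n^'n) \<Rightarrow> ('e \<Rightarrow> real) \<Rightarrow> ('e \<Rightarrow> real) \<Rightarrow> complex" where
  "donaldson_type B g G H = donaldson_type_along B g (\<lambda>s e. (1 - s) * H e + s * G e)"

definition velocity_endo :: "('m, 'n::finite, 'e, 'r::finite) vbundle \<Rightarrow> ('m, 'n) chart \<Rightarrow> ('e, 'm, 'r) triv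
    \<Rightarrow> (real \<Rightarrow> 'e \<Rightarrow> 'e \<Rightarrow> complex) \<Rightarrow> real \<Rightarrow> complex^'n \<Rightarrow> complex^'r^'r" where
  "velocity_endo B c t \<Gamma> s z =
     vector_derivative (\<lambda>u. herm_matrix B c t (\<Gamma> u) z) (at s within {0..1})
       ** matrix_inv (herm_matrix B c t (\<Gamma> s) z)"

definition tr_VR :: "('m, 'n::finite, 'e, 'r::finite) vbundle \<Rightarrow> ('m, 'n) chart \<Rightarrow> ('e, 'm, 'r) triv
    \<Rightarrow> (real \<Rightarrow> 'e \<Rightarrow> 'e \<Rightarrow> complex) \<Rightarrow> real \<Rightarrow> complex^'n \<Rightarrow> 'n covec" where
  "tr_VR B c t \<Gamma> s z = form11 (\<lambda>a b.
     \<i> * trace (velocity_endo B c t \<Gamma> s z ** chern_curvature B c t (\<Gamma> s) z a b))"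

definition log_det :: "('m, 'n::finite, 'e, 'r::finite) vbundle \<Rightarrow> ('e \<Rightarrow> 'e \<Rightarrow> complex)
    \<Rightarrow> ('e \<Rightarrow> 'e \<Rightarrow> complex) \<Rightarrow> ('m, 'n) chart \<Rightarrow> complex^'n \<Rightarrow> complex" where
  "log_det B G H c z = Ln (det (herm_matrix B c (triv_at B c z) G z)
                         / det (herm_matrix B c (triv_at B c z) H z))"

text \<open>The Donaldson functional, computed along a curve from \<open>H = \<Gamma> 0\<close> to \<open>G = \<Gamma> 1\<close>.\<close>
definition donaldson_along :: "('m, 'n::finite, 'e, 'r::finite) vbundle
    \<Rightarrow> (('m, 'n) chart \<Rightarrow> complex^'n \<Rightarrow> complex^'n^'n) \<Rightarrow> (real \<Rightarrow> 'e \<Rightarrow> 'e \<Rightarrow> complex) \<Rightarrow> complex" where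
  "donaldson_along B g \<Gamma> = integral_M B (\<lambda>c z X.
     wedge 2 (2 * (CARD('n) - 1))
       (\<lambda>Y. integral {0..1} (\<lambda>s. tr_VR B c (triv_at B c z) \<Gamma> s z Y)
            - einstein_constant B g / of_nat CARD('n) * log_det B (\<Gamma> 1) (\<Gamma> 0) c z * kaehler_form g c z Y)
       (wedge_power (kaehler_form g c z) (CARD('n) - 1)) X
     / fact (CARD('n) - 1))"

text \<open>\<open>M(G, H)\<close>: the value does not depend on the curve of Hermitian metrics, so the segment is used.\<close>
definition donaldson :: "('m, 'n::finite, 'e, 'r::finite) vbundle
    \<Rightarrow> (('m, 'n) chart \<Rightarrow> complex^'n \<Rightarrow> complex^'n^'n)
    \<Rightarrow> ('e \<Rightarrow> 'e \<Rightarrow> complex) \<Rightarrow> ('e \<Rightarrow> 'e \<Rightarrow> complex) \<Rightarrow> complex" where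
  "donaldson B g G H =
     donaldson_along B g (\<lambda>s e e'. of_real (1 - s) * H e e' + of_real s * G e e')"

end

theory Submission
  imports Defs "Jordan_Normal_Form.Determinant" "HOL-Combinatorics.Multiset_Permutations"
begin

text \<open>The two integrands already agree pointwise on \<open>M\<close>. If \<open>G\<close> comes from a Hermitian metric with matrix \<open>A\<close>,
  the Kobayashi form is \<open>\<i> R A(v, v) / G\<close> with \<open>R\<close> the Chern curvature, and in the affine chart of a fibre of
  \<open>P(E)\<close> the volume form of \<open>\<Xi>\<^bsup>r-1\<^esup>\<close> is \<open>(r-1)! det A / (\<pi>\<^bsup>r-1\<^esup> G\<^bsup>r\<^esup>)\<close>. So everything reduces to the moments
  of quadratic forms for the Fubini-Study measure: with \<open>V = B A\<inverse>\<close>, the mean of \<open>B(v, v) / G\<close> is \<open>tr V / r\<close>, and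
  the mean of \<open>B(v, v) C(v, v) / G\<^sup>2\<close> is \<open>(tr V tr W + tr (V W)) / (r (r + 1))\<close>, \<open>W = C A\<inverse>\<close>. They are the first and
  second derivatives in \<open>A\<close> of the identity \<open>\<integral> G\<^bsup>-r\<^esup> = \<pi>\<^bsup>r-1\<^esup> / ((r-1)! det A)\<close>, which follows by completing
  squares. Hence \<open>Q\<^sub>1\<close> is the logarithm of the quotient of determinants, and in \<open>Q\<^sub>2 + Q\<^sub>3\<close> the products of traces
  cancel, leaving \<open>tr (\<i> V R)\<close>.\<close>

text \<open>\<open>wedge\<close> is a sum over permutations, so products of one-forms are rewritten
  as determinants \<open>Det\<close> of lists of one-forms. On vertical frames these have block
  form: each fibre coordinate contributes a 2 x 2 block of value -2i, which with the factor i/(2 pi)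
  of \<open>Xi\<close> gives the 1/pi in the volume form.

  The moments are derivatives along A + tB, which must stay positive definite, so the direction has
  to be Hermitian. The matrices R_ab A of single components of the curvature are not Hermitian in
  general. The first moment is therefore extended to arbitrary C by complex linearity before it is
  differentiated again, now in the direction of the velocity of the curve, which is Hermitian. The
  factors r, r(r+1) and r^2 in the functional are exactly the denominators of these moments.

  The products of traces cancel only after the integral over the parameter has been split, so each
  part has to be integrable. This is why a curve is described by matrices that are jointly
  differentiable in the parameter and the base point.\<close>

no_notation Matrix.vec_index (infixl "$" 100)
hide_const (open) Matrix.mat Determinant.det Matrix.row Matrix.rows Matrix.col Matrix.vec Lattice.join
hide_fact (open) Matrix.vec_eq_iff Matrix.row_def Matrix.mat_def Matrix.vec_def Determinant.det_def Lattice.join_def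

section \<open>Exterior algebra: powers of (1,1)-forms as determinants\<close>

section \<open>Determinants of lists of one-forms\<close>

text \<open>The exterior product of the one-forms in \<open>\<rho>\<close>, on the vectors
  \<open>X\<close>. The determinant with natural number indices is chosen because the length of a
  list is not a type, and because it comes with block matrices and row operations.\<close>

definition Det :: "('v \<Rightarrow> complex) list \<Rightarrow> 'v list \<Rightarrow> complex" where
  "Det \<rho> X = Determinant.det (Matrix.mat (length \<rho>) (length \<rho>) (\<lambda>(i, j). (\<rho> ! i) (X ! j)))"

lemma Det_Leibniz:
  "Det \<rho> X = (\<Sum>\<sigma> | \<sigma> permutes {..<length \<rho>}. of_int (sign \<sigma>) * (\<Prod>i<length \<rho>. (\<rho> ! i) (X ! \<sigma> i)))"
proof -
  have "Det \<rho> X = (\<Sum>\<sigma> | \<sigma> permutes {0..<length \<rho>}. of_int (sign \<sigma>) *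
      (\<Prod>i = 0..<length \<rho>. Matrix.mat (length \<rho>) (length \<rho>) (\<lambda>(i, j). (\<rho> ! i) (X ! j)) $$ (i, \<sigma> i)))"
    unfolding Det_def by (subst det_def'[of _ "length \<rho>"]) auto
  also have "\<dots> = (\<Sum>\<sigma> | \<sigma> permutes {0..<length \<rho>}. of_int (sign \<sigma>) *
      (\<Prod>i = 0..<length \<rho>. (\<rho> ! i) (X ! \<sigma> i)))"
    by (intro sum.cong refl arg_cong2[where f = "(*)"] prod.cong) auto
  finally show ?thesis by (simp add: atLeast0LessThan)
qed

lemma Det_Nil [simp]: "Det [] X = 1"
  by (simp add: Det_def)

lemma Det_single: "Det [\<phi>] X = \<phi> (X ! 0)"
  by (simp add: Det_def det_single)

lemma Det_pair: "Det [\<phi>, \<psi>] X = \<phi> (X ! 0) * \<psi> (X ! 1) - \<phi> (X ! 1) * \<psi> (X ! 0)"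
proof -
  have "{\<sigma>. \<sigma> permutes {..<2::nat}} = {id, Transposition.transpose 0 1}"
    using permutes_doubleton_iff[of _ "1::nat" 0] by (auto simp: lessThan_Suc numeral_2_eq_2 transpose_commute)
  moreover have "id \<noteq> Transposition.transpose 0 (1::nat)"
    by (auto simp: fun_eq_iff Transposition.transpose_def)
  ultimately show ?thesis
    unfolding Det_Leibniz by (simp add: numeral_2_eq_2 sign_swap_id)
qed

lemma Det_swap: "Det (\<rho> @ [\<phi>, \<psi>] @ \<tau>) X = - Det (\<rho> @ [\<psi>, \<phi>] @ \<tau>) X"
proof -
  let ?n = "length \<rho> + 2 + length \<tau>"
  let ?M = "Matrix.mat ?n ?n (\<lambda>(i, j). ((\<rho> @ [\<psi>, \<phi>] @ \<tau>) ! i) (X ! j))"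
  have "Matrix.mat ?n ?n (\<lambda>(i, j). ((\<rho> @ [\<phi>, \<psi>] @ \<tau>) ! i) (X ! j)) = swaprows (length \<rho>) (Suc (length \<rho>)) ?M"
    by (rule eq_matI) (auto simp: nth_append nth_Cons split: nat.splits)
  thus ?thesis
    unfolding Det_def using det_swaprows[of "length \<rho>" ?n "Suc (length \<rho>)" ?M] by (simp add: algebra_simps)
qed

lemma Det_move: "Det (\<rho> @ \<eta> # \<tau> @ \<rho>') X = (- 1) ^ length \<tau> * Det (\<rho> @ \<tau> @ \<eta> # \<rho>') X"
proof (induction \<tau> arbitrary: \<rho>)
  case (Cons \<phi> \<tau>)
  have "Det (\<rho> @ \<eta> # (\<phi> # \<tau>) @ \<rho>') X = - Det ((\<rho> @ [\<phi>]) @ \<eta> # \<tau> @ \<rho>') X"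
    using Det_swap[of \<rho> \<eta> \<phi> "\<tau> @ \<rho>'" X] by simp
  also have "\<dots> = - ((- 1) ^ length \<tau> * Det ((\<rho> @ [\<phi>]) @ \<tau> @ \<eta> # \<rho>') X)"
    by (subst Cons.IH) simp
  finally show ?case by simp
qed simp

lemma Det_zero_row:
  assumes "\<phi> \<in> set \<rho>" "\<And>v. v \<in> set X \<Longrightarrow> \<phi> v = 0" "length \<rho> \<le> length X"
  shows "Det \<rho> X = 0"
proof -
  obtain i where i: "i < length \<rho>" "\<rho> ! i = \<phi>" using assms(1) by (auto simp: in_set_conv_nth)
  have *: "(\<Prod>i<length \<rho>. (\<rho> ! i) (X ! \<sigma> i)) = 0" if "\<sigma> permutes {..<length \<rho>}" for \<sigma>
  proof (rule prod_zero[OF finite_lessThan], rule bexI[of _ i])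
    have "\<sigma> i < length X" using permutes_in_image[OF that, of i] i assms(3) by auto
    thus "(\<rho> ! i) (X ! \<sigma> i) = 0" using i assms(2) by auto
  qed (use i in auto)
  show ?thesis unfolding Det_Leibniz by (intro sum.neutral ballI) (simp only: * mem_Collect_eq mult_zero_right)
qed

lemma Det_equal_rows: "Det (\<rho> @ \<phi> # \<tau> @ \<phi> # \<rho>') X = 0"
proof -
  have "Det (\<rho> @ \<tau> @ [\<phi>, \<phi>] @ \<rho>') X = 0"
    using Det_swap[of "\<rho> @ \<tau>" \<phi> \<phi> \<rho>' X] by simp
  thus ?thesis using Det_move[of \<rho> \<phi> \<tau> "\<phi> # \<rho>'" X] by simp
qed

text \<open>Vanishing of \<open>\<rho>\<close> on \<open>V\<close> makes the matrix block
  triangular, whatever \<open>\<tau>\<close> does on \<open>Y\<close>. This separates horizontal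
  from vertical arguments, and one fibre coordinate from the others.\<close>

lemma Det_block:
  assumes "length Y = length \<rho>" "\<And>\<phi> v. \<phi> \<in> set \<rho> \<Longrightarrow> v \<in> set V \<Longrightarrow> \<phi> v = 0" "length V = length \<tau>"
  shows "Det (\<rho> @ \<tau>) (Y @ V) = Det \<rho> Y * Det \<tau> V"
proof -
  let ?p = "length \<rho>" and ?q = "length \<tau>"
  have "Matrix.mat (?p + ?q) (?p + ?q) (\<lambda>(i, j). ((\<rho> @ \<tau>) ! i) ((Y @ V) ! j)) =
      four_block_mat (Matrix.mat ?p ?p (\<lambda>(i, j). (\<rho> ! i) (Y ! j))) (0\<^sub>m ?p ?q)
        (Matrix.mat ?q ?p (\<lambda>(i, j). (\<tau> ! i) (Y ! j))) (Matrix.mat ?q ?q (\<lambda>(i, j). (\<tau> ! i) (V ! j)))"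
    using assms by (intro eq_matI) (auto simp: nth_append)
  thus ?thesis
    unfolding Det_def by (simp add: det_four_block_mat_upper_right_zero[OF _ refl])
qed

text \<open>On the given vectors the matrix factors as diag(1, \<open>L\<close>) times the matrix of
  \<open>\<phi>s @ \<psi>s\<close>.\<close>

lemma Det_linear:
  assumes "length \<phi>s = m" "length \<psi>s = m" "length \<eta>s = m" "length X = 2 * m"
    and "\<And>i v. i < m \<Longrightarrow> v \<in> set X \<Longrightarrow> (\<eta>s ! i) v = (\<Sum>j<m. L i j * (\<psi>s ! j) v)"
  shows "Det (\<phi>s @ \<eta>s) X = Determinant.det (Matrix.mat m m (\<lambda>(i, j). L i j)) * Det (\<phi>s @ \<psi>s) X"
proof -
  let ?P = "four_block_mat (1\<^sub>m m) (0\<^sub>m m m) (0\<^sub>m m m) (Matrix.mat m m (\<lambda>(i, j). L i j))"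
  let ?B = "Matrix.mat (m + m) (m + m) (\<lambda>(i, j). ((\<phi>s @ \<psi>s) ! i) (X ! j))"
  have "Matrix.mat (m + m) (m + m) (\<lambda>(i, j). ((\<phi>s @ \<eta>s) ! i) (X ! j)) = ?P * ?B"
  proof (rule eq_matI)
    fix i j assume "i < dim_row (?P * ?B)" "j < dim_col (?P * ?B)"
    hence ij: "i < m + m" "j < m + m" by auto
    have "(?P * ?B) $$ (i, j) = (\<Sum>k = 0..<m + m. ?P $$ (i, k) * ?B $$ (k, j))"
      using ij by (simp add: scalar_prod_def)
    also have "\<dots> = (\<Sum>k = 0..<m. ?P $$ (i, k) * ?B $$ (k, j)) + (\<Sum>k = 0..<m. ?P $$ (i, k + m) * ?B $$ (k + m, j))"
      by (subst sum.atLeastLessThan_concat[symmetric, of 0 m "m + m"])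
        (auto simp: sum.shift_bounds_nat_ivl[of _ 0 m m, simplified])
    also have "(\<Sum>k = 0..<m. ?P $$ (i, k) * ?B $$ (k, j)) = (if i < m then (\<phi>s ! i) (X ! j) else 0)"
      using ij assms(1) by (auto simp: nth_append sum.delta if_distrib[where f = "\<lambda>x. x * _"] cong: if_cong)
    also have "(\<Sum>k = 0..<m. ?P $$ (i, k + m) * ?B $$ (k + m, j)) = (if i < m then 0 else (\<eta>s ! (i - m)) (X ! j))"
      using ij assms by (auto simp: nth_append atLeast0LessThan)
    finally show "Matrix.mat (m + m) (m + m) (\<lambda>(i, j). ((\<phi>s @ \<eta>s) ! i) (X ! j)) $$ (i, j) = (?P * ?B) $$ (i, j)"
      using ij assms(1) by (auto simp: nth_append)
  qed auto
  moreover have "Determinant.det ?P = Determinant.det (Matrix.mat m m (\<lambda>(i, j). L i j))"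
    by (subst det_four_block_mat_upper_right_zero[OF _ refl]) auto
  ultimately show ?thesis
    unfolding Det_def using assms by (simp add: det_mult[of ?P "m + m" ?B])
qed

section \<open>Wedge products\<close>

lemma wedge_cong:
  assumes "\<And>Y. length Y = p \<Longrightarrow> \<alpha> Y = \<alpha>' Y" "\<And>Y. length Y = q \<Longrightarrow> \<beta> Y = \<beta>' Y"
  shows "wedge p q \<alpha> \<beta> X = wedge p q \<alpha>' \<beta>' X"
  unfolding wedge_def
  by (intro arg_cong2[where f = "(/)"] refl sum.cong arg_cong2[where f = "(*)"] assms) auto

lemma wedge_sum_left: "wedge p q (\<lambda>Y. \<Sum>a\<in>S. f a Y) \<beta> X = (\<Sum>a\<in>S. wedge p q (f a) \<beta> X)"
  unfolding wedge_def
  by (simp add: sum_distrib_left sum_distrib_right sum_divide_distrib) (rule sum.swap)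

lemma wedge_sum_right: "wedge p q \<alpha> (\<lambda>Y. \<Sum>a\<in>S. f a Y) X = (\<Sum>a\<in>S. wedge p q \<alpha> (f a) X)"
  unfolding wedge_def
  by (simp add: sum_distrib_left sum_distrib_right sum_divide_distrib) (rule sum.swap)

lemma wedge_scale_left: "wedge p q (\<lambda>Y. c * \<alpha> Y) \<beta> X = c * wedge p q \<alpha> \<beta> X"
  unfolding wedge_def by (simp add: sum_distrib_left mult_ac)

text \<open>Let \<open>t\<close> and \<open>u\<close> be permutations of the two blocks, from the
  Leibniz formulas of the two factors. For fixed \<open>t\<close> and \<open>u\<close> the sum over
  \<sigma> is already the full determinant: the substitution \<sigma> o \<pi>, with \<pi> acting as
  \<open>t\<close> on the first block and as the shifted \<open>u\<close> on the second, only
  reorders it. The p! q! equal contributions cancel the denominator in \<open>wedge\<close>.\<close>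

lemma wedge_Det:
  assumes "length \<rho> = p" "length \<tau> = q"
  shows "wedge p q (Det \<rho>) (Det \<tau>) X = Det (\<rho> @ \<tau>) X"
proof -
  let ?S = "{..<p + q}" and ?f = "\<lambda>i. p + i :: nat"
  let ?a = "\<lambda>\<sigma> t. of_int (sign t) * (\<Prod>i<p. (\<rho> ! i) (X ! \<sigma> (t i)))"
  let ?b = "\<lambda>\<sigma> u. of_int (sign u) * (\<Prod>i<q. (\<tau> ! i) (X ! \<sigma> (p + u i)))"
  have inj: "inj_on ?f {..<q}" by auto
  have bij: "bij_betw ?f {..<q} {p..<p + q}"
    unfolding bij_betw_def by (auto simp: lessThan_atLeast0)
  define shift where "shift t = map_permutation {..<q} ?f t" for t
  have inner: "(\<Sum>\<sigma> | \<sigma> permutes ?S. of_int (sign \<sigma>) *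
      ?a \<sigma> t *
      ?b \<sigma> u) = Det (\<rho> @ \<tau>) X"
    if t: "t permutes {..<p}" and u: "u permutes {..<q}" for t u
  proof -
    have u': "shift u permutes {p..<p + q}"
      unfolding shift_def by (rule map_permutation_permutes[OF bij u])
    have tS: "t permutes ?S" and uS: "shift u permutes ?S"
      by (rule permutes_subset[OF t] permutes_subset[OF u']; auto)+
    define \<pi> where "\<pi> = t \<circ> shift u"
    have \<pi>: "\<pi> permutes ?S" unfolding \<pi>_def by (rule permutes_compose[OF uS tS])
    have sgn: "sign \<pi> = sign t * sign u"
      unfolding \<pi>_def
      using sign_compose[OF permutes_imp_permutation[OF _ tS] permutes_imp_permutation[OF _ uS]]
        sign_map_permutation[OF inj u] by (simp add: shift_def)
    have \<pi>1: "\<pi> i = t i" if "i < p" for i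
      using permutes_not_in[OF u', of i] that by (simp add: \<pi>_def)
    have \<pi>2: "\<pi> (p + i) = p + u i" if "i < q" for i
      using map_permutation_apply[OF inj, of i u] that permutes_not_in[OF t, of "p + u i"]
      by (simp add: \<pi>_def shift_def)
    have split: "(\<Prod>i<p + q. ((\<rho> @ \<tau>) ! i) (X ! \<sigma> (\<pi> i))) =
        (\<Prod>i<p. (\<rho> ! i) (X ! \<sigma> (t i))) * (\<Prod>i<q. (\<tau> ! i) (X ! \<sigma> (p + u i)))" for \<sigma>
    proof -
      have "(\<Prod>i<p + q. ((\<rho> @ \<tau>) ! i) (X ! \<sigma> (\<pi> i))) =
          (\<Prod>i<p. ((\<rho> @ \<tau>) ! i) (X ! \<sigma> (\<pi> i))) * (\<Prod>i = p..<p + q. ((\<rho> @ \<tau>) ! i) (X ! \<sigma> (\<pi> i)))"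
        by (simp add: lessThan_atLeast0 prod.atLeastLessThan_concat)
      also have "(\<Prod>i = p..<p + q. ((\<rho> @ \<tau>) ! i) (X ! \<sigma> (\<pi> i))) =
          (\<Prod>i<q. ((\<rho> @ \<tau>) ! (p + i)) (X ! \<sigma> (\<pi> (p + i))))"
        by (rule prod.reindex_bij_betw[OF bij, symmetric])
      finally show ?thesis using assms by (simp add: nth_append \<pi>1 \<pi>2)
    qed
    have "Det (\<rho> @ \<tau>) X = (\<Sum>\<sigma> | \<sigma> permutes ?S. of_int (sign (\<sigma> \<circ> \<pi>)) * (\<Prod>i<p + q. ((\<rho> @ \<tau>) ! i) (X ! (\<sigma> \<circ> \<pi>) i)))"
      unfolding Det_Leibniz length_append assms by (rule sum_permutations_compose_right[OF \<pi>])
    also have "\<dots> = (\<Sum>\<sigma> | \<sigma> permutes ?S. of_int (sign \<sigma>) *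
      ?a \<sigma> t *
      ?b \<sigma> u)"
    proof (rule sum.cong[OF refl])
      fix \<sigma> assume "\<sigma> \<in> {\<sigma>. \<sigma> permutes ?S}"
      hence "sign (\<sigma> \<circ> \<pi>) = sign \<sigma> * sign \<pi>"
        using \<pi> by (intro sign_compose permutes_imp_permutation[of ?S]) auto
      thus "of_int (sign (\<sigma> \<circ> \<pi>)) * (\<Prod>i<p + q. ((\<rho> @ \<tau>) ! i) (X ! (\<sigma> \<circ> \<pi>) i)) =
        of_int (sign \<sigma>) * ?a \<sigma> t *
         ?b \<sigma> u"
        by (simp only: split sgn o_apply of_int_mult mult_ac)
    qed
    finally show ?thesis by (rule sym)
  qed
  let ?P = "{t. t permutes {..<p}}" and ?Q = "{u. u permutes {..<q}}"
  have D1: "Det \<rho> (map (\<lambda>i. X ! \<sigma> i) [0..<p]) = (\<Sum>t\<in>?P. ?a \<sigma> t)" for \<sigma>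
    unfolding Det_Leibniz assms
  proof (intro sum.cong refl arg_cong2[where f = "(*)"] prod.cong)
    fix t i assume "t \<in> ?P" "i \<in> {..<p}"
    hence "t i < p" using permutes_in_image[of t "{..<p}" i] by auto
    thus "(\<rho> ! i) (map (\<lambda>i. X ! \<sigma> i) [0..<p] ! t i) = (\<rho> ! i) (X ! \<sigma> (t i))" by simp
  qed
  have D2: "Det \<tau> (map (\<lambda>i. X ! \<sigma> i) [p..<p + q]) = (\<Sum>u\<in>?Q. ?b \<sigma> u)" for \<sigma>
    unfolding Det_Leibniz assms
  proof (intro sum.cong refl arg_cong2[where f = "(*)"] prod.cong)
    fix t i assume "t \<in> ?Q" "i \<in> {..<q}"
    hence "t i < q" using permutes_in_image[of t "{..<q}" i] by auto
    thus "(\<tau> ! i) (map (\<lambda>i. X ! \<sigma> i) [p..<p + q] ! t i) = (\<tau> ! i) (X ! \<sigma> (p + t i))" by simp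
  qed
  have dist: "c * sum f ?P * sum g ?Q = (\<Sum>t\<in>?P. \<Sum>u\<in>?Q. c * f t * g u)" for c :: complex and f g
    by (simp only: sum_distrib_left[of c f ?P] sum_product)
  have "(\<Sum>\<sigma> | \<sigma> permutes ?S. of_int (sign \<sigma>) * Det \<rho> (map (\<lambda>i. X ! \<sigma> i) [0..<p]) *
      Det \<tau> (map (\<lambda>i. X ! \<sigma> i) [p..<p + q])) =
    (\<Sum>\<sigma> | \<sigma> permutes ?S. \<Sum>t\<in>?P. \<Sum>u\<in>?Q. of_int (sign \<sigma>) *
      ?a \<sigma> t *
      ?b \<sigma> u)"
    unfolding D1 D2 dist by (rule refl)
  also have "\<dots> = (\<Sum>t\<in>?P. \<Sum>u\<in>?Q. Det (\<rho> @ \<tau>) X)"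
    by (subst sum.swap, rule sum.cong[OF refl], subst sum.swap, rule sum.cong[OF refl])
      (simp only: inner mem_Collect_eq)
  also have "\<dots> = fact p * fact q * Det (\<rho> @ \<tau>) X"
    by (simp add: card_permutations)
  finally show ?thesis unfolding wedge_def by simp
qed

definition interleave :: "('a \<Rightarrow> 'b) \<Rightarrow> ('a \<Rightarrow> 'b) \<Rightarrow> 'a list \<Rightarrow> 'b list" where
  "interleave \<phi> \<eta> as = concat (map (\<lambda>a. [\<phi> a, \<eta> a]) as)"

lemma interleave_simps [simp]:
  "interleave \<phi> \<eta> [] = []"
  "interleave \<phi> \<eta> (a # as) = \<phi> a # \<eta> a # interleave \<phi> \<eta> as"
  "interleave \<phi> \<eta> (as @ bs) = interleave \<phi> \<eta> as @ interleave \<phi> \<eta> bs"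
  "length (interleave \<phi> \<eta> as) = 2 * length as"
  "set (interleave \<phi> \<eta> as) = \<phi> ` set as \<union> \<eta> ` set as"
  by (auto simp: interleave_def, induction as, auto)

text \<open>A multinomial expansion, kept as a sum over words with repetitions because one more
  factor then just prefixes a letter. The words that contribute are sorted out in
  \<open>sum_Det_interleave\<close>.\<close>

lemma wedge_power_sum:
  assumes "finite S"
  shows "wedge_power (\<lambda>X. \<Sum>a\<in>S. Det [\<phi> a, \<eta> a] X) m X =
    (\<Sum>as | set as \<subseteq> S \<and> length as = m. Det (interleave \<phi> \<eta> as) X)"
proof (induction m arbitrary: X)
  case 0
  have "{as. set as \<subseteq> S \<and> length as = 0} = {[]}" by auto
  thus ?case by simp
next
  case (Suc m)
  let ?L = "\<lambda>m. {as. set as \<subseteq> S \<and> length as = m}"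
  have fin: "finite (?L m)" by (rule finite_lists_length_eq[OF assms])
  have "wedge_power (\<lambda>X. \<Sum>a\<in>S. Det [\<phi> a, \<eta> a] X) (Suc m) X =
      wedge 2 (2 * m) (\<lambda>X. \<Sum>a\<in>S. Det [\<phi> a, \<eta> a] X) (\<lambda>X. \<Sum>as\<in>?L m. Det (interleave \<phi> \<eta> as) X) X"
    unfolding wedge_power.simps by (rule wedge_cong) (simp_all add: Suc)
  also have "\<dots> = (\<Sum>a\<in>S. \<Sum>as\<in>?L m. Det (interleave \<phi> \<eta> (a # as)) X)"
    unfolding wedge_sum_left wedge_sum_right by (intro sum.cong refl) (simp add: wedge_Det)
  also have "\<dots> = (\<Sum>(a, as)\<in>S \<times> ?L m. Det (interleave \<phi> \<eta> (a # as)) X)"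
    using fin assms by (simp add: sum.cartesian_product)
  also have "\<dots> = (\<Sum>as\<in>?L (Suc m). Det (interleave \<phi> \<eta> as) X)"
    by (rule sum.reindex_bij_witness[of _ "\<lambda>as. (hd as, tl as)" "\<lambda>(a, as). a # as"])
      (auto simp: length_Suc_conv)
  finally show ?case .
qed

text \<open>Adjacent transpositions generate all rearrangements. The prefix \<open>us\<close> is
  generalised in the induction, so that a common first letter can be pushed into it once
  \<open>move\<close> has brought it to the front of \<open>bs\<close>.\<close>

lemma perm_invariant_of_adjacent:
  assumes swap: "\<And>us a b vs. f (us @ a # b # vs) = f (us @ b # a # vs)" and "mset as = mset bs"
  shows "f as = f bs"
proof -
  have move: "f (us @ cs @ a # vs) = f (us @ a # cs @ vs)" for us cs a vs
  proof (induction cs arbitrary: us)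
    case (Cons c cs)
    show ?case using Cons[of "us @ [c]"] swap[of us c a "cs @ vs"] by simp
  qed simp
  have "f (us @ as) = f (us @ bs)" if "mset as = mset bs" for us as bs
    using that
  proof (induction as arbitrary: us bs)
    case (Cons a as)
    then obtain cs ds where bs: "bs = cs @ a # ds"
      by (metis list.set_intros(1) mset_eq_setD split_list)
    with Cons.prems have "mset as = mset (cs @ ds)" by simp
    from Cons.IH[OF this, of "us @ [a]"] show ?case
      unfolding bs by (simp add: move)
  qed simp
  from this[OF assms(2), of "[]"] show ?thesis by simp
qed

text \<open>Two-forms commute: exchanging neighbouring pairs moves two one-forms past three entries
  each, and the two signs cancel.\<close>

lemma Det_interleave_mset:
  assumes "mset as = mset bs"
  shows "Det (interleave \<phi> \<eta> as) X = Det (interleave \<phi> \<eta> bs) X"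
proof (rule perm_invariant_of_adjacent[of "\<lambda>as. Det (interleave \<phi> \<eta> as) X", OF _ assms])
  fix us a b vs
  let ?u = "interleave \<phi> \<eta> us" and ?v = "interleave \<phi> \<eta> vs"
  have "Det (?u @ \<phi> a # [\<eta> a, \<phi> b, \<eta> b] @ ?v) X = - Det ((?u @ [\<eta> a, \<phi> b, \<eta> b]) @ \<phi> a # ?v) X"
    by (subst Det_move) simp
  also have "Det ((?u @ [\<eta> a, \<phi> b, \<eta> b]) @ \<phi> a # ?v) X = Det (?u @ \<eta> a # [\<phi> b, \<eta> b, \<phi> a] @ ?v) X"
    by simp
  also have "\<dots> = - Det (?u @ [\<phi> b, \<eta> b, \<phi> a] @ \<eta> a # ?v) X"
    by (subst Det_move) simp
  finally show "Det (interleave \<phi> \<eta> (us @ a # b # vs)) X = Det (interleave \<phi> \<eta> (us @ b # a # vs)) X"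
    by simp
qed

lemma Det_interleave_not_distinct:
  assumes "\<not> distinct as"
  shows "Det (interleave \<phi> \<eta> as) X = 0"
proof -
  obtain us a vs ws where "as = us @ [a] @ vs @ [a] @ ws" using not_distinct_decomp[OF assms] by blast
  thus ?thesis
    using Det_equal_rows[of "interleave \<phi> \<eta> us" "\<phi> a" "\<eta> a # interleave \<phi> \<eta> vs" "\<eta> a # interleave \<phi> \<eta> ws"]
    by simp
qed

text \<open>The sign depends only on the length of \<open>as\<close>. In
  \<open>wedge_power_interleave\<close> the separation can therefore be undone after the second
  factors have been replaced.\<close>

lemma Det_interleave_split:
  "Det (\<rho> @ interleave \<phi> \<eta> as) X = (\<Prod>i<length as. (- 1) ^ i) * Det (\<rho> @ map \<phi> as @ map \<eta> as) X"
proof (induction as arbitrary: \<rho>)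
  case (Cons a as)
  have "Det (\<rho> @ interleave \<phi> \<eta> (a # as)) X =
      (\<Prod>i<length as. (- 1) ^ i) * Det ((\<rho> @ [\<phi> a]) @ \<eta> a # map \<phi> as @ map \<eta> as) X"
    using Cons[of "\<rho> @ [\<phi> a, \<eta> a]"] by simp
  also have "\<dots> = (\<Prod>i<length (a # as). (- 1) ^ i) * Det (\<rho> @ map \<phi> (a # as) @ map \<eta> (a # as)) X"
    by (subst Det_move) simp
  finally show ?case .
qed simp

text \<open>A word with a letter outside \<open>ys\<close> gives a zero row, and a word with a
  repeated letter gives two equal rows. What remains are the orderings of \<open>ys\<close>, all
  with the same value.\<close>

lemma sum_Det_interleave:
  assumes fin: "finite S" and V: "length V = 2 * length ys" and ys: "distinct ys" "set ys \<subseteq> S"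
    and zero: "\<And>a v. a \<in> S - set ys \<Longrightarrow> v \<in> set V \<Longrightarrow> \<phi> a v = 0"
  shows "(\<Sum>as | set as \<subseteq> S \<and> length as = length ys. Det (interleave \<phi> \<eta> as) V) =
    fact (length ys) * Det (interleave \<phi> \<eta> ys) V"
proof -
  let ?P = "{as. set as = set ys \<and> length as = length ys}"
  have "(\<Sum>as | set as \<subseteq> S \<and> length as = length ys. Det (interleave \<phi> \<eta> as) V) =
      (\<Sum>as\<in>?P. Det (interleave \<phi> \<eta> as) V)"
  proof (rule sum.mono_neutral_right)
    show "finite {as. set as \<subseteq> S \<and> length as = length ys}" by (rule finite_lists_length_eq[OF fin])
    show "\<forall>as\<in>{as. set as \<subseteq> S \<and> length as = length ys} - ?P. Det (interleave \<phi> \<eta> as) V = 0"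
    proof
      fix as assume as: "as \<in> {as. set as \<subseteq> S \<and> length as = length ys} - ?P"
      show "Det (interleave \<phi> \<eta> as) V = 0"
      proof (cases "set as \<subseteq> set ys")
        case True
        have "\<not> distinct as"
        proof
          assume "distinct as"
          hence "set as = set ys"
            using True as ys(1) by (intro card_subset_eq) (auto simp: distinct_card)
          thus False using as by auto
        qed
        thus ?thesis by (rule Det_interleave_not_distinct)
      next
        case False
        then obtain a where a: "a \<in> set as" "a \<in> S - set ys" using as by auto
        show ?thesis by (rule Det_zero_row[of "\<phi> a"]) (use a zero as V in auto)
      qed
    qed
  qed (use ys in auto)
  also have "?P = {as. mset as = mset ys}"
    using ys(1) by (auto simp: set_eq_iff_mset_eq_distinct card_distinct distinct_card
        intro: mset_eq_setD mset_eq_length dest: mset_eq_setD mset_eq_length)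
       (metis card_distinct distinct_card set_eq_iff_mset_eq_distinct)
  also have "(\<Sum>as | mset as = mset ys. Det (interleave \<phi> \<eta> as) V) =
      of_nat (card {as. mset as = mset ys}) * Det (interleave \<phi> \<eta> ys) V"
    by (subst sum.cong[OF refl, of _ _ "\<lambda>_. Det (interleave \<phi> \<eta> ys) V"])
      (auto intro: Det_interleave_mset)
  also have "{as. mset as = mset ys} = permutations_of_set (set ys)"
    using ys(1) by (auto simp: permutations_of_set_altdef permutations_of_multiset_def mset_set_set)
  also have "card \<dots> = fact (length ys)"
    using ys(1) by (simp add: distinct_card)
  finally show ?thesis by simp
qed

text \<open>Separating first and second factors lets \<open>Det_linear\<close> pull out the minor of
  \<open>c\<close> over \<open>ys\<close>; interleaving again leaves a determinant that does not
  involve \<open>c\<close>.\<close>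

lemma wedge_power_interleave:
  assumes "finite S" and V: "length V = 2 * m" and ys: "length ys = m" "distinct ys" "set ys \<subseteq> S"
    and "\<And>a v. a \<in> S - set ys \<Longrightarrow> v \<in> set V \<Longrightarrow> \<phi> a v = 0"
    and lin: "\<And>a v. a \<in> set ys \<Longrightarrow> v \<in> set V \<Longrightarrow> \<eta> a v = (\<Sum>j<m. c a (ys ! j) * \<psi> (ys ! j) v)"
  shows "wedge_power (\<lambda>X. \<Sum>a\<in>S. Det [\<phi> a, \<eta> a] X) m V =
    fact m * Determinant.det (Matrix.mat m m (\<lambda>(i, j). c (ys ! i) (ys ! j))) * Det (interleave \<phi> \<psi> ys) V"
proof -
  let ?s = "\<Prod>i<m. (- 1) ^ i :: complex"
  have "Det (interleave \<phi> \<eta> ys) V = ?s * Det (map \<phi> ys @ map \<eta> ys) V"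
    using Det_interleave_split[of "[]" \<phi> \<eta> ys V] ys by simp
  also have "Det (map \<phi> ys @ map \<eta> ys) V =
      Determinant.det (Matrix.mat m m (\<lambda>(i, j). c (ys ! i) (ys ! j))) * Det (map \<phi> ys @ map \<psi> ys) V"
    using ys V by (intro Det_linear) (auto simp: lin)
  also have "?s * (Determinant.det (Matrix.mat m m (\<lambda>(i, j). c (ys ! i) (ys ! j))) * Det (map \<phi> ys @ map \<psi> ys) V) =
      Determinant.det (Matrix.mat m m (\<lambda>(i, j). c (ys ! i) (ys ! j))) * (?s * Det (map \<phi> ys @ map \<psi> ys) V)"
    by simp
  also have "?s * Det (map \<phi> ys @ map \<psi> ys) V = Det (interleave \<phi> \<psi> ys) V"
    using Det_interleave_split[of "[]" \<phi> \<psi> ys V] ys by simp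
  finally show ?thesis
    using sum_Det_interleave[of S V ys \<phi> \<eta>] assms wedge_power_sum[of S \<phi> \<eta> m V] by simp
qed

section \<open>Forms of type (1,1) on the fibres\<close>

lemma wedge_dz_dzbar: "wedge 1 1 (dz a) (dzbar b) X = Det [\<lambda>v. v $ a, \<lambda>v. cnj (v $ b)] X"
proof -
  have "wedge 1 1 (dz a) (dzbar b) X = wedge 1 1 (Det [\<lambda>v. v $ a]) (Det [\<lambda>v. cnj (v $ b)]) X"
    by (rule wedge_cong) (auto simp: dz_def dzbar_def Det_single length_Suc_conv)
  thus ?thesis by (simp add: wedge_Det)
qed

text \<open>Summing over b inside the second factor leaves one decomposable two-form per index a,
  the shape required by \<open>wedge_power_sum\<close>.\<close>

lemma form11_Det: "form11 c X = (\<Sum>a\<in>UNIV. Det [\<lambda>v. v $ a, \<lambda>v. \<Sum>b\<in>UNIV. c a b * cnj (v $ b)] X)"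
  unfolding form11_def wedge_dz_dzbar Det_pair
  by (simp add: sum_distrib_left sum_distrib_right sum_subtractf algebra_simps)

definition vertical_frame :: "'r list \<Rightarrow> (complex^('n::finite + 'r::finite)) list" where
  "vertical_frame xs = map (join 0) (real_frame xs)"

lemma vertical_frame_simps [simp]:
  "vertical_frame [] = []"
  "vertical_frame (x # xs) = join 0 (axis x 1) # join 0 (axis x \<i>) # vertical_frame xs"
  by (simp_all add: vertical_frame_def real_frame_def)

lemma length_vertical_frame [simp]: "length (vertical_frame xs) = 2 * length xs"
  by (induction xs) auto

lemma set_vertical_frame:
  "set (vertical_frame xs) = (\<Union>x\<in>set xs. {join 0 (axis x 1), join 0 (axis x \<i>)})"
  by (induction xs) auto

lemma axis_apply: "axis x e $ i = (if i = x then e else 0)"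
  by (simp add: axis_def)

lemma join_nth [simp]: "join z v $ Inl a = z $ a" "join z v $ Inr i = v $ i"
  by (simp_all add: join_def)

text \<open>Coordinates are peeled off one at a time by \<open>Det_block\<close>; on the vectors 1
  and i the pair (v, cnj v) has determinant 1 * (-i) - i * 1 = -2i.\<close>

lemma Det_vertical_frame:
  "distinct xs \<Longrightarrow> Det (interleave (\<lambda>a v. v $ a) (\<lambda>a v. cnj (v $ a)) (map Inr xs))
      (vertical_frame xs :: (complex^('n::finite + 'r::finite)) list) = (- 2 * \<i>) ^ length xs"
proof (induction xs)
  case (Cons x xs)
  let ?I = "interleave (\<lambda>a v. v $ a) (\<lambda>a v. cnj (v $ a))"
  have "Det ([\<lambda>v. v $ Inr x, \<lambda>v. cnj (v $ Inr x)] @ ?I (map Inr xs))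
      ([join 0 (axis x 1), join 0 (axis x \<i>)] @ (vertical_frame xs :: (complex^('n + 'r)) list)) =
    Det [\<lambda>v. v $ Inr x, \<lambda>v. cnj (v $ Inr x)] [join 0 (axis x 1), join 0 (axis x \<i>) :: complex^('n + 'r)] *
    Det (?I (map Inr xs)) (vertical_frame xs :: (complex^('n + 'r)) list)"
    by (rule Det_block) (use Cons.prems in \<open>auto simp: set_vertical_frame axis_apply\<close>)
  thus ?case using Cons by (simp add: Det_pair axis_apply)
qed simp

text \<open>Base coordinates and the fibre coordinates outside \<open>xs\<close> vanish on the
  frame, so of \<open>c\<close> only the minor over \<open>xs\<close> is seen.\<close>

lemma wedge_power_vertical_frame:
  fixes xs :: "'r::finite list" and c :: "'n::finite + 'r \<Rightarrow> 'n + 'r \<Rightarrow> complex"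
  assumes xs: "distinct xs" "length xs = m"
  shows "wedge_power (form11 c) m (vertical_frame xs :: (complex^('n + 'r)) list) =
    fact m * (- 2 * \<i>) ^ m * Determinant.det (Matrix.mat m m (\<lambda>(i, j). c (Inr (xs ! i)) (Inr (xs ! j))))"
proof -
  let ?ys = "map Inr xs :: ('n + 'r) list"
  have "wedge_power (form11 c) m (vertical_frame xs :: (complex^('n + 'r)) list) =
    fact m * Determinant.det (Matrix.mat m m (\<lambda>(i, j). c (?ys ! i) (?ys ! j))) *
      Det (interleave (\<lambda>a v. v $ a) (\<lambda>a v. cnj (v $ a)) ?ys) (vertical_frame xs :: (complex^('n + 'r)) list)"
    unfolding form11_Det[abs_def]
  proof (rule wedge_power_interleave)
    fix a and v :: "complex^('n + 'r)" assume "a \<in> UNIV - set ?ys" "v \<in> set (vertical_frame xs)"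
    thus "v $ a = 0"
      by (cases a) (auto simp: set_vertical_frame axis_apply)
  next
    fix a and v :: "complex^('n + 'r)" assume "v \<in> set (vertical_frame xs)"
    then obtain x e where x: "x \<in> set xs" "v = join 0 (axis x e)" by (auto simp: set_vertical_frame)
    have "(\<Sum>b\<in>UNIV. c a b * cnj (v $ b)) = (\<Sum>b\<in>set ?ys. c a b * cnj (v $ b))"
    proof (rule sum.mono_neutral_right)
      show "\<forall>b\<in>UNIV - set ?ys. c a b * cnj (v $ b) = 0"
      proof
        fix b assume "b \<in> UNIV - set ?ys"
        thus "c a b * cnj (v $ b) = 0" using x by (cases b) (auto simp: axis_apply)
      qed
    qed auto
    also have "\<dots> = (\<Sum>j<m. c a (?ys ! j) * cnj (v $ (?ys ! j)))"
      using xs by (intro sum.reindex_bij_betw[symmetric] bij_betw_nth) (auto simp: distinct_map)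
    finally show "(\<Sum>b\<in>UNIV. c a b * cnj (v $ b)) = (\<Sum>j<m. c a (?ys ! j) * cnj (v $ (?ys ! j)))" .
  qed (use xs in \<open>auto simp: distinct_map\<close>)
  moreover have "Matrix.mat m m (\<lambda>(i, j). c (?ys ! i) (?ys ! j)) = Matrix.mat m m (\<lambda>(i, j). c (Inr (xs ! i)) (Inr (xs ! j)))"
    using xs by (intro eq_matI) auto
  ultimately show ?thesis by (simp add: Det_vertical_frame[OF xs(1)] xs(2))
qed

text \<open>The first factor consists of base one-forms, which vanish on \<open>V\<close>. It
  therefore splits off from every word in the expansion of the power by \<open>Det_block\<close>,
  even where the forms of that word do not vanish on \<open>Y\<close>.\<close>

lemma wedge_horizontal:
  fixes c :: "'n::finite + 'r::finite \<Rightarrow> 'n + 'r \<Rightarrow> complex"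
  assumes "length Y = 2" "length V = 2 * m" and V: "\<And>v a. v \<in> set V \<Longrightarrow> v $ Inl a = 0"
  shows "wedge 2 (2 * m) (\<lambda>X. \<Sum>a\<in>UNIV. \<Sum>b\<in>UNIV. p a b * wedge 1 1 (dz (Inl a)) (dzbar (Inl b)) X)
     (wedge_power (form11 c) m) (Y @ V) =
    (\<Sum>a\<in>UNIV. \<Sum>b\<in>UNIV. p a b * wedge 1 1 (dz (Inl a)) (dzbar (Inl b)) Y) * wedge_power (form11 c) m V"
proof -
  let ?\<phi> = "\<lambda>a (v :: complex^('n + 'r)). v $ a"
  let ?\<eta> = "\<lambda>a v. \<Sum>b\<in>UNIV. c a b * cnj (v $ b)"
  let ?h = "\<lambda>a b. [?\<phi> (Inl a), \<lambda>v. cnj (v $ Inl b)]"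
  let ?L = "{as. set as \<subseteq> (UNIV :: ('n + 'r) set) \<and> length as = m}"
  have pw: "wedge_power (form11 c) m X = (\<Sum>as\<in>?L. Det (interleave ?\<phi> ?\<eta> as) X)" for X
    unfolding form11_Det[abs_def] by (rule wedge_power_sum) simp
  have "wedge 2 (2 * m) (Det (?h a b)) (\<lambda>X. \<Sum>as\<in>?L. Det (interleave ?\<phi> ?\<eta> as) X) (Y @ V) =
      Det (?h a b) Y * (\<Sum>as\<in>?L. Det (interleave ?\<phi> ?\<eta> as) V)" for a b
  proof -
    have "wedge 2 (2 * m) (Det (?h a b)) (\<lambda>X. \<Sum>as\<in>?L. Det (interleave ?\<phi> ?\<eta> as) X) (Y @ V) =
        (\<Sum>as\<in>?L. Det (?h a b @ interleave ?\<phi> ?\<eta> as) (Y @ V))"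
      unfolding wedge_sum_right by (intro sum.cong refl wedge_Det) auto
    also have "\<dots> = (\<Sum>as\<in>?L. Det (?h a b) Y * Det (interleave ?\<phi> ?\<eta> as) V)"
      using assms by (intro sum.cong refl Det_block) auto
    finally show ?thesis by (simp add: sum_distrib_left)
  qed
  thus ?thesis
    unfolding pw[abs_def] wedge_dz_dzbar wedge_sum_left wedge_scale_left
    by (simp add: sum_distrib_right mult.assoc)
qed

section \<open>Comparison of the two determinants\<close>

text \<open>The passage from determinants indexed by a finite type to those indexed by natural
  numbers. Masking row and column k by the identity stands for deleting them, which would change the
  index type; permutations that move k contribute zero.\<close>

lemma det_masked:
  assumes xs: "distinct xs" "set xs = UNIV - {k :: 'r::finite}" "length xs = m"
  shows "det (\<chi> i j. if i = k \<or> j = k then (if i = j then 1 else 0) else (f i j :: complex)) =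
     Determinant.det (Matrix.mat m m (\<lambda>(i, j). f (xs ! i) (xs ! j)))"
proof -
  let ?M = "\<chi> i j. if i = k \<or> j = k then (if i = j then 1 else 0) else (f i j :: complex)"
  let ?S = "UNIV - {k}"
  have bij: "bij_betw (\<lambda>i. xs ! i) {..<m} ?S" using bij_betw_nth[OF xs(1)] xs by auto
  hence inj: "inj_on (\<lambda>i. xs ! i) {..<m}" by (rule bij_betw_imp_inj_on)
  have "det ?M = (\<Sum>p | p permutes UNIV. of_int (sign p) * (\<Prod>i\<in>UNIV. ?M $ i $ p i))"
    by (simp only: det_def)
  also have "\<dots> = (\<Sum>p | p permutes ?S. of_int (sign p) * (\<Prod>i\<in>UNIV. ?M $ i $ p i))"
  proof (rule sum.mono_neutral_right)
    show "\<forall>p\<in>{p. p permutes UNIV} - {p. p permutes ?S}. of_int (sign p) * (\<Prod>i\<in>UNIV. ?M $ i $ p i) = 0"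
    proof
      fix p assume p: "p \<in> {p. p permutes UNIV} - {p. p permutes ?S}"
      have "p k \<noteq> k"
      proof
        assume "p k = k"
        hence "p permutes ?S" using p by (auto simp: permutes_def)
        thus False using p by blast
      qed
      hence "?M $ k $ p k = 0" by simp
      hence "\<exists>i\<in>UNIV. ?M $ i $ p i = 0" by blast
      thus "of_int (sign p) * (\<Prod>i\<in>UNIV. ?M $ i $ p i) = 0"
        by (simp only: prod_zero[OF finite] mult_zero_right)
    qed
    show "{p. p permutes ?S} \<subseteq> {p. p permutes UNIV}"
      using permutes_subset[of _ ?S UNIV] by blast
  qed (simp add: finite_permutations)
  also have "\<dots> = (\<Sum>p | p permutes ?S. of_int (sign p) * (\<Prod>i\<in>?S. f i (p i)))"
  proof (intro sum.cong refl arg_cong2[where f = "(*)"])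
    fix p assume p: "p \<in> {p. p permutes ?S}"
    hence "p k = k" by (auto intro: permutes_not_in)
    hence "(\<Prod>i\<in>UNIV. ?M $ i $ p i) = (\<Prod>i\<in>?S. ?M $ i $ p i)"
      by (intro prod.mono_neutral_right) auto
    also have "\<dots> = (\<Prod>i\<in>?S. f i (p i))"
    proof (rule prod.cong[OF refl])
      fix i assume i: "i \<in> ?S"
      hence "p i \<in> ?S" using p permutes_in_image[of p ?S i] by auto
      thus "?M $ i $ p i = f i (p i)" using i by simp
    qed
    finally show "(\<Prod>i\<in>UNIV. ?M $ i $ p i) = (\<Prod>i\<in>?S. f i (p i))" .
  qed
  also have "\<dots> = (\<Sum>p | p permutes {..<m}. of_int (sign p) * (\<Prod>i<m. f (xs ! i) (xs ! p i)))"
  proof -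
    \<comment> \<open>A permutation of the positions in \<open>xs\<close>, transported to the
      entries of \<open>xs\<close> and extended by the identity.\<close>
    let ?g = "\<lambda>\<pi> x. if x \<in> ?S then xs ! \<pi> (inv_into {..<m} (\<lambda>i. xs ! i) x) else x"
    have img: "(\<lambda>i. xs ! i) ` {..<m} = ?S" using bij by (simp add: bij_betw_def)
    have g: "?g p = map_permutation {..<m} (\<lambda>i. xs ! i) p" for p
      unfolding map_permutation_def img by (auto simp: restrict_id_def fun_eq_iff)
    have "(\<Sum>p | p permutes ?S. of_int (sign p) * (\<Prod>i\<in>?S. f i (p i))) =
      (\<Sum>p | p permutes {..<m}. of_int (sign (?g p)) * (\<Prod>i\<in>?S. f i (?g p i)))"
      using sum.reindex_bij_betw[OF bij_betw_permutations[OF bij], of "\<lambda>p. of_int (sign p) * (\<Prod>i\<in>?S. f i (p i))"]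
      by simp
    also have "\<dots> = (\<Sum>p | p permutes {..<m}. of_int (sign p) * (\<Prod>i<m. f (xs ! i) (xs ! p i)))"
    proof (intro sum.cong refl arg_cong2[where f = "(*)"])
      fix p assume p: "p \<in> {p. p permutes {..<m}}"
      show "of_int (sign (?g p)) = (of_int (sign p) :: complex)"
        unfolding g using sign_map_permutation[OF inj] p by simp
      have "(\<Prod>i\<in>?S. f i (?g p i)) = (\<Prod>i<m. f (xs ! i) (?g p (xs ! i)))"
        by (rule prod.reindex_bij_betw[OF bij, symmetric])
      also have "\<dots> = (\<Prod>i<m. f (xs ! i) (xs ! p i))"
        using bij_betwE[OF bij] by (intro prod.cong refl) (auto simp: inv_into_f_f[OF inj])
      finally show "(\<Prod>i\<in>?S. f i (?g p i)) = (\<Prod>i<m. f (xs ! i) (xs ! p i))" .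
    qed
    finally show ?thesis .
  qed
  also have "\<dots> = Determinant.det (Matrix.mat m m (\<lambda>(i, j). f (xs ! i) (xs ! j)))"
    by (subst det_def'[of _ m]) (auto simp: lessThan_atLeast0 intro!: sum.cong prod.cong arg_cong2[where f = "(*)"])
  finally show ?thesis .
qed

section \<open>Integrals over projective space of inverse powers of Hermitian forms\<close>

section \<open>Positive definite matrices\<close>

lemma sum_delta_mult:
  fixes f :: "'k::finite \<Rightarrow> complex"
  shows "(\<Sum>i\<in>UNIV. (if i = j then c else 0) * f i) = c * f j"
    "(\<Sum>i\<in>UNIV. f i * (if i = j then c else 0)) = f j * c"
  by (simp_all add: if_distrib[where f = "\<lambda>x. x * _"] if_distrib[where f = "\<lambda>x. _ * x"] cong: if_cong)

lemma sesq_add: "sesq A (x + y) z = sesq A x z + sesq A y z" "sesq A z (x + y) = sesq A z x + sesq A z y"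
  by (simp_all add: sesq_def algebra_simps sum.distrib)

lemma sesq_axis_left: "sesq A (axis j y) z = y * (\<Sum>b\<in>UNIV. A $ j $ b * cnj (z $ b))"
proof -
  have "sesq A (axis j y) z = (\<Sum>a\<in>UNIV. (if a = j then y else 0) * (\<Sum>b\<in>UNIV. A $ a $ b * cnj (z $ b)))"
    unfolding sesq_def axis_apply by (simp add: sum_distrib_left mult_ac)
  thus ?thesis by (simp only: sum_delta_mult)
qed

lemma sesq_axis_right: "sesq A z (axis j y) = cnj y * (\<Sum>a\<in>UNIV. A $ a $ j * z $ a)"
proof -
  have "sesq A z (axis j y) = (\<Sum>a\<in>UNIV. A $ a $ j * z $ a * cnj y)"
    unfolding sesq_def axis_apply
    by (intro sum.cong refl) (simp add: if_distrib[where f = cnj] if_distrib[where f = "\<lambda>x. _ * x"] cong: if_cong)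
  thus ?thesis by (simp add: sum_distrib_left mult_ac)
qed

lemma sesq_axis_axis: "sesq A (axis j y) (axis j y) = A $ j $ j * (y * cnj y)"
  by (simp add: sesq_axis_left axis_apply if_distrib[where f = cnj] sum_delta_mult mult_ac cong: if_cong)

lemma sesq_add_add: "sesq A (x + y) (x + y) = sesq A x x + sesq A x y + sesq A y x + sesq A y y"
  by (simp only: sesq_add add_ac)

lemma pos_def_hermitian_cnj: "pos_def_hermitian A \<Longrightarrow> cnj (A $ a $ b) = A $ b $ a"
  unfolding pos_def_hermitian_def by metis

lemma pos_def_hermitian_pos: "pos_def_hermitian A \<Longrightarrow> X \<noteq> 0 \<Longrightarrow> 0 < Re (sesq A X X)"
  unfolding pos_def_hermitian_def by blast

lemma sesq_cnj:
  assumes "\<And>a b. cnj (A $ a $ b) = A $ b $ a"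
  shows "cnj (sesq A X Y) = sesq A Y X"
  unfolding sesq_def by (subst sum.swap) (simp add: assms mult_ac)

lemma hermitian_sesq_real:
  assumes "\<And>a b. cnj (A $ a $ b) = A $ b $ a"
  shows "sesq A X X = of_real (Re (sesq A X X))"
  using sesq_cnj[of A X X, OF assms] by (simp add: complex_eq_iff)

lemma pos_def_hermitian_diag:
  assumes "pos_def_hermitian A"
  shows "A $ j $ j = of_real (Re (A $ j $ j))" "0 < Re (A $ j $ j)"
proof -
  have "axis j 1 \<noteq> (0 :: complex^'a)" by (simp add: axis_eq_0_iff)
  hence "0 < Re (sesq A (axis j 1) (axis j 1))" using assms by (intro pos_def_hermitian_pos)
  thus "0 < Re (A $ j $ j)"
    by (simp add: sesq_axis_left axis_apply if_distrib[where f = cnj] sum_delta_mult cong: if_cong)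
  have "cnj (A $ j $ j) = A $ j $ j" by (rule pos_def_hermitian_cnj[OF assms])
  thus "A $ j $ j = of_real (Re (A $ j $ j))" by (simp add: complex_eq_iff)
qed

text \<open>The Schur complement of the entry (k, k), padded in row and column k by the identity so
  that its type stays the same. It serves twice: for completing the square in the integrals, and for
  the determinant of the Fubini-Study form.\<close>

definition schur :: "complex^'k^'k \<Rightarrow> 'k \<Rightarrow> complex^'k^'k" where
  "schur A k = (\<chi> i j. if i = k \<or> j = k then (if i = j then 1 else 0)
     else A $ i $ j - A $ i $ k * A $ k $ j / A $ k $ k)"

text \<open>Cramer's rule for the identity matrix. It gives determinant 1 to the elementary factors
  in \<open>det_schur\<close> and \<open>det_affine_minor\<close>.\<close>

lemma det_identity_row:
  fixes x :: "'a::field^'b::finite"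
  shows "det (\<chi> i j. if i = k then x $ j else if i = j then 1 else 0) = x $ k"
proof -
  have "(\<chi> i. if i = k then (\<Sum>i\<in>UNIV. x $ i *s row i (mat 1 :: 'a^'b^'b)) else row i (mat 1)) $ i $ j =
      (\<chi> i j. if i = k then x $ j else if i = j then 1 else 0) $ i $ j" for i j
    by (simp add: row_def mat_def if_distrib[where f = "\<lambda>x. _ * x"] cong: if_cong)
  hence "(\<chi> i. if i = k then (\<Sum>i\<in>UNIV. x $ i *s row i (mat 1 :: 'a^'b^'b)) else row i (mat 1)) =
      (\<chi> i j. if i = k then x $ j else if i = j then 1 else 0)"
    unfolding vec_eq_iff by blast
  thus ?thesis using cramer_lemma_transpose[of k x "mat 1"] by simp
qed

lemma matrix_mult_remove:
  "(A ** B) $ i $ j = A $ i $ k * B $ k $ j + (\<Sum>l\<in>UNIV - {k}. A $ i $ l * B $ l $ j)"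
  unfolding matrix_matrix_mult_def vec_lambda_beta by (rule sum.remove) auto

text \<open>One step of Gaussian elimination, A = L D U: \<open>L\<close> and \<open>U\<close>
  differ from the identity only in column k and row k respectively, with 1 on the diagonal, and
  \<open>D\<close> is the Schur complement with its k-th row scaled by the pivot.\<close>

lemma det_schur:
  fixes A :: "complex^'k^'k"
  assumes nz: "A $ k $ k \<noteq> 0"
  shows "det A = A $ k $ k * det (schur A k)"
proof -
  define l where "l = (\<chi> i. if i = k then 1 else A $ i $ k / A $ k $ k)"
  define u where "u = (\<chi> j. A $ k $ j / A $ k $ k)"
  define L where "L = (\<chi> i j. if j = k then l $ i else if j = i then 1 else 0)"
  define U where "U = (\<chi> i j. if i = k then u $ j else if i = j then 1 else 0)"
  define D where "D = (\<chi> i. if i = k then A $ k $ k *s schur A k $ i else schur A k $ i)"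
  have DU: "(D ** U) $ i $ j = (if i = k then A $ k $ j else A $ i $ j - A $ i $ k * A $ k $ j / A $ k $ k)" for i j
  proof -
    have "(\<Sum>l\<in>UNIV - {k}. D $ i $ l * U $ l $ j) = (\<Sum>l\<in>UNIV - {k}. D $ i $ l * (if l = j then 1 else 0))"
      by (rule sum.cong) (auto simp: U_def)
    hence "(D ** U) $ i $ j = D $ i $ k * U $ k $ j + (if j = k then 0 else D $ i $ j)"
      unfolding matrix_mult_remove[of D U i j k]
      by (auto simp: if_distrib[where f = "\<lambda>x. _ * x"] sum.delta cong: if_cong)
    thus ?thesis using nz by (auto simp: D_def U_def u_def schur_def)
  qed
  have "(L ** (D ** U)) $ i $ j = A $ i $ j" for i j
  proof -
    have "(\<Sum>l\<in>UNIV - {k}. L $ i $ l * (D ** U) $ l $ j) = (\<Sum>l\<in>UNIV - {k}. (if l = i then 1 else 0) * (D ** U) $ l $ j)"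
      by (rule sum.cong) (auto simp: L_def)
    hence "(L ** (D ** U)) $ i $ j = L $ i $ k * (D ** U) $ k $ j + (if i = k then 0 else (D ** U) $ i $ j)"
      unfolding matrix_mult_remove[of L "D ** U" i j k]
      by (auto simp: if_distrib[where f = "\<lambda>x. x * _"] sum.delta cong: if_cong)
    thus ?thesis by (simp add: DU L_def l_def)
  qed
  hence "L ** (D ** U) = A" by (simp add: vec_eq_iff)
  hence "det A = det L * (det D * det U)" by (metis det_mul)
  moreover have "det U = 1" unfolding U_def det_identity_row using nz by (simp add: u_def)
  moreover have "det L = 1"
  proof -
    have "transpose L = (\<chi> i j. if i = k then l $ j else if i = j then 1 else 0)"
      by (simp add: transpose_def L_def)
    hence "det (transpose L) = l $ k" by (simp only: det_identity_row)
    thus ?thesis by (simp add: l_def)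
  qed
  moreover have "det D = A $ k $ k * det (schur A k)"
    unfolding D_def by (subst det_row_mul) simp
  ultimately show ?thesis by simp
qed

text \<open>The square is completed in the single variable \<open>y\<close>. Since \<open>u\<close>
  vanishes at j, the padding of the Schur complement is not seen.\<close>

lemma complete_square:
  assumes "pos_def_hermitian A" "u $ j = 0"
  shows "Re (sesq A (u + axis j y) (u + axis j y)) =
    Re (A $ j $ j) * (cmod (y + (\<Sum>a\<in>UNIV. A $ a $ j * u $ a) / A $ j $ j))\<^sup>2 + Re (sesq (schur A j) u u)"
proof -
  let ?a = "A $ j $ j" and ?S = "\<Sum>a\<in>UNIV. A $ a $ j * u $ a"
  let ?\<beta> = "?S / ?a"
  have a: "?a = of_real (Re ?a)" "?a \<noteq> 0" using pos_def_hermitian_diag[OF assms(1), of j] by auto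
  have ca: "cnj ?a = ?a" using pos_def_hermitian_cnj[OF assms(1)] .
  have S': "(\<Sum>b\<in>UNIV. A $ j $ b * cnj (u $ b)) = cnj ?S"
    by (simp add: pos_def_hermitian_cnj[OF assms(1)])
  have "sesq A (u + axis j y) (u + axis j y) = sesq A u u + cnj y * ?S + y * cnj ?S + ?a * (y * cnj y)"
    by (simp only: sesq_add_add sesq_axis_axis sesq_axis_left[where z = u] sesq_axis_right[where z = u] S')
  moreover have "sesq (schur A j) u u = sesq A u u - ?S * cnj ?S / ?a"
  proof -
    have "sesq (schur A j) u u = (\<Sum>a\<in>UNIV. \<Sum>b\<in>UNIV. (A $ a $ b - A $ a $ j * A $ j $ b / ?a) * u $ a * cnj (u $ b))"
      unfolding sesq_def by (intro sum.cong refl) (use assms(2) in \<open>auto simp: schur_def\<close>)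
    also have "\<dots> = sesq A u u - (\<Sum>a\<in>UNIV. \<Sum>b\<in>UNIV. (A $ a $ j * u $ a) * (A $ j $ b * cnj (u $ b))) / ?a"
      by (simp add: sesq_def sum_subtractf sum_divide_distrib algebra_simps)
    also have "(\<Sum>a\<in>UNIV. \<Sum>b\<in>UNIV. (A $ a $ j * u $ a) * (A $ j $ b * cnj (u $ b))) = ?S * cnj ?S"
      by (simp only: S'[symmetric] sum_product)
    finally show ?thesis .
  qed
  moreover have "of_real (Re ?a * (cmod (y + ?\<beta>))\<^sup>2) = ?a * ((y + ?\<beta>) * cnj (y + ?\<beta>))"
    by (simp only: complex_norm_square of_real_mult a(1)[symmetric])
  moreover have "?a * ((y + ?\<beta>) * cnj (y + ?\<beta>)) = ?a * (y * cnj y) + y * cnj ?S + cnj y * ?S + ?S * cnj ?S / ?a"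
    using a(2) by (simp add: ca field_simps)
  ultimately have "sesq A (u + axis j y) (u + axis j y) =
      of_real (Re ?a * (cmod (y + ?\<beta>))\<^sup>2) + sesq (schur A j) u u"
    by (simp add: algebra_simps)
  thus ?thesis by simp
qed

lemma vec_split_axis: "X = (\<chi> i. if i = j then 0 else X $ i) + axis j (X $ j :: 'a :: monoid_add)"
  by (simp add: vec_eq_iff axis_def)

text \<open>On a nonzero vector with u_j = 0 the Schur complement is the value of A at u + y e_j for
  the \<open>y\<close> that kills the square, hence positive; the padding adds the independent term
  |X_j|^2.\<close>

lemma pos_def_hermitian_schur:
  assumes A: "pos_def_hermitian A"
  shows "pos_def_hermitian (schur A j)"
  unfolding pos_def_hermitian_def
proof (intro conjI allI impI)
  show "schur A j $ a $ b = cnj (schur A j $ b $ a)" for a b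
    by (simp add: schur_def pos_def_hermitian_cnj[OF A])
next
  fix X :: "complex^'a" assume X: "X \<noteq> 0"
  define u where "u = (\<chi> i. if i = j then 0 else X $ i)"
  have Xu: "X = u + axis j (X $ j)" unfolding u_def by (rule vec_split_axis)
  have uj: "u $ j = 0" by (simp add: u_def)
  have r: "(\<Sum>b\<in>UNIV. schur A j $ j $ b * cnj (v $ b)) = cnj (v $ j)" for v
    by (simp add: schur_def sum_delta_mult(1)[where c = 1, simplified] if_distrib[where f = "\<lambda>x. x * _"] cong: if_cong)
  have r': "(\<Sum>b\<in>UNIV. schur A j $ b $ j * v $ b) = v $ j" for v
    by (simp add: schur_def if_distrib[where f = "\<lambda>x. x * _"] cong: if_cong)
  have jj: "schur A j $ j $ j = 1" by (simp add: schur_def)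
  have eq: "sesq (schur A j) X X = of_real ((cmod (X $ j))\<^sup>2) + sesq (schur A j) u u"
    by (subst (1 2) Xu) (simp add: sesq_add_add sesq_axis_axis sesq_axis_left[where z = u] sesq_axis_right[where z = u] r r' uj
        complex_norm_square jj del: of_real_power)
  let ?\<beta> = "(\<Sum>a\<in>UNIV. A $ a $ j * u $ a) / A $ j $ j"
  have su: "Re (sesq (schur A j) u u) = Re (sesq A (u + axis j (- ?\<beta>)) (u + axis j (- ?\<beta>)))"
    by (subst complete_square[OF A uj]) simp
  show "0 < Re (sesq (schur A j) X X)"
  proof (cases "u = 0")
    case True
    hence "X $ j \<noteq> 0" using X Xu by (auto simp: axis_eq_0_iff)
    thus ?thesis unfolding eq using True by (simp add: sesq_def)
  next
    case False
    then obtain i where i: "u $ i \<noteq> 0" by (auto simp: vec_eq_iff)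
    hence "(u + axis j (- ?\<beta>)) $ i \<noteq> 0" using uj by (cases "i = j") (auto simp: axis_apply)
    hence "u + axis j (- ?\<beta>) \<noteq> 0" by (metis zero_index)
    hence "0 < Re (sesq (schur A j) u u)" unfolding su by (intro pos_def_hermitian_pos[OF A])
    thus ?thesis unfolding eq by (simp add: add_nonneg_pos)
  qed
qed

section \<open>Integrals of inverse powers of Hermitian forms\<close>

lemma nn_integral_radial:
  fixes f :: "real \<Rightarrow> ennreal"
  assumes [measurable]: "f \<in> borel_measurable borel"
  shows "(\<integral>\<^sup>+ w. f ((cmod w)\<^sup>2) \<partial>lborel) = ennreal pi * (\<integral>\<^sup>+ x. f x * indicator {0..} x \<partial>lborel)"
proof -
  \<comment> \<open>The minus sign turns the rays \<open>{x<..}\<close> into discs. These have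
    finite area, as needed to identify two measures by their values on rays.\<close>
  let ?M = "distr lborel borel (\<lambda>w. - (cmod w)\<^sup>2)"
  let ?N = "density lborel (\<lambda>x :: real. ennreal pi * indicator {..0} x)"
  have M: "emeasure ?M {x<..} = ennreal (pi * max 0 (- x))" for x
  proof -
    have "emeasure ?M {x<..} = emeasure lborel {w. (cmod w)\<^sup>2 < - x}"
      by (subst emeasure_distr) (auto intro!: arg_cong[where f = "emeasure lborel"])
    also have "\<dots> = ennreal (pi * max 0 (- x))"
    proof (cases "x < 0")
      case True
      have "{w. (cmod w)\<^sup>2 < - x} = ball 0 (sqrt (- x))"
      proof safe
        fix w :: complex assume "(cmod w)\<^sup>2 < - x"
        thus "w \<in> ball 0 (sqrt (- x))" by (auto simp: real_less_rsqrt)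
      next
        fix w :: complex assume "w \<in> ball 0 (sqrt (- x))"
        hence "cmod w < sqrt (- x)" by simp
        hence "(cmod w)\<^sup>2 < (sqrt (- x))\<^sup>2" by (intro power_strict_mono) auto
        thus "(cmod w)\<^sup>2 < - x" using True by simp
      qed
      thus ?thesis using True by (simp add: emeasure_ball unit_ball_vol_2)
    next
      case False
      have "\<not> (cmod w)\<^sup>2 < - x" for w using False zero_le_power2[of "cmod w"] by linarith
      hence "{w. (cmod w)\<^sup>2 < - x} = {}" by auto
      thus ?thesis using False by (simp add: max_def)
    qed
    finally show ?thesis .
  qed
  have N: "emeasure ?N {x<..} = ennreal (pi * max 0 (- x))" for x
  proof -
    have "emeasure ?N {x<..} = (\<integral>\<^sup>+ y. ennreal pi * indicator {x<..0} y \<partial>lborel)"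
      by (subst emeasure_density) (auto intro!: nn_integral_cong simp: indicator_def)
    also have "\<dots> = ennreal pi * emeasure lborel {x<..0}"
      by (subst nn_integral_cmult_indicator) auto
    also have "\<dots> = ennreal (pi * max 0 (- x))"
      by (cases "x \<le> 0") (auto simp: ennreal_mult'[symmetric] max_def)
    finally show ?thesis .
  qed
  have MN: "?M = ?N" by (rule measure_eqI_lessThan) (auto simp: M N)
  have "(\<integral>\<^sup>+ w. f ((cmod w)\<^sup>2) \<partial>lborel) = (\<integral>\<^sup>+ y. f (- y) \<partial>?M)"
    by (subst nn_integral_distr) auto
  also have "\<dots> = (\<integral>\<^sup>+ y. ennreal pi * indicator {..0} y * f (- y) \<partial>lborel)"
    unfolding MN by (subst nn_integral_density) auto
  also have "\<dots> = (\<integral>\<^sup>+ x. ennreal pi * (f x * indicator {0..} x) \<partial>lborel)"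
    by (subst nn_integral_real_affine[where c = "-1" and t = 0])
      (auto intro!: nn_integral_cong simp: indicator_def mult_ac)
  also have "\<dots> = ennreal pi * (\<integral>\<^sup>+ x. f x * indicator {0..} x \<partial>lborel)"
    by (rule nn_integral_cmult) auto
  finally show ?thesis .
qed

text \<open>The effect of integrating out one coordinate after completing the square: the exponent
  drops by one and a factor pi / (a p) appears.\<close>

lemma nn_integral_inverse_quadratic:
  fixes b :: complex
  assumes "0 < a" "0 < c" "0 < p"
  shows "(\<integral>\<^sup>+ w. ennreal (1 / (a * (cmod (w + b))\<^sup>2 + c) ^ Suc p) \<partial>lborel) = ennreal (pi / (a * p * c ^ p))"
proof -
  let ?f = "\<lambda>x. ennreal (1 / (a * x + c) ^ Suc p)"
  let ?F = "\<lambda>x. - 1 / (a * p * (a * x + c) ^ p)"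
  have "(\<integral>\<^sup>+ w. ?f ((cmod (w + b))\<^sup>2) \<partial>lborel) = (\<integral>\<^sup>+ w. ?f ((cmod (b + w))\<^sup>2) \<partial>lborel)"
    by (simp add: add.commute)
  also have "\<dots> = (\<integral>\<^sup>+ w. ?f ((cmod w)\<^sup>2) \<partial>distr lborel borel ((+) b))"
    by (subst nn_integral_distr) auto
  also have "\<dots> = ennreal pi * (\<integral>\<^sup>+ x. ?f x * indicator {0..} x \<partial>lborel)"
    unfolding lborel_distr_plus by (rule nn_integral_radial) auto
  also have "(\<integral>\<^sup>+ x. ?f x * indicator {0..} x \<partial>lborel) = ennreal (0 - ?F 0)"
  proof (rule nn_integral_FTC_atLeast)
    fix x :: real assume "0 \<le> x"
    hence pos: "a * x + c > 0" using assms by (simp add: add_nonneg_pos)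
    show "0 \<le> 1 / (a * x + c) ^ Suc p" using pos by simp
    have "(?F has_real_derivative 
       (a * p * (p * (a * x + c) ^ (p - 1) * a)) / (a * p * (a * x + c) ^ p)\<^sup>2) (at x)"
      using pos assms by (auto intro!: derivative_eq_intros simp: power2_eq_square)
    also have "(a * p * (p * (a * x + c) ^ (p - 1) * a)) / (a * p * (a * x + c) ^ p)\<^sup>2 = 1 / (a * x + c) ^ Suc p"
    proof -
      obtain q where q: "p = Suc q" using assms(3) by (cases p) auto
      have "(a * P * (P * D ^ q * a)) / (a * P * D ^ Suc q)\<^sup>2 = 1 / D ^ Suc (Suc q)" if "D > 0" "P > 0" for D P :: real
        using that assms(1) by (simp add: field_simps power2_eq_square)
      from this[OF pos, of "real p"] show ?thesis using assms(3) unfolding q by simp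
    qed
    finally show "(?F has_real_derivative 1 / (a * x + c) ^ Suc p) (at x)" .
  next
    have 1: "filterlim (\<lambda>x. a * x + c) at_top at_top"
      using filterlim_tendsto_add_at_top[OF tendsto_const[of c]
          filterlim_tendsto_pos_mult_at_top[OF tendsto_const assms(1) filterlim_ident]]
      by (simp add: add.commute)
    have 2: "filterlim (\<lambda>x. (a * x + c) ^ p) at_top at_top"
      by (rule filterlim_pow_at_top[OF assms(3) 1])
    have "filterlim (\<lambda>x. (a * p) * (a * x + c) ^ p) at_top at_top"
      by (rule filterlim_tendsto_pos_mult_at_top[OF tendsto_const _ 2]) (use assms in auto)
    thus "(?F \<longlongrightarrow> 0) at_top"
      by (intro real_tendsto_divide_at_top[OF tendsto_const])
  qed auto
  also have "ennreal pi * ennreal (0 - ?F 0) = ennreal (pi / (a * p * c ^ p))"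
    using assms by (simp add: ennreal_mult'[symmetric])
  finally show ?thesis .
qed

text \<open>\<open>S\<close> holds the coordinates that vary; all others, except the normalised
  k-th, are frozen at 0. This allows an induction over \<open>S\<close> without changing the
  type.\<close>

definition affine_point :: "'k \<Rightarrow> 'k set \<Rightarrow> ('k \<Rightarrow> complex) \<Rightarrow> complex^'k::finite" where
  "affine_point k S w = (\<chi> i. if i = k then 1 else if i \<in> S then w i else 0)"

lemma affine_point_nth: "affine_point k S w $ i = (if i = k then 1 else if i \<in> S then w i else 0)"
  by (simp add: affine_point_def)

lemma affine_point_nonzero: "affine_point k S w \<noteq> 0"
proof
  assume "affine_point k S w = 0"
  hence "affine_point k S w $ k = 0" by simp
  thus False by (simp add: affine_point_nth)
qed

lemma affine_point_insert:
  "j \<noteq> k \<Longrightarrow> j \<notin> S \<Longrightarrow> affine_point k (insert j S) (x(j := y)) = affine_point k S x + axis j y"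
  by (auto simp: vec_eq_iff affine_point_nth axis_apply)

lemma affine_point_nth_measurable [measurable]:
  "(\<lambda>w. affine_point k S w $ i) \<in> borel_measurable (\<Pi>\<^sub>M i\<in>S. lborel)"
  unfolding affine_point_nth
  by (cases "i = k"; cases "i \<in> S") (auto intro!: measurable_component_singleton[THEN measurable_compose])

lemma sesq_measurable [measurable]:
  "(\<lambda>w. sesq A (affine_point k S w) (affine_point k S w)) \<in> borel_measurable (\<Pi>\<^sub>M i\<in>S. lborel)"
proof -
  have [measurable]: "cnj \<in> borel_measurable borel"
    by (intro borel_measurable_continuous_onI continuous_intros)
  show ?thesis unfolding sesq_def by measurable
qed

text \<open>Integrating out coordinate j replaces A by its Schur complement, which is the identity
  outside the remaining coordinates, and splits the pivot off the determinant. The exponent counts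
  the active coordinates including k, so it falls in step. That the determinant is a positive real
  number comes out of the same recursion.\<close>

lemma nn_integral_inverse_hermitian_aux:
  assumes "finite S" "k \<notin> S" "pos_def_hermitian A"
    and "\<And>i j. i \<notin> insert k S \<or> j \<notin> insert k S \<Longrightarrow> A $ i $ j = (if i = j then 1 else 0)"
  shows "\<exists>d>0. det A = of_real d \<and>
    (\<integral>\<^sup>+ w. ennreal (1 / Re (sesq A (affine_point k S w) (affine_point k S w)) ^ Suc (card S)) \<partial>(\<Pi>\<^sub>M i\<in>S. lborel)) =
    ennreal (pi ^ card S / (fact (card S) * d))"
  using assms
proof (induction S arbitrary: A)
  case empty
  let ?a = "Re (A $ k $ k)"
  have off: "A $ i $ j = 0" if "i \<noteq> j" for i j using empty(3)[of i j] that by auto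
  have one: "A $ i $ i = 1" if "i \<noteq> k" for i using empty(3)[of i i] that by auto
  have "det A = (\<Prod>i\<in>UNIV. A $ i $ i)" by (rule det_diagonal[OF off])
  also have "\<dots> = A $ k $ k" by (simp add: prod.remove[of UNIV k] one)
  finally have det: "det A = of_real ?a" using pos_def_hermitian_diag(1)[OF empty(2), of k] by simp
  have v: "affine_point k {} w = axis k 1" for w
    by (auto simp: vec_eq_iff affine_point_nth axis_apply)
  have "sesq A (axis k 1) (axis k 1) = A $ k $ k" by (simp add: sesq_axis_axis)
  thus ?case using det pos_def_hermitian_diag(2)[OF empty(2), of k]
    by (intro exI[of _ ?a]) (simp add: v PiM_empty nn_integral_count_space_finite)
next
  case (insert j S)
  interpret product_sigma_finite "\<lambda>_ :: 'a. lborel :: complex measure" by standard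
  let ?a = "Re (A $ j $ j)" and ?B = "schur A j"
  let ?v = "affine_point k S" and ?c = "\<lambda>x. Re (sesq ?B (affine_point k S x) (affine_point k S x))"
  have jk: "j \<noteq> k" "k \<notin> S" and jS: "j \<notin> S" using insert by auto
  have a: "A $ j $ j = of_real ?a" "0 < ?a" using pos_def_hermitian_diag[OF insert(5)] by auto
  have B: "pos_def_hermitian ?B" by (rule pos_def_hermitian_schur[OF insert(5)])
  have "?B $ i $ l = (if i = l then 1 else 0)" if "i \<notin> insert k S \<or> l \<notin> insert k S" for i l
    using that insert.prems(3)[of i l] insert.prems(3)[of i j] insert.prems(3)[of j l] by (auto simp: schur_def)
  from insert.IH[OF jk(2) B this]
  obtain d where d: "d > 0" "det ?B = of_real d"
    "(\<integral>\<^sup>+ w. ennreal (1 / ?c w ^ Suc (card S)) \<partial>(\<Pi>\<^sub>M i\<in>S. lborel)) = ennreal (pi ^ card S / (fact (card S) * d))"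
    by blast
  have c: "?c x > 0" for x by (rule pos_def_hermitian_pos[OF B affine_point_nonzero])
  have det: "det A = of_real (?a * d)"
    using det_schur[of A j] a d(2) by (metis of_real_0 of_real_eq_iff of_real_mult order_less_irrefl)
  have card: "card (insert j S) = Suc (card S)" using insert by simp
  let ?f = "\<lambda>w. ennreal (1 / Re (sesq A (affine_point k (insert j S) w) (affine_point k (insert j S) w)) ^ Suc (card (insert j S)))"
  have inner: "(\<integral>\<^sup>+ y. ?f (x(j := y)) \<partial>lborel) = ennreal (pi / (?a * Suc (card S))) * ennreal (1 / ?c x ^ Suc (card S))" for x
  proof -
    have "?v x $ j = 0" using jk jS by (simp add: affine_point_nth)
    note cs = complete_square[OF insert(5) this]
    have "(\<integral>\<^sup>+ y. ?f (x(j := y)) \<partial>lborel) = ennreal (pi / (?a * Suc (card S) * ?c x ^ Suc (card S)))"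
      unfolding affine_point_insert[OF jk(1) jS] cs card
      by (rule nn_integral_inverse_quadratic) (use a c in auto)
    also have "\<dots> = ennreal (pi / (?a * Suc (card S))) * ennreal (1 / ?c x ^ Suc (card S))"
      using a c[of x] by (subst ennreal_mult'[symmetric]) (auto simp: field_simps)
    finally show ?thesis .
  qed
  have "(\<integral>\<^sup>+ w. ?f w \<partial>(\<Pi>\<^sub>M i\<in>insert j S. lborel)) = (\<integral>\<^sup>+ x. (\<integral>\<^sup>+ y. ?f (x(j := y)) \<partial>lborel) \<partial>(\<Pi>\<^sub>M i\<in>S. lborel))"
    by (rule product_nn_integral_insert[OF insert(1) jS]) measurable
  also have "\<dots> = ennreal (pi / (?a * Suc (card S))) * ennreal (pi ^ card S / (fact (card S) * d))"
    unfolding inner d(3)[symmetric] by (rule nn_integral_cmult) measurable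
  also have "\<dots> = ennreal (pi ^ card (insert j S) / (fact (card (insert j S)) * (?a * d)))"
    unfolding card using a d by (subst ennreal_mult'[symmetric]) (auto simp: field_simps)
  finally show ?case using det a d(1) by (intro exI[of _ "?a * d"]) simp
qed

lemma card_UNIV_minus: "Suc (card (UNIV - {k :: 'k::finite})) = CARD('k)"
  by (simp add: card_Diff_singleton)

lemma det_pos_def_hermitian:
  assumes "pos_def_hermitian (A :: complex^'k::finite^'k)"
  shows "\<exists>d>0. det A = of_real d"
  using nn_integral_inverse_hermitian_aux[of "UNIV - {undefined}" undefined A] assms by auto

lemma integral_inverse_hermitian:
  fixes A :: "complex^'k::finite^'k" and k :: 'k
  assumes A: "pos_def_hermitian A"
  defines "v \<equiv> affine_point k (UNIV - {k})" and "m \<equiv> card (UNIV - {k})"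
  shows "has_bochner_integral (\<Pi>\<^sub>M i\<in>UNIV - {k}. lborel)
    (\<lambda>w. 1 / complex_of_real (Re (sesq A (v w) (v w)) ^ CARD('k))) (of_real (pi ^ m / fact m) / det A)"
proof -
  obtain d where d: "d > 0" "det A = of_real d"
    "(\<integral>\<^sup>+ w. ennreal (1 / Re (sesq A (v w) (v w)) ^ Suc m) \<partial>(\<Pi>\<^sub>M i\<in>UNIV - {k}. lborel)) = ennreal (pi ^ m / (fact m * d))"
    using nn_integral_inverse_hermitian_aux[of "UNIV - {k}" k A] A unfolding v_def m_def by auto
  have "has_bochner_integral (\<Pi>\<^sub>M i\<in>UNIV - {k}. lborel) (\<lambda>w. 1 / Re (sesq A (v w) (v w)) ^ Suc m) (pi ^ m / (fact m * d))"
  proof (rule has_bochner_integral_nn_integral)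
    show "AE w in (\<Pi>\<^sub>M i\<in>UNIV - {k}. lborel). 0 \<le> 1 / Re (sesq A (v w) (v w)) ^ Suc m"
      using pos_def_hermitian_pos[OF A affine_point_nonzero] unfolding v_def
      by (intro AE_I2 divide_nonneg_nonneg zero_le_power) (auto intro: less_imp_le)
  qed (use d in \<open>auto simp: v_def\<close>)
  hence "has_bochner_integral (\<Pi>\<^sub>M i\<in>UNIV - {k}. lborel)
      (\<lambda>w. complex_of_real (1 / Re (sesq A (v w) (v w)) ^ Suc m)) (of_real (pi ^ m / (fact m * d)))"
    by (rule has_bochner_integral_of_real)
  thus ?thesis using d card_UNIV_minus[of k] unfolding m_def by simp
qed

section \<open>Derivatives of determinants and inverses\<close>

lemma matrix_diff_ldistrib: "A ** (B - C) = A ** B - A ** (C :: 'a::ring_1^'n^'m)"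
  by (simp add: matrix_matrix_mult_def vec_eq_iff algebra_simps sum_subtractf)

lemma matrix_diff_rdistrib: "(B - C) ** A = B ** A - (C :: 'a::ring_1^'n^'m) ** A"
  by (simp add: matrix_matrix_mult_def vec_eq_iff algebra_simps sum_subtractf)

lemma matrix_inv_both:
  fixes A :: "'a::field^'k^'k"
  assumes "det A \<noteq> 0"
  shows "A ** matrix_inv A = mat 1" "matrix_inv A ** A = mat 1"
proof -
  have "\<exists>B. A ** B = mat 1 \<and> B ** A = mat 1"
    using assms unfolding invertible_det_nz[symmetric] invertible_def .
  from someI_ex[OF this] show "A ** matrix_inv A = mat 1" "matrix_inv A ** A = mat 1"
    by (auto simp: matrix_inv_def)
qed

lemma det_has_derivative:
  fixes A :: "'a::real_normed_vector \<Rightarrow> complex^'k::finite^'k"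
  assumes "\<And>i j. ((\<lambda>x. A x $ i $ j) has_derivative (\<lambda>h. A' h $ i $ j)) (at x within S)"
  shows "((\<lambda>x. det (A x)) has_derivative (\<lambda>h. \<Sum>i\<in>UNIV. det (\<chi> r. if r = i then A' h $ r else A x $ r))) (at x within S)"
proof -
  have "((\<lambda>x. \<Sum>p | p permutes UNIV. of_int (sign p) * (\<Prod>i\<in>UNIV. A x $ i $ p i)) has_derivative
    (\<lambda>h. \<Sum>p | p permutes UNIV. of_int (sign p) * (\<Sum>i\<in>UNIV. A' h $ i $ p i * (\<Prod>j\<in>UNIV - {i}. A x $ j $ p j))))
    (at x within S)"
    by (intro has_derivative_sum has_derivative_mult_right has_derivative_prod assms)
  moreover have "(\<Sum>p | p permutes UNIV. of_int (sign p) * (\<Sum>i\<in>UNIV. A' h $ i $ p i * (\<Prod>j\<in>UNIV - {i}. A x $ j $ p j))) =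
     (\<Sum>i\<in>UNIV. det (\<chi> r. if r = i then A' h $ r else A x $ r))" for h
  proof -
    have "(\<Prod>j\<in>UNIV. (\<chi> r. if r = i then A' h $ r else A x $ r) $ j $ p j) =
        A' h $ i $ p i * (\<Prod>j\<in>UNIV - {i}. A x $ j $ p j)" for i p
      by (subst prod.remove[of UNIV i]) auto
    thus ?thesis unfolding det_def sum_distrib_left by (subst sum.swap) simp
  qed
  ultimately show ?thesis unfolding det_def[of "A _"] by simp
qed

text \<open>Row i of B combines the rows of A with the coefficients in row i of B A^-1; by Cramer's
  rule only the i-th coefficient survives.\<close>

lemma det_replace_row:
  fixes A B :: "'a::field^'k^'k"
  assumes "det A \<noteq> 0"
  shows "det (\<chi> r. if r = i then B $ r else A $ r) = (B ** matrix_inv A) $ i $ i * det A"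
proof -
  define x where "x = (B ** matrix_inv A) $ i"
  have "(\<Sum>j\<in>UNIV. x $ j *s row j A) $ l = B $ i $ l" for l
  proof -
    have "(\<Sum>j\<in>UNIV. x $ j *s row j A) $ l = (B ** matrix_inv A ** A) $ i $ l"
      by (simp add: x_def matrix_matrix_mult_def[of "B ** matrix_inv A"] row_def)
    thus ?thesis by (simp add: matrix_mul_assoc[symmetric] matrix_inv_both[OF assms])
  qed
  hence "(\<Sum>j\<in>UNIV. x $ j *s row j A) = B $ i" by (simp add: vec_eq_iff)
  moreover have "row r A = A $ r" for r by (simp add: row_def vec_eq_iff)
  ultimately have "(\<chi> r. if r = i then \<Sum>j\<in>UNIV. x $ j *s row j A else row r A) = (\<chi> r. if r = i then B $ r else A $ r)"
    by (auto simp: vec_eq_iff)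
  thus ?thesis using cramer_lemma_transpose[of i x A] by (simp add: x_def)
qed

text \<open>Jacobi's formula. It yields the first moment and, integrated along a curve, the
  logarithm of the determinant.\<close>

lemma det_has_derivative_trace:
  fixes A :: "'a::real_normed_vector \<Rightarrow> complex^'k::finite^'k"
  assumes "\<And>i j. ((\<lambda>x. A x $ i $ j) has_derivative (\<lambda>h. A' h $ i $ j)) (at x within S)" "det (A x) \<noteq> 0"
  shows "((\<lambda>x. det (A x)) has_derivative (\<lambda>h. det (A x) * trace (A' h ** matrix_inv (A x)))) (at x within S)"
  using det_has_derivative[of A A' x S, OF assms(1)] unfolding det_replace_row[OF assms(2)]
  by (simp add: trace_def sum_distrib_left mult.commute)

lemma matrix_inv_cramer:
  fixes A :: "'a::field^'k^'k"
  assumes "det A \<noteq> 0"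
  shows "matrix_inv A $ k $ j = det (\<chi> i l. if l = k then (if i = j then 1 else 0) else A $ i $ l) / det A"
proof -
  have "A *v (matrix_inv A *v axis j 1) = axis j 1"
    by (simp add: matrix_vector_mul_assoc matrix_inv_both[OF assms])
  hence "(matrix_inv A *v axis j 1) = (\<chi> k. det (\<chi> i l. if l = k then axis j 1 $ i else A $ i $ l) / det A)"
    unfolding cramer[OF assms] .
  hence "(matrix_inv A *v axis j 1) $ k = det (\<chi> i l. if l = k then axis j 1 $ i else A $ i $ l) / det A"
    by (simp only: vec_lambda_beta)
  thus ?thesis
    by (simp add: matrix_vector_mult_def axis_apply if_distrib[where f = "\<lambda>x. _ * x"] cong: if_cong)
qed

lemma matrix_mult_triple:
  "(X ** Y ** Z) $ i $ j = (\<Sum>k\<in>UNIV. \<Sum>l\<in>UNIV. X $ i $ k * Y $ k $ l * Z $ l $ j)"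
  unfolding matrix_matrix_mult_def vec_lambda_beta sum_distrib_right by (rule sum.swap)

text \<open>Cramer's rule gives some derivative \<open>D\<close>. Its value then comes from the
  identity A(y)^-1 = A(x)^-1 - A(y)^-1 (A(y) - A(x)) A(x)^-1 on \<open>S\<close>, in whose
  derivative at x the unknown \<open>D\<close> meets only the factor A(x) - A(x) = 0.\<close>

lemma matrix_inv_has_derivative:
  fixes A :: "'a::real_normed_vector \<Rightarrow> complex^'k::finite^'k"
  assumes A: "\<And>i j. ((\<lambda>x. A x $ i $ j) has_derivative (\<lambda>h. A' h $ i $ j)) (at x within S)"
    and nz: "\<And>y. y \<in> S \<Longrightarrow> det (A y) \<noteq> 0" and x: "x \<in> S"
  shows "((\<lambda>x. matrix_inv (A x) $ i $ j) has_derivative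
    (\<lambda>h. - (matrix_inv (A x) ** A' h ** matrix_inv (A x)) $ i $ j)) (at x within S)"
proof -
  let ?B = "\<lambda>y. matrix_inv (A y)"
  have ex: "\<exists>D. ((\<lambda>y. ?B y $ k $ j) has_derivative D) (at x within S)" for k j
  proof -
    let ?M = "\<lambda>y. \<chi> i l. if l = k then (if i = j then 1 else 0) else A y $ i $ l"
    let ?M' = "\<lambda>h. \<chi> i l. if l = k then 0 else A' h $ i $ l"
    have "((\<lambda>y. ?M y $ i $ l) has_derivative (\<lambda>h. ?M' h $ i $ l)) (at x within S)" for i l
      using A[of i l] by (cases "l = k") auto
    note num = det_has_derivative[of ?M ?M', OF this]
    from has_derivative_divide[OF num det_has_derivative[of A A', OF A] nz[OF x]]
    obtain D where "((\<lambda>y. det (?M y) / det (A y)) has_derivative D) (at x within S)" by blast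
    hence "((\<lambda>y. ?B y $ k $ j) has_derivative D) (at x within S)"
      by (rule has_derivative_transform[OF x, rotated]) (simp add: matrix_inv_cramer[OF nz])
    thus ?thesis by blast
  qed
  then obtain D where D: "\<And>k j. ((\<lambda>y. ?B y $ k $ j) has_derivative D k j) (at x within S)" by metis
  have "((\<lambda>y. ?B x $ i $ j - (\<Sum>k\<in>UNIV. \<Sum>l\<in>UNIV. ?B y $ i $ k * (A y $ k $ l - A x $ k $ l) * ?B x $ l $ j))
    has_derivative (\<lambda>h. 0 - (\<Sum>k\<in>UNIV. \<Sum>l\<in>UNIV. (?B x $ i $ k * (A' h $ k $ l - 0) + D i k h * (A x $ k $ l - A x $ k $ l)) * ?B x $ l $ j)))
    (at x within S)"
    by (intro has_derivative_diff has_derivative_const has_derivative_sum has_derivative_mult_left has_derivative_mult A D)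
  moreover have "(0 - (\<Sum>k\<in>UNIV. \<Sum>l\<in>UNIV. (?B x $ i $ k * (A' h $ k $ l - 0) + D i k h * (A x $ k $ l - A x $ k $ l)) * ?B x $ l $ j)) =
      - (?B x ** A' h ** ?B x) $ i $ j" for h
    by (simp add: matrix_mult_triple)
  moreover have "?B x $ i $ j - (\<Sum>k\<in>UNIV. \<Sum>l\<in>UNIV. ?B y $ i $ k * (A y $ k $ l - A x $ k $ l) * ?B x $ l $ j) = ?B y $ i $ j"
    if y: "y \<in> S" for y
  proof -
    have "(\<Sum>k\<in>UNIV. \<Sum>l\<in>UNIV. ?B y $ i $ k * (A y $ k $ l - A x $ k $ l) * ?B x $ l $ j) = (?B y ** (A y - A x) ** ?B x) $ i $ j"
      by (simp add: matrix_mult_triple)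
    also have "?B y ** (A y - A x) ** ?B x = ?B x - ?B y"
      using matrix_inv_both[OF nz[OF x]] matrix_inv_both[OF nz[OF y]]
      by (simp add: matrix_diff_ldistrib matrix_diff_rdistrib) (simp add: matrix_mul_assoc[symmetric])
    finally show ?thesis by simp
  qed
  ultimately show ?thesis
    by (intro has_derivative_transform[OF x, where g = "\<lambda>y. ?B y $ i $ j"]) auto
qed

section \<open>Differentiation under the integral sign\<close>

text \<open>The bound that dominates the difference quotients below: p * 2^p bounds the geometric
  sum in (1 + x)^p - 1, and a further 2^p the inverse of (1 + x)^p.\<close>

lemma inverse_power_difference_bound:
  fixes x :: real
  assumes "\<bar>x\<bar> \<le> 1 / 2"
  shows "\<bar>1 / (1 + x) ^ p - 1\<bar> \<le> 4 ^ p * real p * \<bar>x\<bar>"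
proof -
  have pos: "1 / 2 \<le> 1 + x" "\<bar>1 + x\<bar> \<le> 2" using assms by auto
  have "(1 + x) ^ p - 1 = x * (\<Sum>i<p. (1 + x) ^ i)" using power_diff_1_eq[of "1 + x" p] by simp
  hence "\<bar>(1 + x) ^ p - 1\<bar> = \<bar>x\<bar> * \<bar>\<Sum>i<p. (1 + x) ^ i\<bar>" by (simp add: abs_mult)
  also have "\<dots> \<le> \<bar>x\<bar> * (\<Sum>i<p. 2 ^ p)"
  proof (intro mult_left_mono order_trans[OF sum_abs] sum_mono)
    fix i assume "i \<in> {..<p}"
    have "\<bar>(1 + x) ^ i\<bar> \<le> 2 ^ i" unfolding power_abs using pos by (intro power_mono) auto
    also have "\<dots> \<le> (2 :: real) ^ p" using \<open>i \<in> {..<p}\<close> by (intro power_increasing) auto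
    finally show "\<bar>(1 + x) ^ i\<bar> \<le> 2 ^ p" .
  qed auto
  finally have 1: "\<bar>(1 + x) ^ p - 1\<bar> \<le> \<bar>x\<bar> * (p * 2 ^ p)" by simp
  have "(1 / 2) ^ p \<le> (1 + x) ^ p" using pos by (intro power_mono) auto
  hence 2: "1 / (1 + x) ^ p \<le> 2 ^ p"
    using pos by (simp add: field_simps power_one_over)
  have "1 / (1 + x) ^ p - 1 = - ((1 + x) ^ p - 1) * (1 / (1 + x) ^ p)"
    using pos by (simp add: field_simps)
  hence "\<bar>1 / (1 + x) ^ p - 1\<bar> = \<bar>(1 + x) ^ p - 1\<bar> * (1 / (1 + x) ^ p)"
    using pos by (simp add: abs_mult)
  also have "\<dots> \<le> \<bar>x\<bar> * (p * 2 ^ p) * 2 ^ p"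
    using pos by (intro mult_mono 1 2) auto
  also have "\<dots> = 4 ^ p * real p * \<bar>x\<bar>"
    using power_mult_distrib[of 2 "2 :: real" p] by simp
  finally show ?thesis .
qed

text \<open>Dominated convergence for the difference quotients at 0. Since |P| is at most K Q, the
  relative change t P / Q of the denominator stays below 1/2 for small t, so a multiple of the
  integrand at t = 0 dominates.\<close>

lemma has_bochner_integral_parameter_derivative:
  fixes f :: "'a \<Rightarrow> complex" and Q P :: "'a \<Rightarrow> real" and \<phi> :: "real \<Rightarrow> complex"
  assumes [measurable]: "f \<in> borel_measurable M" "Q \<in> borel_measurable M" "P \<in> borel_measurable M"
    and pos: "\<And>x. 0 < Q x" and bound: "\<And>x. \<bar>P x\<bar> \<le> K * Q x" and K: "0 < K" and \<delta>: "0 < \<delta>"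
    and int: "\<And>t. \<bar>t\<bar> \<le> \<delta> \<Longrightarrow> has_bochner_integral M (\<lambda>x. f x / of_real ((Q x + t * P x) ^ p)) (\<phi> t)"
    and deriv: "(\<phi> has_vector_derivative D) (at 0)"
  shows "has_bochner_integral M (\<lambda>x. - of_nat p * f x * of_real (P x) / of_real (Q x ^ Suc p)) D"
proof -
  \<comment> \<open>Chosen such that along the sequence \<open>t\<close> the integrals are given and
    \<open>t n * K\<close> is at most 1/2.\<close>
  define s where "s = min \<delta> (1 / (2 * K))"
  define t where "t n = s / real (Suc n)" for n
  have s: "0 < s" "s \<le> \<delta>" "s * K \<le> 1 / 2" using K \<delta> by (auto simp: s_def min_def field_simps)
  have t: "0 < t n" "t n \<le> s" for n
    using s(1) by (auto simp: t_def field_simps)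
  have t0: "filterlim t (at 0) sequentially"
  proof -
    have "t \<longlonglongrightarrow> 0" unfolding t_def by (rule lim_const_over_n[THEN LIMSEQ_Suc])
    thus ?thesis using t(1) by (intro filterlim_atI) (auto intro!: always_eventually simp: less_imp_neq[symmetric])
  qed
  let ?u = "\<lambda>x. P x / Q x"
  let ?q = "\<lambda>n x. (f x / of_real ((Q x + t n * P x) ^ p) - f x / of_real (Q x ^ p)) / of_real (t n)"
  let ?g = "\<lambda>x. - of_nat p * f x * of_real (P x) / of_real (Q x ^ Suc p)"
  have int0: "has_bochner_integral M (\<lambda>x. f x / of_real (Q x ^ p)) (\<phi> 0)" using int[of 0] \<delta> by simp
  have intn: "has_bochner_integral M (?q n) ((\<phi> (t n) - \<phi> 0) / of_real (t n))" for n
    using t[of n] s by (intro has_bochner_integral_divide has_bochner_integral_diff int int0) auto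
  have lim: "(\<lambda>n. ?q n x) \<longlonglongrightarrow> ?g x" for x
  proof -
    have "((\<lambda>t. (Q x + t * P x) ^ p) has_real_derivative (real p * (Q x + 0 * P x) ^ (p - 1) * P x)) (at 0)"
      by (auto intro!: derivative_eq_intros)
    hence "((\<lambda>t. 1 / (Q x + t * P x) ^ p) has_real_derivative
        (0 * (Q x + 0 * P x) ^ p - 1 * (real p * (Q x + 0 * P x) ^ (p - 1) * P x)) / ((Q x + 0 * P x) ^ p * (Q x + 0 * P x) ^ p)) (at 0)"
      using pos[of x] by (intro DERIV_divide DERIV_const) auto
    moreover have "(0 * (Q x + 0 * P x) ^ p - 1 * (real p * (Q x + 0 * P x) ^ (p - 1) * P x)) / ((Q x + 0 * P x) ^ p * (Q x + 0 * P x) ^ p) =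
        - real p * P x / Q x ^ Suc p"
      using pos[of x] by (cases p) (auto simp: field_simps)
    ultimately have "((\<lambda>t. 1 / (Q x + t * P x) ^ p) has_real_derivative (- real p * P x / Q x ^ Suc p)) (at 0)"
      by (simp only:)
    hence "((\<lambda>h. (1 / (Q x + h * P x) ^ p - 1 / Q x ^ p) / h) \<longlongrightarrow> - real p * P x / Q x ^ Suc p) (at 0)"
      by (simp add: DERIV_def)
    hence "(\<lambda>n. (1 / (Q x + t n * P x) ^ p - 1 / Q x ^ p) / t n) \<longlonglongrightarrow> - real p * P x / Q x ^ Suc p"
      by (rule filterlim_compose[OF _ t0])
    hence "(\<lambda>n. f x * of_real ((1 / (Q x + t n * P x) ^ p - 1 / Q x ^ p) / t n)) \<longlonglongrightarrow>
        f x * of_real (- real p * P x / Q x ^ Suc p)"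
      by (intro tendsto_mult tendsto_of_real tendsto_const)
    thus ?thesis by (simp add: diff_divide_distrib algebra_simps)
  qed
  let ?C = "4 ^ p * real p * K"
  have bnd: "norm (?q n x) \<le> ?C * norm (f x / of_real (Q x ^ p))" for n x
  proof -
    have u: "\<bar>?u x\<bar> \<le> K" using bound[of x] pos[of x] by (simp add: field_simps abs_divide)
    have "\<bar>t n * ?u x\<bar> \<le> s * K" unfolding abs_mult using t[of n] u K by (intro mult_mono) auto
    hence tu: "\<bar>t n * ?u x\<bar> \<le> 1 / 2" using s by linarith
    have Qt: "Q x + t n * P x = Q x * (1 + t n * ?u x)" using pos[of x] by (simp add: field_simps)
    have "?q n x = f x / of_real (Q x ^ p) * of_real ((1 / (1 + t n * ?u x) ^ p - 1) / t n)"
      unfolding Qt power_mult_distrib using pos[of x] by (simp add: diff_divide_distrib algebra_simps)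
    hence "norm (?q n x) = norm (f x / of_real (Q x ^ p)) * (\<bar>1 / (1 + t n * ?u x) ^ p - 1\<bar> / t n)"
      using t[of n] by (simp only: norm_mult norm_of_real) simp
    also have "\<dots> \<le> norm (f x / of_real (Q x ^ p)) * ((4 ^ p * real p * \<bar>t n * ?u x\<bar>) / t n)"
      using t[of n] by (intro mult_left_mono divide_right_mono inverse_power_difference_bound[OF tu]) auto
    also have "(4 ^ p * real p * \<bar>t n * ?u x\<bar>) / t n = 4 ^ p * real p * \<bar>?u x\<bar>"
      using t[of n] by (simp add: abs_mult)
    also have "norm (f x / of_real (Q x ^ p)) * (4 ^ p * real p * \<bar>?u x\<bar>) \<le> norm (f x / of_real (Q x ^ p)) * ?C"
      by (intro mult_left_mono u) auto
    finally show ?thesis by (simp only: mult.commute)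
  qed
  have intw: "integrable M (\<lambda>x. ?C * norm (f x / of_real (Q x ^ p)))"
    using int0 by (intro integrable_mult_right integrable_norm) (auto simp: has_bochner_integral_iff)
  have gm: "?g \<in> borel_measurable M" by measurable
  have qm: "?q n \<in> borel_measurable M" for n by measurable
  have AElim: "AE x in M. (\<lambda>n. ?q n x) \<longlonglongrightarrow> ?g x" by (rule AE_I2, rule lim)
  have AEbnd: "AE x in M. norm (?q n x) \<le> ?C * norm (f x / of_real (Q x ^ p))" for n by (rule AE_I2, rule bnd)
  have "integrable M ?g" by (rule integrable_dominated_convergence[OF gm qm intw AElim AEbnd])
  moreover have "integral\<^sup>L M ?g = D"
  proof (rule LIMSEQ_unique)
    have "(\<lambda>n. integral\<^sup>L M (?q n)) \<longlonglongrightarrow> integral\<^sup>L M ?g"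
      by (rule integral_dominated_convergence[OF gm qm intw AElim AEbnd])
    thus "(\<lambda>n. (\<phi> (t n) - \<phi> 0) / of_real (t n)) \<longlonglongrightarrow> integral\<^sup>L M ?g"
      by (simp only: has_bochner_integral_integral_eq[OF intn])
    have "((\<lambda>h. norm (\<phi> (0 + h) - \<phi> 0 - h *\<^sub>R D) / norm h) \<longlongrightarrow> 0) (at 0)"
      using deriv unfolding has_vector_derivative_def has_derivative_at by blast
    from filterlim_compose[OF this t0]
    have "(\<lambda>n. norm (\<phi> (0 + t n) - \<phi> 0 - t n *\<^sub>R D) / norm (t n)) \<longlonglongrightarrow> 0" .
    moreover have "norm (\<phi> (0 + t n) - \<phi> 0 - t n *\<^sub>R D) / norm (t n) = norm ((\<phi> (t n) - \<phi> 0) / of_real (t n) - D)" for n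
    proof -
      have "(\<phi> (t n) - \<phi> 0) / of_real (t n) - D = (\<phi> (0 + t n) - \<phi> 0 - t n *\<^sub>R D) / of_real (t n)"
        using t(1)[of n] by (simp add: diff_divide_distrib scaleR_conv_of_real)
      thus ?thesis by (simp only: norm_divide norm_of_real real_norm_def)
    qed
    ultimately have "(\<lambda>n. norm ((\<phi> (t n) - \<phi> 0) / of_real (t n) - D)) \<longlonglongrightarrow> 0" by (simp only:)
    thus "(\<lambda>n. (\<phi> (t n) - \<phi> 0) / of_real (t n)) \<longlonglongrightarrow> D"
      by (rule LIM_zero_cancel[OF tendsto_norm_zero_cancel])
  qed
  ultimately show ?thesis by (simp add: has_bochner_integral_iff)
qed

section \<open>Moments\<close>

lemma sesq_scaleR: "sesq A (c *\<^sub>R x) (c *\<^sub>R x) = of_real (c\<^sup>2) * sesq A x x"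
  unfolding sesq_def sum_distrib_left
  by (intro sum.cong refl) (simp only: vector_scaleR_component scaleR_conv_of_real[where 'a = complex], simp add: power2_eq_square)

lemma scaleR_matrix_nth: "(t *\<^sub>R B) $ i $ j = of_real t * (B $ i $ j :: complex)"
  by (simp only: vector_scaleR_component scaleR_conv_of_real[where 'a = complex])

lemma bochner_integral_scale:
  fixes f :: "'a \<Rightarrow> complex"
  shows "has_bochner_integral M f x \<Longrightarrow> has_bochner_integral M (\<lambda>w. c * f w) (c * x)"
  by (rule has_bochner_integral_mult_right)

lemma sesq_add_scaleR_matrix: "sesq (A + t *\<^sub>R B) X Y = sesq A X Y + of_real t * sesq B X Y"
  unfolding sesq_def sum_distrib_left sum.distrib[symmetric]
  by (intro sum.cong refl) (simp add: scaleR_matrix_nth vector_add_component algebra_simps del: vector_scaleR_component)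

text \<open>Compactness of the unit sphere, then homogeneity of degree two.\<close>

lemma sesq_bound:
  fixes A :: "complex^'k::finite^'k"
  assumes "pos_def_hermitian A"
  shows "\<exists>K>0. \<forall>v. \<bar>Re (sesq B v v)\<bar> \<le> K * Re (sesq A v v)"
proof -
  have cont: "continuous_on X (\<lambda>v. Re (sesq C v v))" for X and C :: "complex^'k^'k"
    unfolding sesq_def by (intro continuous_intros)
  let ?S = "sphere 0 1 :: (complex^'k) set"
  obtain u :: "complex^'k" where "norm u = 1" using vector_choose_size[of 1] by auto
  hence ne: "?S \<noteq> {}" by auto
  obtain a where a: "a \<in> ?S" "\<And>v. v \<in> ?S \<Longrightarrow> Re (sesq A a a) \<le> Re (sesq A v v)"
    using continuous_attains_inf[OF compact_sphere ne cont[of _ A]] by blast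
  obtain b where b: "\<And>v. v \<in> ?S \<Longrightarrow> \<bar>Re (sesq B v v)\<bar> \<le> \<bar>Re (sesq B b b)\<bar>"
    using continuous_attains_sup[OF compact_sphere ne continuous_on_rabs[OF cont[of _ B]]] by blast
  have apos: "0 < Re (sesq A a a)" using a(1) by (intro pos_def_hermitian_pos[OF assms]) auto
  \<comment> \<open>The added 1 keeps the constant positive when the form of \<open>B\<close> has
    real part 0 on the whole sphere.\<close>
  let ?K = "(\<bar>Re (sesq B b b)\<bar> + 1) / Re (sesq A a a)"
  have K: "0 < ?K" using apos by (intro divide_pos_pos) auto
  have "\<bar>Re (sesq B v v)\<bar> \<le> ?K * Re (sesq A v v)" for v
  proof (cases "v = 0")
    case False
    define u where "u = v /\<^sub>R norm v"
    have u: "u \<in> ?S" "v = norm v *\<^sub>R u" using False by (auto simp: u_def)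
    have "\<bar>Re (sesq B u u)\<bar> \<le> ?K * Re (sesq A a a)" using b[OF u(1)] apos by simp
    also have "\<dots> \<le> ?K * Re (sesq A u u)" by (rule mult_left_mono[OF a(2)[OF u(1)] less_imp_le[OF K]])
    finally have "(norm v)\<^sup>2 * \<bar>Re (sesq B u u)\<bar> \<le> (norm v)\<^sup>2 * (?K * Re (sesq A u u))"
      by (rule mult_left_mono) simp
    moreover have "Re (sesq C v v) = (norm v)\<^sup>2 * Re (sesq C u u)" for C :: "complex^'k^'k"
      by (subst (1 2) u(2), subst sesq_scaleR) (simp del: of_real_power)
    ultimately show ?thesis by (simp add: abs_mult mult_ac)
  qed (simp add: sesq_def)
  with K show ?thesis by blast
qed

lemma pos_def_hermitian_perturb:
  fixes A :: "complex^'k::finite^'k"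
  assumes A: "pos_def_hermitian A" and B: "\<And>a b. cnj (B $ a $ b) = B $ b $ a"
    and K: "\<And>v. \<bar>Re (sesq B v v)\<bar> \<le> K * Re (sesq A v v)" and t: "\<bar>t\<bar> * K < 1"
  shows "pos_def_hermitian (A + t *\<^sub>R B)"
  unfolding pos_def_hermitian_def
proof (intro conjI allI impI)
  fix a b show "(A + t *\<^sub>R B) $ a $ b = cnj ((A + t *\<^sub>R B) $ b $ a)"
    by (simp add: B pos_def_hermitian_cnj[OF A])
next
  fix X :: "complex^'k" assume "X \<noteq> 0"
  hence pos: "0 < Re (sesq A X X)" by (rule pos_def_hermitian_pos[OF A])
  have "\<bar>t * Re (sesq B X X)\<bar> \<le> \<bar>t\<bar> * (K * Re (sesq A X X))"
    unfolding abs_mult by (rule mult_left_mono[OF K]) simp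
  also have "\<dots> < 1 * Re (sesq A X X)" unfolding mult.assoc[symmetric] by (rule mult_strict_right_mono[OF t pos])
  finally show "0 < Re (sesq (A + t *\<^sub>R B) X X)" by (simp add: sesq_add_scaleR_matrix)
qed

context
  fixes k :: "'k::finite"
begin

private abbreviation "\<mu> \<equiv> \<Pi>\<^sub>M i\<in>UNIV - {k}. (lborel :: complex measure)"
private abbreviation "v \<equiv> affine_point k (UNIV - {k})"
private abbreviation "Q C w \<equiv> Re (sesq C (v w) (v w))"
private abbreviation "c0 \<equiv> complex_of_real (pi ^ card (UNIV - {k}) / fact (card (UNIV - {k})))"

private lemma Q_pos: "pos_def_hermitian C \<Longrightarrow> 0 < Q C w"
  by (rule pos_def_hermitian_pos[OF _ affine_point_nonzero])

private lemma nonsingular: "pos_def_hermitian C \<Longrightarrow> det C \<noteq> 0" for C :: "complex^'k^'k"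
  using det_pos_def_hermitian[of C] by auto

private lemma line_has_derivative:
  fixes A B :: "complex^'k^'k"
  shows "((\<lambda>t. (A + t *\<^sub>R B) $ i $ j) has_derivative (\<lambda>h. (h *\<^sub>R B) $ i $ j)) (at x within S)"
  by (auto intro!: derivative_eq_intros)

private lemma trace_scaleR: "trace ((h *\<^sub>R B) ** C) = h *\<^sub>R trace (B ** C)" for B C :: "complex^'k^'k"
  by (simp add: trace_def matrix_matrix_mult_def scaleR_sum_right)

private lemma det_line_has_derivative:
  fixes A B :: "complex^'k^'k"
  assumes A: "pos_def_hermitian A"
  shows "((\<lambda>t. det (A + t *\<^sub>R B)) has_vector_derivative (det A * trace (B ** matrix_inv A))) (at 0)"
proof -
  have "((\<lambda>t. det (A + t *\<^sub>R B)) has_derivative (\<lambda>h. det (A + 0 *\<^sub>R B) * trace ((h *\<^sub>R B) ** matrix_inv (A + 0 *\<^sub>R B)))) (at 0)"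
    by (rule det_has_derivative_trace[OF line_has_derivative]) (use nonsingular[OF A] in simp)
  thus ?thesis by (simp add: has_vector_derivative_def trace_scaleR)
qed

private lemma perturb:
  fixes A B :: "complex^'k^'k"
  assumes A: "pos_def_hermitian A" and B: "\<And>a b. cnj (B $ a $ b) = B $ b $ a"
  obtains K \<delta> where "0 < K" "0 < \<delta>" "\<And>w. \<bar>Q B w\<bar> \<le> K * Q A w" "\<And>t. \<bar>t\<bar> \<le> \<delta> \<Longrightarrow> pos_def_hermitian (A + t *\<^sub>R B)"
proof -
  obtain K where K: "0 < K" "\<And>v. \<bar>Re (sesq B v v)\<bar> \<le> K * Re (sesq A v v)" using sesq_bound[OF A] by blast
  show ?thesis
  proof (rule that[of K "1 / (2 * K)"])
    fix t assume "\<bar>t\<bar> \<le> 1 / (2 * K)"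
    hence "\<bar>t\<bar> * K < 1" using K(1) by (simp add: field_simps)
    thus "pos_def_hermitian (A + t *\<^sub>R B)" by (rule pos_def_hermitian_perturb[OF A B K(2)])
  qed (use K in auto)
qed

private lemma moment1_hermitian:
  assumes A: "pos_def_hermitian A" and B: "\<And>a b. cnj (B $ a $ b) = B $ b $ a"
  shows "has_bochner_integral \<mu> (\<lambda>w. sesq B (v w) (v w) / of_real (Q A w ^ Suc CARD('k)))
    (c0 / of_nat CARD('k) * trace (B ** matrix_inv A) / det A)"
proof -
  obtain K \<delta> where K: "0 < K" "0 < \<delta>" "\<And>w. \<bar>Q B w\<bar> \<le> K * Q A w"
    "\<And>t. \<bar>t\<bar> \<le> \<delta> \<Longrightarrow> pos_def_hermitian (A + t *\<^sub>R B)" using perturb[OF A B] by blast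
  have main: "has_bochner_integral \<mu> (\<lambda>w. - of_nat CARD('k) * 1 * of_real (Q B w) / of_real (Q A w ^ Suc CARD('k)))
     (- c0 * (det A * trace (B ** matrix_inv A)) / (det A * det A))"
  proof (rule has_bochner_integral_parameter_derivative[OF _ _ _ Q_pos[OF A] K(3,1,2), where \<phi> = "\<lambda>t. c0 / det (A + t *\<^sub>R B)"])
    fix t assume "\<bar>t\<bar> \<le> \<delta>"
    from integral_inverse_hermitian[OF K(4)[OF this], of k]
    show "has_bochner_integral \<mu> (\<lambda>w. 1 / of_real ((Q A w + t * Q B w) ^ CARD('k))) (c0 / det (A + t *\<^sub>R B))"
      by (simp add: sesq_add_scaleR_matrix)
  next
    have "((\<lambda>t. c0 / det (A + t *\<^sub>R B)) has_derivative (\<lambda>h. (- c0 * (det A * trace (B ** matrix_inv A)) / (det A * det A)) * of_real h)) (at 0)"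
      using det_line_has_derivative[OF A, of B] nonsingular[OF A] unfolding has_vector_derivative_def
      by (auto intro!: derivative_eq_intros simp: scaleR_conv_of_real field_simps)
    thus "((\<lambda>t. c0 / det (A + t *\<^sub>R B)) has_vector_derivative (- c0 * (det A * trace (B ** matrix_inv A)) / (det A * det A))) (at 0)"
      by (simp add: has_vector_derivative_def scaleR_conv_of_real mult.commute)
  qed auto
  note scaled = bochner_integral_scale[OF main, of "- 1 / of_nat CARD('k)"]
  have e1: "- 1 / of_nat CARD('k) * (- of_nat CARD('k) * 1 * of_real (Q B w) / of_real (Q A w ^ Suc CARD('k))) =
      sesq B (v w) (v w) / of_real (Q A w ^ Suc CARD('k))" for w
    unfolding hermitian_sesq_real[OF B, of "v w", symmetric] by simp
  have e2: "- 1 / of_nat CARD('k) * (- c0 * (det A * trace (B ** matrix_inv A)) / (det A * det A)) =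
      c0 / of_nat CARD('k) * trace (B ** matrix_inv A) / det A"
    using nonsingular[OF A] by simp
  show ?thesis using scaled unfolding e1 e2 .
qed

text \<open>Both sides are complex linear in \<open>C\<close>, which is split as C1 + i C2 with
  Hermitian parts. The generality is needed for the matrices R_ab A, since a single component of the
  curvature is not Hermitian in general.\<close>

lemma moment1:
  assumes A: "pos_def_hermitian A"
  shows "has_bochner_integral \<mu> (\<lambda>w. sesq C (v w) (v w) / of_real (Q A w ^ Suc CARD('k)))
    (c0 / of_nat CARD('k) * trace (C ** matrix_inv A) / det A)"
proof -
  define C1 where "C1 = (\<chi> a b. (C $ a $ b + cnj (C $ b $ a)) / 2)"
  define C2 where "C2 = (\<chi> a b. (C $ a $ b - cnj (C $ b $ a)) / (2 * \<i>))"
  have herm: "cnj (C1 $ a $ b) = C1 $ b $ a" "cnj (C2 $ a $ b) = C2 $ b $ a" for a b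
    by (simp_all add: C1_def C2_def field_simps)
  have C: "C $ a $ b = C1 $ a $ b + \<i> * C2 $ a $ b" for a b
    by (simp add: C1_def C2_def field_simps)
  have sC: "sesq C X X = sesq C1 X X + \<i> * sesq C2 X X" for X
    unfolding sesq_def C sum_distrib_left sum.distrib[symmetric] by (intro sum.cong refl) (simp add: algebra_simps)
  have tr: "trace (C ** matrix_inv A) = trace (C1 ** matrix_inv A) + \<i> * trace (C2 ** matrix_inv A)"
    unfolding trace_def matrix_matrix_mult_def C by (simp add: sum_distrib_left sum.distrib algebra_simps)
  have e1: "sesq C1 (v w) (v w) / of_real (Q A w ^ Suc CARD('k)) + \<i> * (sesq C2 (v w) (v w) / of_real (Q A w ^ Suc CARD('k))) =
      sesq C (v w) (v w) / of_real (Q A w ^ Suc CARD('k))" for w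
    unfolding sC by (simp only: add_divide_distrib times_divide_eq_right)
  have e2: "c * trace (C1 ** matrix_inv A) / d + \<i> * (c * trace (C2 ** matrix_inv A) / d) =
      c * trace (C ** matrix_inv A) / d" for c d
    unfolding tr by (simp only: distrib_left add_divide_distrib times_divide_eq_right mult.left_commute)
  show ?thesis
    using has_bochner_integral_add[OF moment1_hermitian[of A C1, OF A herm(1)]
        bochner_integral_scale[OF moment1_hermitian[of A C2, OF A herm(2)], of \<i>]]
    unfolding e1 e2 .
qed

text \<open>The first moment is differentiated along A + tB with \<open>C\<close> fixed: the
  derivative of A^-1 in tr (C A^-1) gives the trace of the product, that of 1 / det A the product of
  the traces, and the exponent r + 1 the new denominator.\<close>

lemma moment2:
  assumes A: "pos_def_hermitian A" and B: "\<And>a b. cnj (B $ a $ b) = B $ b $ a"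
  shows "has_bochner_integral \<mu> (\<lambda>w. sesq C (v w) (v w) * sesq B (v w) (v w) / of_real (Q A w ^ Suc (Suc CARD('k))))
    (c0 / of_nat (CARD('k) * Suc CARD('k)) *
      (trace (C ** matrix_inv A ** B ** matrix_inv A) + trace (C ** matrix_inv A) * trace (B ** matrix_inv A)) / det A)"
proof -
  let ?c = "c0 / of_nat CARD('k)" and ?I = "matrix_inv A" and ?A = "\<lambda>t. A + t *\<^sub>R B"
  obtain K \<delta> where K: "0 < K" "0 < \<delta>" "\<And>w. \<bar>Q B w\<bar> \<le> K * Q A w" "\<And>t. \<bar>t\<bar> \<le> \<delta> \<Longrightarrow> pos_def_hermitian (?A t)"
    using perturb[OF A B] by blast
  have nz: "det (?A t) \<noteq> 0" if "t \<in> {- \<delta><..<\<delta>}" for t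
    by (rule nonsingular[OF K(4)]) (use that in auto)
  note nzA = nonsingular[OF A]
  let ?tr = "trace (C ** ?I ** B ** ?I)"
  define D where "D = ?c * ((- ?tr * det A - trace (C ** ?I) * (det A * trace (B ** ?I))) / (det A * det A))"
  \<comment> \<open>The derivative of the inverse is stated within a set on which the determinant is
    nonzero; on an open interval it is the full derivative.\<close>
  have at: "at (0 :: real) within {- \<delta><..<\<delta>} = at 0" using K(2) by (intro at_within_open) auto
  have dinv: "((\<lambda>t. matrix_inv (?A t) $ i $ j) has_derivative (\<lambda>h. of_real h * - (?I ** B ** ?I) $ i $ j)) (at 0)" for i j
  proof -
    have "((\<lambda>t. matrix_inv (?A t) $ i $ j) has_derivative
       (\<lambda>h. - (matrix_inv (?A 0) ** (h *\<^sub>R B) ** matrix_inv (?A 0)) $ i $ j)) (at 0 within {- \<delta><..<\<delta>})"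
      by (rule matrix_inv_has_derivative[OF line_has_derivative nz]) (use K(2) in auto)
    moreover have "(?I ** (h *\<^sub>R B) ** ?I) $ i $ j = of_real h * (?I ** B ** ?I) $ i $ j" for h
      unfolding matrix_mult_triple sum_distrib_left scaleR_matrix_nth by (intro sum.cong refl) (simp add: mult_ac)
    ultimately show ?thesis unfolding at by simp
  qed
  have dtr: "((\<lambda>t. trace (C ** matrix_inv (?A t))) has_derivative (\<lambda>h. of_real h * - ?tr)) (at 0)"
  proof -
    have "((\<lambda>t. \<Sum>i\<in>UNIV. \<Sum>j\<in>UNIV. C $ i $ j * matrix_inv (?A t) $ j $ i) has_derivative
      (\<lambda>h. \<Sum>i\<in>UNIV. \<Sum>j\<in>UNIV. C $ i $ j * (of_real h * - (?I ** B ** ?I) $ j $ i))) (at 0)"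
      by (intro has_derivative_sum has_derivative_mult_right dinv)
    moreover have "(\<Sum>i\<in>UNIV. \<Sum>j\<in>UNIV. C $ i $ j * (of_real h * - (?I ** B ** ?I) $ j $ i)) = of_real h * - ?tr" for h
    proof -
      have "?tr = trace (C ** (?I ** B ** ?I))" by (simp add: matrix_mul_assoc)
      also have "\<dots> = (\<Sum>i\<in>UNIV. \<Sum>j\<in>UNIV. C $ i $ j * (?I ** B ** ?I) $ j $ i)"
        by (simp add: trace_def matrix_matrix_mult_def[of C])
      finally show ?thesis by (simp add: sum_distrib_left sum_negf mult_ac)
    qed
    ultimately show ?thesis by (simp add: trace_def matrix_matrix_mult_def[of C])
  qed
  have ddet: "((\<lambda>t. det (?A t)) has_derivative (\<lambda>h. of_real h * (det A * trace (B ** ?I)))) (at 0)"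
    using det_line_has_derivative[OF A, of B] by (simp add: has_vector_derivative_def scaleR_conv_of_real)
  let ?\<phi> = "\<lambda>t. ?c * trace (C ** matrix_inv (?A t)) / det (?A t)"
  have main: "has_bochner_integral \<mu>
     (\<lambda>w. - of_nat (Suc CARD('k)) * sesq C (v w) (v w) * of_real (Q B w) / of_real (Q A w ^ Suc (Suc CARD('k)))) D"
  proof (rule has_bochner_integral_parameter_derivative[OF _ _ _ Q_pos[OF A] K(3,1,2), where \<phi> = ?\<phi>])
    fix t assume "\<bar>t\<bar> \<le> \<delta>"
    from moment1[OF K(4)[OF this], of C]
    show "has_bochner_integral \<mu> (\<lambda>w. sesq C (v w) (v w) / of_real ((Q A w + t * Q B w) ^ Suc CARD('k))) (?\<phi> t)"
      by (simp add: sesq_add_scaleR_matrix)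
  next
    have "(?\<phi> has_derivative (\<lambda>h. of_real h * D)) (at 0)"
      using nzA by (auto intro!: derivative_eq_intros dtr ddet simp: D_def field_simps)
    thus "(?\<phi> has_vector_derivative D) (at 0)"
      by (simp add: has_vector_derivative_def scaleR_conv_of_real)
  qed auto
  note scaled = bochner_integral_scale[OF main, of "- 1 / of_nat (Suc CARD('k))"]
  have e1: "- 1 / of_nat (Suc CARD('k)) * (- of_nat (Suc CARD('k)) * sesq C (v w) (v w) * of_real (Q B w) / of_real (Q A w ^ Suc (Suc CARD('k)))) =
      sesq C (v w) (v w) * sesq B (v w) (v w) / of_real (Q A w ^ Suc (Suc CARD('k)))" for w
    unfolding hermitian_sesq_real[OF B, of "v w", symmetric] by (simp del: of_nat_Suc power_Suc)
  have e2: "- 1 / of_nat (Suc CARD('k)) * D = c0 / of_nat (CARD('k) * Suc CARD('k)) * (?tr + trace (C ** ?I) * trace (B ** ?I)) / det A"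
  proof -
    have eq: "- 1 / s * (c / r * ((- x * d - y * (d * z)) / (d * d))) = c / (r * s) * (x + y * z) / d"
      if "d \<noteq> 0" "r \<noteq> 0" "s \<noteq> 0" for c r s x y z d :: complex
      using that by (simp add: field_simps)
    show ?thesis unfolding D_def of_nat_mult by (rule eq[OF nzA]) (simp_all del: of_nat_Suc)
  qed
  show ?thesis using scaled unfolding e1 e2 .
qed

end

section \<open>Calculus: differentiability classes and Wirtinger derivatives\<close>

section \<open>Differentiability classes\<close>

lemma frechet_derivative_eq: "(f has_derivative f') (at x) \<Longrightarrow> frechet_derivative f (at x) = f'"
  by (rule frechet_derivative_at[symmetric])

lemma has_derivative_cong_open:
  assumes "open S" "x \<in> S" "\<And>y. y \<in> S \<Longrightarrow> f y = g y"
  shows "(f has_derivative D) (at x) \<longleftrightarrow> (g has_derivative D) (at x)"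
  using has_derivative_transform_within_open[OF _ assms(1,2), of f D UNIV g]
    has_derivative_transform_within_open[OF _ assms(1,2), of g D UNIV f] assms(3) by auto

lemma frechet_derivative_cong_open:
  assumes "open S" "x \<in> S" "\<And>y. y \<in> S \<Longrightarrow> f y = g y"
  shows "frechet_derivative f (at x) = frechet_derivative g (at x)"
  unfolding frechet_derivative_def using has_derivative_cong_open[OF assms] by presburger

lemma differentiable_cong_open:
  assumes "open S" "x \<in> S" "\<And>y. y \<in> S \<Longrightarrow> f y = g y"
  shows "f differentiable (at x) \<longleftrightarrow> g differentiable (at x)"
  unfolding differentiable_def using has_derivative_cong_open[OF assms] by presburger

lemma C_k_on_cong:
  assumes "open S" "\<And>x. x \<in> S \<Longrightarrow> f x = g x"
  shows "C_k_on k S f \<longleftrightarrow> C_k_on k S g"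
  using assms(2)
proof (induction k arbitrary: f g)
  case 0
  thus ?case by (simp cong: continuous_on_cong)
next
  case (Suc k)
  have d: "f differentiable (at x) \<longleftrightarrow> g differentiable (at x)" if "x \<in> S" for x
    by (rule differentiable_cong_open[OF assms(1) that Suc.prems])
  have "C_k_on k S (\<lambda>x. frechet_derivative f (at x) v) \<longleftrightarrow> C_k_on k S (\<lambda>x. frechet_derivative g (at x) v)" for v
    by (rule Suc.IH) (simp add: frechet_derivative_cong_open[OF assms(1) _ Suc.prems])
  with d show ?case by simp
qed

lemma C_k_on_linear:
  assumes "open S" "bounded_linear L"
  shows "C_k_on k S f \<Longrightarrow> C_k_on k S (\<lambda>x. L (f x))"
proof (induction k arbitrary: f)
  case 0
  thus ?case by (simp add: bounded_linear.continuous_on[OF assms(2)])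
next
  case (Suc k)
  have d: "((\<lambda>x. L (f x)) has_derivative (\<lambda>h. L (frechet_derivative f (at x) h))) (at x)" if "x \<in> S" for x
    using Suc.prems that by (intro bounded_linear.has_derivative[OF assms(2)]) (auto simp: frechet_derivative_works[symmetric])
  have "C_k_on k S (\<lambda>x. frechet_derivative (\<lambda>x. L (f x)) (at x) v)" for v
    using Suc by (subst C_k_on_cong[OF assms(1), of _ "\<lambda>x. L (frechet_derivative f (at x) v)"])
      (auto simp: frechet_derivative_eq[OF d])
  with d show ?case by (auto simp: differentiable_def)
qed

lemma C_k_on_add:
  assumes "open S"
  shows "C_k_on k S f \<Longrightarrow> C_k_on k S g \<Longrightarrow> C_k_on k S (\<lambda>x. f x + g x)"
proof (induction k arbitrary: f g)
  case 0
  thus ?case by (simp add: continuous_on_add)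
next
  case (Suc k)
  have d: "((\<lambda>x. f x + g x) has_derivative (\<lambda>h. frechet_derivative f (at x) h + frechet_derivative g (at x) h)) (at x)" if "x \<in> S" for x
    using Suc.prems that by (intro has_derivative_add) (auto simp: frechet_derivative_works[symmetric])
  have "C_k_on k S (\<lambda>x. frechet_derivative (\<lambda>x. f x + g x) (at x) v)" for v
    using Suc by (subst C_k_on_cong[OF assms(1), of _ "\<lambda>x. frechet_derivative f (at x) v + frechet_derivative g (at x) v"])
      (auto simp: frechet_derivative_eq[OF d])
  with d show ?case by (auto simp: differentiable_def)
qed

text \<open>For an affine map the derivative in direction v is the derivative of f in the constant
  direction l v, composed with the same map, so the recursion on k closes without a general chain
  rule. It is applied to inserting a fixed fibre vector and to forgetting the parameter.\<close>

lemma C_k_on_compose_affine: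
  assumes S: "open S" and T: "open T" and l: "bounded_linear l" and L: "\<And>x. L x = c + l x" "\<And>x. x \<in> T \<Longrightarrow> L x \<in> S"
  shows "C_k_on k S f \<Longrightarrow> C_k_on k T (\<lambda>x. f (L x))"
proof (induction k arbitrary: f)
  case 0
  have "continuous_on T L" unfolding L(1)[abs_def] by (intro continuous_intros bounded_linear.continuous_on[OF l])
  thus ?case using 0 L(2) by (auto intro: continuous_on_compose2)
next
  case (Suc k)
  have L': "(L has_derivative l) (at x)" for x
    unfolding L(1)[abs_def] by (auto intro!: derivative_eq_intros bounded_linear_imp_has_derivative[OF l])
  have d: "((\<lambda>x. f (L x)) has_derivative (\<lambda>h. frechet_derivative f (at (L x)) (l h))) (at x)" if "x \<in> T" for x
    using Suc.prems L(2)[OF that]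
    by (intro has_derivative_compose[OF L']) (auto simp: frechet_derivative_works[symmetric])
  have "C_k_on k T (\<lambda>x. frechet_derivative (\<lambda>x. f (L x)) (at x) v)" for v
    using Suc by (subst C_k_on_cong[OF T, of _ "\<lambda>x. frechet_derivative f (at (L x)) (l v)"])
      (auto simp: frechet_derivative_eq[OF d])
  with d show ?case by (auto simp: differentiable_def)
qed

lemma C_k_on_pred: "C_k_on (Suc k) S f \<Longrightarrow> C_k_on k S f"
proof (induction k arbitrary: f)
  case 0
  thus ?case
    by (auto intro!: continuous_at_imp_continuous_on differentiable_imp_continuous_within)
next
  case (Suc k)
  thus ?case by (metis C_k_on.simps(2))
qed

lemma C_k_on_1_2:
  assumes "C_k_on 2 S f" "x \<in> S"
  shows "f differentiable (at x)" "(\<lambda>y. frechet_derivative f (at y) v) differentiable (at x)"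
    "(f has_derivative frechet_derivative f (at x)) (at x)"
    "((\<lambda>y. frechet_derivative f (at y) v) has_derivative frechet_derivative (\<lambda>y. frechet_derivative f (at y) v) (at x)) (at x)"
  using assms by (auto simp: numeral_2_eq_2 frechet_derivative_works[symmetric])

abbreviation deriv2 :: "('a::real_normed_vector \<Rightarrow> 'b::real_normed_vector) \<Rightarrow> 'a \<Rightarrow> 'a \<Rightarrow> 'a \<Rightarrow> 'b" where
  "deriv2 f x u v \<equiv> frechet_derivative (\<lambda>y. frechet_derivative f (at y) u) (at x) v"

abbreviation diff2 :: "('a::real_normed_vector \<Rightarrow> real) \<Rightarrow> 'a \<Rightarrow> 'a \<Rightarrow> 'a \<Rightarrow> real \<Rightarrow> real" where
  "diff2 f x u v h \<equiv> f (x + h *\<^sub>R u + h *\<^sub>R v) - f (x + h *\<^sub>R u) - f (x + h *\<^sub>R v) + f x"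

text \<open>Both mixed derivatives are the limit of the same second-order difference quotient.\<close>
lemma second_difference:
  fixes f :: "'a::real_normed_vector \<Rightarrow> real"
  assumes f: "\<And>y. y \<in> ball x r \<Longrightarrow> (f has_derivative f' y) (at y)"
    and f'': "\<And>y. y \<in> ball x r \<Longrightarrow> ((\<lambda>y. f' y u) has_derivative f'' y) (at y)"
    and h: "0 < h" "h * (norm u + norm v) < r"
  shows "\<exists>\<xi> \<eta>. 0 < \<xi> \<and> \<xi> < h \<and> 0 < \<eta> \<and> \<eta> < h \<and>
    diff2 f x u v h = h\<^sup>2 * f'' (x + \<xi> *\<^sub>R u + \<eta> *\<^sub>R v) v"
proof -
  have in_ball: "x + a *\<^sub>R u + b *\<^sub>R v \<in> ball x r" if "0 \<le> a" "a \<le> h" "0 \<le> b" "b \<le> h" for a b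
  proof -
    have "norm (a *\<^sub>R u + b *\<^sub>R v) \<le> a * norm u + b * norm v"
      using norm_triangle_ineq[of "a *\<^sub>R u" "b *\<^sub>R v"] that by simp
    also have "\<dots> \<le> h * norm u + h * norm v" using that by (intro add_mono mult_right_mono) auto
    also have "\<dots> < r" using h by (simp add: algebra_simps)
    finally have "norm (- (a *\<^sub>R u + b *\<^sub>R v)) < r" by (simp only: norm_minus_cancel)
    moreover have "x - (x + a *\<^sub>R u + b *\<^sub>R v) = - (a *\<^sub>R u + b *\<^sub>R v)" by simp
    ultimately show ?thesis by (simp only: mem_ball dist_norm)
  qed
  have d1: "((\<lambda>s. f (x + s *\<^sub>R u + b *\<^sub>R v)) has_real_derivative f' (x + a *\<^sub>R u + b *\<^sub>R v) u) (at a)"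
    if "0 \<le> a" "a \<le> h" "0 \<le> b" "b \<le> h" for a b
  proof -
    have "((\<lambda>s. x + s *\<^sub>R u + b *\<^sub>R v) has_derivative (\<lambda>s. s *\<^sub>R u)) (at a)"
      by (auto intro!: derivative_eq_intros)
    from has_derivative_compose[OF this f[OF in_ball[OF that]]]
    have "((\<lambda>s. f (x + s *\<^sub>R u + b *\<^sub>R v)) has_derivative (\<lambda>s. f' (x + a *\<^sub>R u + b *\<^sub>R v) (s *\<^sub>R u))) (at a)" .
    moreover have "f' (x + a *\<^sub>R u + b *\<^sub>R v) (s *\<^sub>R u) = f' (x + a *\<^sub>R u + b *\<^sub>R v) u * s" for s
      using linear_scale[OF has_derivative_linear[OF f[OF in_ball[OF that]]], of s u] by simp
    ultimately show ?thesis by (simp add: has_field_derivative_def)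
  qed
  have d2: "((\<lambda>s. f' (x + a *\<^sub>R u + s *\<^sub>R v) u) has_real_derivative f'' (x + a *\<^sub>R u + b *\<^sub>R v) v) (at b)"
    if "0 \<le> a" "a \<le> h" "0 \<le> b" "b \<le> h" for a b
  proof -
    have "((\<lambda>s. x + a *\<^sub>R u + s *\<^sub>R v) has_derivative (\<lambda>s. s *\<^sub>R v)) (at b)"
      by (auto intro!: derivative_eq_intros)
    from has_derivative_compose[OF this f''[OF in_ball[OF that]]]
    have "((\<lambda>s. f' (x + a *\<^sub>R u + s *\<^sub>R v) u) has_derivative (\<lambda>s. f'' (x + a *\<^sub>R u + b *\<^sub>R v) (s *\<^sub>R v))) (at b)" .
    moreover have "f'' (x + a *\<^sub>R u + b *\<^sub>R v) (s *\<^sub>R v) = f'' (x + a *\<^sub>R u + b *\<^sub>R v) v * s" for s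
      using linear_scale[OF has_derivative_linear[OF f''[OF in_ball[OF that]]], of s v] by simp
    ultimately show ?thesis by (simp add: has_field_derivative_def)
  qed
  \<comment> \<open>The mean value theorem is applied to this difference in the direction u, and
    then to the resulting difference of derivatives in the direction v.\<close>
  let ?g = "\<lambda>s. f (x + s *\<^sub>R u + h *\<^sub>R v) - f (x + s *\<^sub>R u + 0 *\<^sub>R v)"
  have "\<exists>\<xi>>0. \<xi> < h \<and> ?g h - ?g 0 = (h - 0) * (f' (x + \<xi> *\<^sub>R u + h *\<^sub>R v) u - f' (x + \<xi> *\<^sub>R u + 0 *\<^sub>R v) u)"
    using h by (intro MVT2 DERIV_diff d1) auto
  then obtain \<xi> where \<xi>: "0 < \<xi>" "\<xi> < h"
    "?g h - ?g 0 = h * (f' (x + \<xi> *\<^sub>R u + h *\<^sub>R v) u - f' (x + \<xi> *\<^sub>R u + 0 *\<^sub>R v) u)" by auto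
  have "\<exists>\<eta>>0. \<eta> < h \<and> f' (x + \<xi> *\<^sub>R u + h *\<^sub>R v) u - f' (x + \<xi> *\<^sub>R u + 0 *\<^sub>R v) u =
      (h - 0) * f'' (x + \<xi> *\<^sub>R u + \<eta> *\<^sub>R v) v"
    using h \<xi> by (intro MVT2 d2) auto
  then obtain \<eta> where \<eta>: "0 < \<eta>" "\<eta> < h"
    "f' (x + \<xi> *\<^sub>R u + h *\<^sub>R v) u - f' (x + \<xi> *\<^sub>R u + 0 *\<^sub>R v) u = h * f'' (x + \<xi> *\<^sub>R u + \<eta> *\<^sub>R v) v" by auto
  show ?thesis
    using \<xi> \<eta> by (intro exI[of _ \<xi>] exI[of _ \<eta>]) (simp add: power2_eq_square)
qed

lemma second_difference_tendsto:
  fixes f :: "'a::real_normed_vector \<Rightarrow> real"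
  assumes S: "open S" "x \<in> S" and C: "C_k_on 2 S f"
  shows "((\<lambda>h. diff2 f x u v h / h\<^sup>2) \<longlongrightarrow>
     deriv2 f x u v) (at_right 0)"
proof (rule tendstoI)
  let ?f'' = "\<lambda>y. deriv2 f y u v"
  fix e :: real assume "0 < e"
  have "continuous_on S ?f''" using C by (simp add: numeral_2_eq_2)
  hence "continuous (at x) ?f''" using S by (simp add: continuous_on_eq_continuous_at)
  then obtain d where d: "d > 0" "\<And>y. dist y x < d \<Longrightarrow> dist (?f'' y) (?f'' x) < e"
    using \<open>0 < e\<close> unfolding continuous_at_eps_delta by blast
  obtain r0 where r0: "r0 > 0" "ball x r0 \<subseteq> S" using S by (auto simp: open_contains_ball)
  define r where "r = min r0 d"
  have r: "r > 0" "ball x r \<subseteq> S" "ball x r \<subseteq> ball x d" using r0 d(1) by (auto simp: r_def)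
  define N where "N = norm u + norm v + 1"
  have N: "0 < N" "norm u + norm v < N" unfolding N_def using norm_ge_zero[of u] norm_ge_zero[of v] by linarith+
  have "\<forall>\<^sub>F h in at_right 0. h \<in> {0<..<r / N}"
    using r N by (intro eventually_at_right_real) auto
  thus "\<forall>\<^sub>F h in at_right 0. dist (diff2 f x u v h / h\<^sup>2) (?f'' x) < e"
  proof eventually_elim
    fix h assume h: "h \<in> {0<..<r / N}"
    have "h * (norm u + norm v) \<le> h * N" using h N by (intro mult_left_mono) auto
    also have "\<dots> < r" using h N by (simp add: field_simps)
    finally have hr: "h * (norm u + norm v) < r" .
    have "\<exists>\<xi> \<eta>. 0 < \<xi> \<and> \<xi> < h \<and> 0 < \<eta> \<and> \<eta> < h \<and>
       diff2 f x u v h = h\<^sup>2 * ?f'' (x + \<xi> *\<^sub>R u + \<eta> *\<^sub>R v)"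
      by (rule second_difference[OF C_k_on_1_2(3)[OF C subsetD[OF r(2)]] C_k_on_1_2(4)[OF C subsetD[OF r(2)]] _ hr]) (use h in auto)
    then obtain \<xi> \<eta> where \<xi>: "0 < \<xi>" "\<xi> < h" "0 < \<eta>" "\<eta> < h"
      "diff2 f x u v h = h\<^sup>2 * ?f'' (x + \<xi> *\<^sub>R u + \<eta> *\<^sub>R v)" by blast
    have "norm (\<xi> *\<^sub>R u + \<eta> *\<^sub>R v) \<le> \<xi> * norm u + \<eta> * norm v"
      using norm_triangle_ineq[of "\<xi> *\<^sub>R u" "\<eta> *\<^sub>R v"] \<xi> by simp
    also have "\<dots> \<le> h * norm u + h * norm v" using \<xi> by (intro add_mono mult_right_mono) auto
    also have "\<dots> < d" using hr r_def by (simp add: algebra_simps)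
    finally have "dist (x + \<xi> *\<^sub>R u + \<eta> *\<^sub>R v) x < d" by (simp add: dist_norm add.assoc)
    from d(2)[OF this] show "dist (diff2 f x u v h / h\<^sup>2) (?f'' x) < e"
      unfolding \<xi>(5) using h by simp
  qed
qed

lemma symmetric_second_derivative_real:
  fixes f :: "'a::real_normed_vector \<Rightarrow> real"
  assumes "open S" "x \<in> S" "C_k_on 2 S f"
  shows "deriv2 f x u v = deriv2 f x v u"
proof (rule tendsto_unique)
  show "((\<lambda>h. diff2 f x u v h / h\<^sup>2) \<longlongrightarrow>
     deriv2 f x u v) (at_right 0)"
    by (rule second_difference_tendsto[OF assms])
  have "(\<lambda>h. diff2 f x u v h / h\<^sup>2) =
      (\<lambda>h. diff2 f x v u h / h\<^sup>2)"
    by (simp add: algebra_simps)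
  thus "((\<lambda>h. diff2 f x u v h / h\<^sup>2) \<longlongrightarrow>
     deriv2 f x v u) (at_right 0)"
    using second_difference_tendsto[OF assms, of v u] by simp
qed simp

lemma frechet_derivative_linear_twice:
  assumes "open S" "x \<in> S" "C_k_on 2 S f" "bounded_linear L"
  shows "frechet_derivative (\<lambda>y. frechet_derivative (\<lambda>y. L (f y)) (at y) u) (at x) v =
    L (deriv2 f x u v)"
proof -
  have 1: "frechet_derivative (\<lambda>y. L (f y)) (at y) u = L (frechet_derivative f (at y) u)" if "y \<in> S" for y
    using frechet_derivative_eq[OF bounded_linear.has_derivative[OF assms(4) C_k_on_1_2(3)[OF assms(3) that]]] by simp
  have "frechet_derivative (\<lambda>y. frechet_derivative (\<lambda>y. L (f y)) (at y) u) (at x) = frechet_derivative (\<lambda>y. L (frechet_derivative f (at y) u)) (at x)"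
    by (rule frechet_derivative_cong_open[OF assms(1,2) 1])
  thus ?thesis
    using frechet_derivative_eq[OF bounded_linear.has_derivative[OF assms(4) C_k_on_1_2(4)[OF assms(3,2), of u]]] by simp
qed

text \<open>The mean value argument is for real values, so real and imaginary parts are treated
  separately.\<close>

lemma symmetric_second_derivative:
  fixes f :: "'a::real_normed_vector \<Rightarrow> complex"
  assumes "open S" "x \<in> S" "C_k_on 2 S f"
  shows "deriv2 f x u v = deriv2 f x v u"
proof (rule complex_eqI)
  note L = frechet_derivative_linear_twice[OF assms]
  show "Re (deriv2 f x u v) = Re (deriv2 f x v u)"
    unfolding L[OF bounded_linear_Re, symmetric]
    by (rule symmetric_second_derivative_real[OF assms(1,2) C_k_on_linear[OF assms(1) bounded_linear_Re assms(3)]])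
  show "Im (deriv2 f x u v) = Im (deriv2 f x v u)"
    unfolding L[OF bounded_linear_Im, symmetric]
    by (rule symmetric_second_derivative_real[OF assms(1,2) C_k_on_linear[OF assms(1) bounded_linear_Im assms(3)]])
qed

section \<open>Wirtinger derivatives\<close>

lemma wd_eq: "(f has_derivative f') (at x) \<Longrightarrow> wd a f x = (f' (axis a 1) - \<i> * f' (axis a \<i>)) / 2"
  by (simp add: wd_def frechet_derivative_eq)

lemma wdbar_eq: "(f has_derivative f') (at x) \<Longrightarrow> wdbar a f x = (f' (axis a 1) + \<i> * f' (axis a \<i>)) / 2"
  by (simp add: wdbar_def frechet_derivative_eq)

lemma wd_cong_open:
  assumes "open S" "x \<in> S" "\<And>y. y \<in> S \<Longrightarrow> f y = g y"
  shows "wd a f x = wd a g x" "wdbar a f x = wdbar a g x"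
  by (simp_all only: wd_def wdbar_def frechet_derivative_cong_open[OF assms])

lemma C_k_on_wd:
  assumes "open S" "C_k_on (Suc k) S f"
  shows "C_k_on k S (wd a f)" "C_k_on k S (wdbar a f)"
proof -
  have "C_k_on k S (\<lambda>x. c * frechet_derivative f (at x) v)" for c v
    using assms by (intro C_k_on_linear[OF assms(1) bounded_linear_mult_right]) simp
  from C_k_on_add[OF assms(1) this[of "1 / 2" "axis a 1"] this[of "- \<i> / 2" "axis a \<i>"]]
    C_k_on_add[OF assms(1) this[of "1 / 2" "axis a 1"] this[of "\<i> / 2" "axis a \<i>"]]
  show "C_k_on k S (wd a f)" "C_k_on k S (wdbar a f)"
    by (simp_all add: wd_def[abs_def] wdbar_def[abs_def] diff_divide_distrib add_divide_distrib)
qed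

lemma wd_differentiable:
  assumes "C_k_on 2 S f" "x \<in> S"
  shows "(\<lambda>y. wd a f y) differentiable (at x)" "(\<lambda>y. wdbar a f y) differentiable (at x)"
  unfolding wd_def wdbar_def using C_k_on_1_2(2)[OF assms] by (auto intro!: derivative_intros)

text \<open>Reconciles \<open>chern_curvature\<close>, which applies the conjugate derivative last,
  with \<open>kobayashi_coeff\<close>, which applies it first.\<close>

lemma wd_wdbar_commute:
  fixes f :: "complex^'k::finite \<Rightarrow> complex"
  assumes "open S" "x \<in> S" "C_k_on 2 S f"
  shows "wdbar b (wd a f) x = wd a (wdbar b f) x"
proof -
  let ?D = "\<lambda>u v. frechet_derivative (\<lambda>y. frechet_derivative f (at y) u) (at x) v"
  note d = C_k_on_1_2(4)[OF assms(3,2)]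
  have "((\<lambda>y. (frechet_derivative f (at y) (axis a 1) - \<i> * frechet_derivative f (at y) (axis a \<i>)) / 2) has_derivative
      (\<lambda>h. (?D (axis a 1) h - \<i> * ?D (axis a \<i>) h) / 2)) (at x)"
    by (auto intro!: derivative_eq_intros d)
  hence 1: "wdbar b (wd a f) x = ((?D (axis a 1) (axis b 1) - \<i> * ?D (axis a \<i>) (axis b 1)) / 2 +
      \<i> * ((?D (axis a 1) (axis b \<i>) - \<i> * ?D (axis a \<i>) (axis b \<i>)) / 2)) / 2"
    unfolding wd_def[abs_def] by (rule wdbar_eq)
  have "((\<lambda>y. (frechet_derivative f (at y) (axis b 1) + \<i> * frechet_derivative f (at y) (axis b \<i>)) / 2) has_derivative
      (\<lambda>h. (?D (axis b 1) h + \<i> * ?D (axis b \<i>) h) / 2)) (at x)"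
    by (auto intro!: derivative_eq_intros d)
  hence 2: "wd a (wdbar b f) x = ((?D (axis b 1) (axis a 1) + \<i> * ?D (axis b \<i>) (axis a 1)) / 2 -
      \<i> * ((?D (axis b 1) (axis a \<i>) + \<i> * ?D (axis b \<i>) (axis a \<i>)) / 2)) / 2"
    unfolding wdbar_def[abs_def] by (rule wd_eq)
  show ?thesis
    unfolding 1 2 symmetric_second_derivative[OF assms, of "axis a _" "axis b _"] by (simp add: field_simps)
qed

section \<open>Hermitian forms in fibre coordinates\<close>

text \<open>The coefficients may be arbitrary functions, not only Hermitian ones, so that base
  derivatives of such a form are again of this shape.\<close>

definition hform :: "('r \<Rightarrow> 'r \<Rightarrow> complex^'n \<Rightarrow> complex) \<Rightarrow> complex^('n::finite + 'r::finite) \<Rightarrow> complex" where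
  "hform M x = (\<Sum>i\<in>UNIV. \<Sum>j\<in>UNIV. M i j (zpart x) * x $ Inr i * cnj (x $ Inr j))"

lemma bounded_linear_zpart: "bounded_linear (zpart :: complex^('n::finite + 'r::finite) \<Rightarrow> _)"
  unfolding linear_conv_bounded_linear[symmetric]
  by (rule linearI) (simp_all add: vec_eq_iff zpart_def)

lemma zpart_join [simp]: "zpart (join z v) = z" and vpart_join [simp]: "vpart (join z v) = v"
  by (simp_all add: zpart_def vpart_def vec_eq_iff)

lemma vpart_nth: "vpart x $ i = x $ Inr i"
  by (simp add: vpart_def)

lemma zpart_axis [simp]: "zpart (axis (Inl a) e) = axis a e" "zpart (axis (Inr i) e) = 0"
  by (simp_all add: vec_eq_iff zpart_def axis_apply)

lemma hform_sesq: "hform (\<lambda>i j z. A z $ i $ j) x = sesq (A (zpart x)) (vpart x) (vpart x)"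
  by (simp add: hform_def sesq_def vpart_nth)

lemma nth_has_derivative: "((\<lambda>y. y $ b) has_derivative (\<lambda>h. h $ b)) (at x)"
  by (rule bounded_linear_imp_has_derivative[OF bounded_linear_vec_nth])

lemma cnj_nth_has_derivative: "((\<lambda>y. cnj (y $ b)) has_derivative (\<lambda>h. cnj (h $ b))) (at x)"
  by (rule bounded_linear.has_derivative[OF bounded_linear_cnj nth_has_derivative])

lemma compose_zpart_has_derivative:
  "(M has_derivative M') (at (zpart x)) \<Longrightarrow> ((\<lambda>y. M (zpart y)) has_derivative (\<lambda>h. M' (zpart h))) (at x)"
  by (rule has_derivative_compose[OF bounded_linear_imp_has_derivative[OF bounded_linear_zpart]])

lemma hform_has_derivative:
  assumes "\<And>i j. (M i j has_derivative M' i j) (at (zpart x))"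
  shows "(hform M has_derivative (\<lambda>h. \<Sum>i\<in>UNIV. \<Sum>j\<in>UNIV.
    (M i j (zpart x) * x $ Inr i) * cnj (h $ Inr j) +
    (M i j (zpart x) * h $ Inr i + M' i j (zpart h) * x $ Inr i) * cnj (x $ Inr j))) (at x)"
  unfolding hform_def[abs_def]
  by (intro has_derivative_sum has_derivative_mult nth_has_derivative cnj_nth_has_derivative
      compose_zpart_has_derivative assms)

lemma hform_derivatives:
  assumes "\<And>i j. M i j differentiable (at (zpart x))"
  shows "wd (Inl a) (hform M) x = hform (\<lambda>i j. wd a (M i j)) x"
    "wdbar (Inl a) (hform M) x = hform (\<lambda>i j. wdbar a (M i j)) x"
    "wd (Inr p) (hform M) x = (\<Sum>j\<in>UNIV. M p j (zpart x) * cnj (x $ Inr j))"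
    "wdbar (Inr p) (hform M) x = (\<Sum>i\<in>UNIV. M i p (zpart x) * x $ Inr i)"
proof -
  let ?M' = "\<lambda>i j. frechet_derivative (M i j) (at (zpart x))"
  have "(M i j has_derivative ?M' i j) (at (zpart x))" for i j
    using assms by (simp add: frechet_derivative_works)
  note d = hform_has_derivative[of M ?M' x, OF this]
  show "wd (Inl a) (hform M) x = hform (\<lambda>i j. wd a (M i j)) x"
    unfolding wd_eq[OF d] unfolding hform_def wd_def
    by (simp add: axis_apply sum_distrib_left sum_subtractf[symmetric] sum_divide_distrib)
      (intro sum.cong refl, simp add: field_simps)
  show "wdbar (Inl a) (hform M) x = hform (\<lambda>i j. wdbar a (M i j)) x"
    unfolding wdbar_eq[OF d] unfolding hform_def wdbar_def
    by (simp add: axis_apply sum_distrib_left sum.distrib[symmetric] sum_divide_distrib)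
      (intro sum.cong refl, simp add: field_simps)
  let ?S = "\<Sum>i\<in>UNIV. M i p (zpart x) * x $ Inr i" and ?T = "\<Sum>j\<in>UNIV. M p j (zpart x) * cnj (x $ Inr j)"
  have z: "?M' i j 0 = 0" for i j
    using linear_0[OF has_derivative_linear[OF \<open>(M i j has_derivative ?M' i j) (at (zpart x))\<close>]] .
  have e: "(\<Sum>i\<in>UNIV. \<Sum>j\<in>UNIV. (M i j (zpart x) * x $ Inr i) * cnj (axis (Inr p) e $ Inr j) +
    (M i j (zpart x) * axis (Inr p) e $ Inr i + ?M' i j (zpart (axis (Inr p) e)) * x $ Inr i) * cnj (x $ Inr j)) =
    cnj e * ?S + e * ?T" for e
  proof -
    have h1: "(\<Sum>i\<in>UNIV. \<Sum>j\<in>UNIV. (M i j (zpart x) * x $ Inr i) * cnj (axis (Inr p) e $ Inr j)) = cnj e * ?S"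
      unfolding sum_distrib_left by (intro sum.cong refl)
        (simp add: axis_apply if_distrib[where f = cnj] if_distrib[where f = "\<lambda>x. _ * x"] mult_ac cong: if_cong)
    have h2: "(\<Sum>i\<in>UNIV. \<Sum>j\<in>UNIV. M i j (zpart x) * axis (Inr p) e $ Inr i * cnj (x $ Inr j)) = e * ?T"
      unfolding sum_distrib_left by (subst sum.swap, intro sum.cong refl)
        (simp add: axis_apply if_distrib[where f = "\<lambda>x. _ * x"] if_distrib[where f = "\<lambda>x. x * _"] mult_ac cong: if_cong)
    have h3: "(\<Sum>i\<in>UNIV. \<Sum>j\<in>UNIV. ?M' i j (zpart (axis (Inr p) e)) * x $ Inr i * cnj (x $ Inr j)) = 0"
      by (simp add: z)
    show ?thesis unfolding distrib_right sum.distrib h1 h2 h3 by simp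
  qed
  show "wd (Inr p) (hform M) x = ?T" unfolding wd_eq[OF d] e by (simp add: field_simps)
  show "wdbar (Inr p) (hform M) x = ?S" unfolding wdbar_eq[OF d] e by (simp add: field_simps)
qed

lemma wd_linear_form:
  assumes "\<And>i. M i differentiable (at (zpart x))"
  shows "((\<lambda>y. \<Sum>i\<in>UNIV. M i (zpart y) * y $ Inr i) has_derivative
     (\<lambda>h. \<Sum>i\<in>UNIV. M i (zpart x) * h $ Inr i + frechet_derivative (M i) (at (zpart x)) (zpart h) * x $ Inr i)) (at x)"
    "wd (Inr p) (\<lambda>y. \<Sum>i\<in>UNIV. M i (zpart y) * y $ Inr i) x = M p (zpart x)"
proof -
  have M: "(M i has_derivative frechet_derivative (M i) (at (zpart x))) (at (zpart x))" for i
    using assms by (simp add: frechet_derivative_works)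
  show d: "((\<lambda>y. \<Sum>i\<in>UNIV. M i (zpart y) * y $ Inr i) has_derivative
     (\<lambda>h. \<Sum>i\<in>UNIV. M i (zpart x) * h $ Inr i + frechet_derivative (M i) (at (zpart x)) (zpart h) * x $ Inr i)) (at x)"
    by (intro has_derivative_sum has_derivative_mult nth_has_derivative compose_zpart_has_derivative M)
  have z: "frechet_derivative (M i) (at (zpart x)) 0 = 0" for i
    using linear_0[OF has_derivative_linear[OF M[of i]]] .
  show "wd (Inr p) (\<lambda>y. \<Sum>i\<in>UNIV. M i (zpart y) * y $ Inr i) x = M p (zpart x)"
  proof -
    have e: "(\<Sum>i\<in>UNIV. M i (zpart x) * axis (Inr p) e $ Inr i + frechet_derivative (M i) (at (zpart x)) (zpart (axis (Inr p) e)) * x $ Inr i) =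
        M p (zpart x) * e" for e
      by (simp add: z axis_apply if_distrib[where f = "\<lambda>x. _ * x"] cong: if_cong)
    show ?thesis unfolding wd_eq[OF d] e by (simp add: field_simps)
  qed
qed

lemma wd_wdbar_hform:
  fixes x :: "complex^('n::finite + 'r::finite)"
  assumes "open D" "zpart x \<in> D" "\<And>i j y. y \<in> D \<Longrightarrow> M i j differentiable (at y)"
  shows "wd (Inr p) (wdbar (Inr q) (hform M)) x = M p q (zpart x)"
proof -
  have U: "open (zpart -` D :: (complex^('n + 'r)) set)"
    by (intro open_vimage assms bounded_linear.continuous_on[OF bounded_linear_zpart] continuous_on_id)
  have "wd (Inr p) (wdbar (Inr q) (hform M)) x = wd (Inr p) (\<lambda>y. \<Sum>i\<in>UNIV. M i q (zpart y) * y $ Inr i) x"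
    by (rule wd_cong_open[OF U]) (use assms in \<open>auto intro!: hform_derivatives\<close>)
  thus ?thesis using assms(2,3) wd_linear_form(2)[of "\<lambda>i. M i q" x p] by simp
qed

text \<open>With F = \<open>hform M\<close> this is (F_pq - F_p F_q / F) / F, the index q being
  conjugate. Fibre indices suffice because the powers of \<open>Xi\<close> end up evaluated on
  vertical vectors.\<close>

lemma wd_wdbar_log_hform:
  fixes x :: "complex^('n::finite + 'r::finite)" and g :: "complex^('n + 'r) \<Rightarrow> real"
  assumes "open U" "x \<in> U" and M: "\<And>i j y. y \<in> U \<Longrightarrow> M i j differentiable (at (zpart y))"
    and g: "\<And>y. y \<in> U \<Longrightarrow> hform M y = of_real (g y)" "\<And>y. y \<in> U \<Longrightarrow> 0 < g y"
  shows "wd (Inr p) (wdbar (Inr q) (\<lambda>y. of_real (ln (g y)))) x =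
    (M p q (zpart x) - (\<Sum>j\<in>UNIV. M p j (zpart x) * cnj (x $ Inr j)) * (\<Sum>i\<in>UNIV. M i q (zpart x) * x $ Inr i) / of_real (g x)) / of_real (g x)"
proof -
  let ?F = "hform M" and ?S = "\<lambda>y. \<Sum>i\<in>UNIV. M i q (zpart y) * y $ Inr i"
  have F: "(?F has_derivative frechet_derivative ?F (at y)) (at y)" if "y \<in> U" for y
  proof -
    have "(M i j has_derivative frechet_derivative (M i j) (at (zpart y))) (at (zpart y))" for i j
      using M[OF that] by (simp add: frechet_derivative_works)
    from differentiableI[OF hform_has_derivative[of M _ y, OF this]] show ?thesis
      by (simp only: frechet_derivative_works)
  qed
  have 1: "wdbar (Inr q) (\<lambda>y. of_real (ln (g y))) y = ?S y / ?F y" if y: "y \<in> U" for y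
  proof -
    let ?F' = "frechet_derivative ?F (at y)"
    have "((\<lambda>y. Re (?F y)) has_derivative (\<lambda>h. Re (?F' h))) (at y)"
      by (rule bounded_linear.has_derivative[OF bounded_linear_Re F[OF y]])
    hence dg: "(g has_derivative (\<lambda>h. Re (?F' h))) (at y)"
      by (subst has_derivative_cong_open[OF assms(1) y, of _ "\<lambda>y. Re (?F y)"]) (simp_all add: g(1))
    have "((\<lambda>y. complex_of_real (g y)) has_derivative (\<lambda>h. of_real (Re (?F' h)))) (at y)"
      by (rule bounded_linear.has_derivative[OF bounded_linear_of_real dg])
    hence "(?F has_derivative (\<lambda>h. of_real (Re (?F' h)))) (at y)"
      by (subst has_derivative_cong_open[OF assms(1) y, of _ "\<lambda>y. of_real (g y)"]) (simp_all add: g(1))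
    \<comment> \<open>F equals the real function \<open>g\<close> on \<open>U\<close>, so its
      derivative is real; this carries the derivative of ln g over to the complex-valued F.\<close>
    from has_derivative_unique[OF F[OF y] this] have re: "of_real (Re (?F' h)) = ?F' h" for h
      by metis
    have "((\<lambda>y. ln (g y)) has_derivative (\<lambda>h. Re (?F' h) / g y)) (at y)"
      using g(2)[OF y] by (auto intro!: derivative_eq_intros dg simp: divide_inverse)
    from bounded_linear.has_derivative[OF bounded_linear_of_real this]
    have "((\<lambda>y. complex_of_real (ln (g y))) has_derivative (\<lambda>h. of_real (Re (?F' h) / g y))) (at y)" .
    from wdbar_eq[OF this, of "Inr q"]
    moreover have "(a / F + \<i> * (b / F)) / 2 = ((a + \<i> * b) / 2) / F" for a b F :: complex
      by (cases "F = 0") (simp_all add: field_simps)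
    ultimately have "wdbar (Inr q) (\<lambda>y. of_real (ln (g y))) y = wdbar (Inr q) ?F y / ?F y"
      unfolding wdbar_def[of _ ?F] of_real_divide re g(1)[OF y, symmetric] by (simp only:)
    thus ?thesis using hform_derivatives(4)[of M y q] M[OF y] by simp
  qed
  have Fx: "?F x \<noteq> 0" using g[OF assms(2)] by simp
  have "wd (Inr p) (wdbar (Inr q) (\<lambda>y. of_real (ln (g y)))) x = wd (Inr p) (\<lambda>y. ?S y / ?F y) x"
    by (rule wd_cong_open[OF assms(1,2) 1])
  also have "\<dots> = (wd (Inr p) ?S x * ?F x - ?S x * wd (Inr p) ?F x) / (?F x * ?F x)"
  proof -
    have "(?S has_derivative frechet_derivative ?S (at x)) (at x)"
      using differentiableI[OF wd_linear_form(1)[of "\<lambda>i. M i q" x, OF M[OF assms(2)]]]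
      by (simp only: frechet_derivative_works)
    from has_derivative_divide'[OF this F[OF assms(2)] Fx]
    have "((\<lambda>y. ?S y / ?F y) has_derivative (\<lambda>h. (frechet_derivative ?S (at x) h * ?F x - ?S x * frechet_derivative ?F (at x) h) / (?F x * ?F x))) (at x)" .
    note lhs = wd_eq[OF this, of "Inr p"]
    have "((a * F - S * b) / (F * F) - \<i> * ((a' * F - S * b') / (F * F))) / 2 =
        ((a - \<i> * a') / 2 * F - S * ((b - \<i> * b') / 2)) / (F * F)" for a a' b b' S F :: complex
      by (cases "F = 0") (simp_all add: field_simps)
    thus ?thesis unfolding lhs wd_def[of _ ?S] wd_def[of _ ?F] .
  qed
  also have "wd (Inr p) ?S x = M p q (zpart x)"
    using wd_linear_form(2)[of "\<lambda>i. M i q" x p] M[OF assms(2)] by simp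
  also have "wd (Inr p) ?F x = (\<Sum>j\<in>UNIV. M p j (zpart x) * cnj (x $ Inr j))"
    using hform_derivatives(3)[of M x p] M[OF assms(2)] by simp
  finally show ?thesis
    using Fx unfolding g(1)[OF assms(2)] by (simp add: field_simps)
qed

section \<open>Metrics, curvature and fibre integrals in coordinates\<close>

section \<open>Hermitian metrics in coordinates\<close>

definition base_dom :: "('m, 'n::finite) chart \<Rightarrow> ('e, 'm, 'r::finite) triv \<Rightarrow> (complex^'n) set" where
  "base_dom c t = snd c ` (fst c \<inter> fst t)"

text \<open>Three derivatives are asked for because the fibre derivatives in
  \<open>kobayashi_coeff\<close> come from Frechet derivatives on the total space. They are applied
  to functions that contain two base derivatives of A, and these must be differentiable once
  more.\<close>

definition herm_coord :: "('m, 'n::finite, 'e, 'r::finite) vbundle \<Rightarrow> ('m, 'n) chart \<Rightarrow> ('e, 'm, 'r) triv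
    \<Rightarrow> ('e \<Rightarrow> 'e \<Rightarrow> complex) \<Rightarrow> (complex^'n \<Rightarrow> complex^'r^'r) \<Rightarrow> bool" where
  "herm_coord B c t h A \<longleftrightarrow> (\<forall>y\<in>base_dom c t. pos_def_hermitian (A y)) \<and>
    (\<forall>x x'. zpart x \<in> base_dom c t \<longrightarrow> zpart x = zpart x' \<longrightarrow>
       h (point B c t x) (point B c t x') = sesq (A (zpart x)) (vpart x) (vpart x')) \<and>
    (\<forall>i j. C_k_on 3 (base_dom c t) (\<lambda>y. A y $ i $ j))"

definition wd_matrix :: "'n::finite \<Rightarrow> (complex^'n \<Rightarrow> complex^'r^'r) \<Rightarrow> complex^'n \<Rightarrow> complex^'r^'r" where
  "wd_matrix a A z = (\<chi> i j. wd a (\<lambda>y. A y $ i $ j) z)"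

definition wdbar_matrix :: "'n::finite \<Rightarrow> (complex^'n \<Rightarrow> complex^'r^'r) \<Rightarrow> complex^'n \<Rightarrow> complex^'r^'r" where
  "wdbar_matrix b A z = (\<chi> i j. wdbar b (\<lambda>y. A y $ i $ j) z)"

lemma chart_props:
  assumes "closed_complex_manifold B" "c \<in> charts B"
  shows "openin (base B) (fst c)" "open (snd c ` fst c)"
    "homeomorphic_map (subtopology (base B) (fst c)) (top_of_set (snd c ` fst c)) (snd c)"
    "inj_on (snd c) (fst c)"
proof -
  show 1: "openin (base B) (fst c)" "open (snd c ` fst c)"
    "homeomorphic_map (subtopology (base B) (fst c)) (top_of_set (snd c ` fst c)) (snd c)"
    using assms unfolding closed_complex_manifold_def by (auto simp: case_prod_beta)
  have "topspace (subtopology (base B) (fst c)) = fst c"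
    using openin_subset[OF 1(1)] by auto
  thus "inj_on (snd c) (fst c)" using homeomorphic_imp_injective_map[OF 1(3)] by simp
qed

lemma chart_inv_mem:
  assumes "closed_complex_manifold B" "c \<in> charts B" "z \<in> snd c ` fst c"
  shows "chart_inv c z \<in> fst c" "chart_inv c z \<in> topspace (base B)"
proof -
  show "chart_inv c z \<in> fst c" using assms(3) by (auto simp: chart_inv_def inv_into_into)
  thus "chart_inv c z \<in> topspace (base B)"
    using openin_subset[OF chart_props(1)[OF assms(1,2)]] by blast
qed

lemma triv_at_mem:
  assumes "closed_complex_manifold B" "holomorphic_vector_bundle B" "c \<in> charts B" "z \<in> snd c ` fst c"
  shows "triv_at B c z \<in> trivs B" "z \<in> base_dom c (triv_at B c z)"
proof -
  have "chart_inv c z \<in> (\<Union>(W, \<tau>)\<in>trivs B. W)"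
    using chart_inv_mem[OF assms(1,3,4)] assms(2) unfolding holomorphic_vector_bundle_def by simp
  hence "\<exists>t. t \<in> trivs B \<and> chart_inv c z \<in> fst t" by force
  from someI_ex[OF this] have *: "triv_at B c z \<in> trivs B" "chart_inv c z \<in> fst (triv_at B c z)"
    by (simp_all add: triv_at_def)
  thus "triv_at B c z \<in> trivs B" by simp
  have "snd c (chart_inv c z) = z" using assms(4) by (simp add: chart_inv_def f_inv_into_f)
  thus "z \<in> base_dom c (triv_at B c z)"
    unfolding base_dom_def using *(2) chart_inv_mem(1)[OF assms(1,3,4)] by (metis IntI image_eqI)
qed

lemma bounded_linear_vpart: "bounded_linear (vpart :: complex^('n::finite + 'r::finite) \<Rightarrow> _)"
  unfolding linear_conv_bounded_linear[symmetric]
  by (rule linearI) (simp_all add: vec_eq_iff vpart_def)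

text \<open>Since v_k = 1, both \<open>P\<close> and \<open>P'\<close> have determinant 1. The
  product P A P' has A(v, v) at (k, k) and the contractions of A with v and its conjugate in the
  rest of row and column k, so the matrix on the left is its Schur complement at k with row and
  column k deleted.\<close>

lemma det_affine_minor:
  fixes A :: "complex^'r::finite^'r"
  assumes xs: "distinct xs" "set xs = UNIV - {k}" "length xs = m"
    and v: "v $ k = 1" and F: "sesq A v v \<noteq> 0"
  shows "Determinant.det (Matrix.mat m m (\<lambda>(i, j). A $ (xs ! i) $ (xs ! j) -
     (\<Sum>l\<in>UNIV. A $ (xs ! i) $ l * cnj (v $ l)) * (\<Sum>l\<in>UNIV. A $ l $ (xs ! j) * v $ l) / sesq A v v)) = det A / sesq A v v"
proof -
  define T where "T i = (\<Sum>l\<in>UNIV. A $ i $ l * cnj (v $ l))" for i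
  define S where "S j = (\<Sum>l\<in>UNIV. A $ l $ j * v $ l)" for j
  define P where "P = (\<chi> i j. if i = k then v $ j else if i = j then 1 else 0)"
  define P' where "P' = (\<chi> i j. if j = k then cnj (v $ i) else if i = j then 1 else 0)"
  define M where "M = P ** A ** P'"
  have PA: "(P ** A) $ i $ l = (if i = k then S l else A $ i $ l)" for i l
    unfolding matrix_matrix_mult_def P_def S_def
    by (cases "i = k") (simp_all add: mult.commute if_distrib[where f = "\<lambda>x. _ * x"] cong: if_cong)
  have M: "M $ i $ j = (if j = k then (\<Sum>l\<in>UNIV. (P ** A) $ i $ l * cnj (v $ l)) else (P ** A) $ i $ j)" for i j
    unfolding M_def matrix_matrix_mult_def[of "P ** A"] P'_def
    by (simp add: if_distrib[where f = "\<lambda>x. _ * x"] cong: if_cong)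
  have Mk: "M $ k $ k = sesq A v v"
    unfolding M PA by (simp add: S_def sesq_def sum_distrib_right) (rule sum.swap)
  have "det P = 1" unfolding P_def det_identity_row by (rule v)
  moreover have "det P' = 1"
  proof -
    have "transpose P' = (\<chi> i j. if i = k then (\<chi> j. cnj (v $ j)) $ j else if i = j then 1 else 0)"
      by (auto simp: transpose_def P'_def vec_eq_iff)
    hence "det (transpose P') = 1" by (simp only: det_identity_row) (simp add: v)
    thus ?thesis by simp
  qed
  ultimately have "det M = det A" by (simp add: M_def det_mul)
  hence "det (schur M k) = det A / sesq A v v"
    using det_schur[of M k] F unfolding Mk by (simp add: eq_divide_eq mult.commute)
  moreover have "schur M k = (\<chi> i j. if i = k \<or> j = k then (if i = j then 1 else 0) else A $ i $ j - T i * S j / sesq A v v)"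
    unfolding schur_def Mk by (auto simp: vec_eq_iff M PA T_def)
  ultimately show ?thesis
    using det_masked[OF xs, of "\<lambda>i j. A $ i $ j - T i * S j / sesq A v v"] by (simp add: T_def S_def)
qed

lemma enumeration_props:
  "distinct (enumeration (S :: 'k::finite set))" "set (enumeration S) = S" "length (enumeration S) = card S"
proof -
  have "\<exists>xs. distinct xs \<and> set xs = S" using finite_distinct_list[of S] by auto
  from someI_ex[OF this] show *: "distinct (enumeration S)" "set (enumeration S) = S"
    by (simp_all add: enumeration_def)
  thus "length (enumeration S) = card S" using distinct_card by metis
qed

lemma affine_vec_eq: "affine_vec w = affine_point proj_index (UNIV - {proj_index}) w"
  by (auto simp: affine_vec_def affine_point_def vec_eq_iff)

context
  fixes B :: "('m, 'n::finite, 'e, 'r::finite) vbundle" and c t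
  assumes M: "closed_complex_manifold B" and E: "holomorphic_vector_bundle B"
    and c: "c \<in> charts B" and t: "t \<in> trivs B"
begin

lemma open_base_dom: "open (base_dom c t)"
proof -
  have "openin (base B) (fst t)" using E t unfolding holomorphic_vector_bundle_def by (auto simp: case_prod_beta)
  hence "openin (subtopology (base B) (fst c)) (fst c \<inter> fst t)" by (rule openin_subtopology_Int2)
  hence "openin (top_of_set (snd c ` fst c)) (snd c ` (fst c \<inter> fst t))"
    using homeomorphic_imp_open_map[OF chart_props(3)[OF M c]] by (simp add: open_map_def)
  thus ?thesis unfolding base_dom_def using openin_open_trans chart_props(2)[OF M c] by blast
qed

lemma base_dom_chart_inv: "y \<in> base_dom c t \<Longrightarrow> chart_inv c y \<in> fst c \<inter> fst t"
  using chart_props(4)[OF M c] by (auto simp: base_dom_def chart_inv_def inv_into_f_f)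

lemma point_props:
  assumes "zpart x \<in> base_dom c t"
  shows "point B c t x \<in> fibre B (chart_inv c (zpart x))" "snd t (point B c t x) = vpart x"
proof -
  let ?f = "fibre B (chart_inv c (zpart x))"
  have bij: "bij_betw (snd t) ?f UNIV"
    using E t base_dom_chart_inv[OF assms] unfolding holomorphic_vector_bundle_def by (auto simp: case_prod_beta)
  have "vpart x \<in> snd t ` ?f" using bij by (simp add: bij_betw_def)
  then obtain e where "e \<in> ?f" "snd t e = vpart x" by auto
  hence "\<exists>!e. e \<in> ?f \<and> snd t e = vpart x"
    using inj_onD[OF bij_betw_imp_inj_on[OF bij]] by (intro ex1I[of _ e]) auto
  from theI'[OF this] show "point B c t x \<in> fibre B (chart_inv c (zpart x))" "snd t (point B c t x) = vpart x"
    by (simp_all add: point_def)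
qed

lemma hermitian_metric_herm_coord:
  assumes "hermitian_metric B h"
  shows "\<exists>A. herm_coord B c t h A"
proof -
  obtain A where A: "\<And>p. p \<in> fst t \<Longrightarrow> pos_def_hermitian (A p)"
    "\<And>p e e'. p \<in> fst t \<Longrightarrow> e \<in> fibre B p \<Longrightarrow> e' \<in> fibre B p \<Longrightarrow> h e e' = sesq (A p) (snd t e) (snd t e')"
    "smooth_on (base_dom c t) (\<lambda>z. A (chart_inv c z))"
    using assms t c unfolding hermitian_metric_def base_dom_def by (fastforce simp: case_prod_beta)
  have "C_k_on 3 (base_dom c t) (\<lambda>y. A (chart_inv c y) $ i $ j)" for i j
    using A(3) unfolding smooth_on_def
    by (intro C_k_on_linear[OF open_base_dom bounded_linear_vec_nth]) auto
  moreover have "h (point B c t x) (point B c t x') = sesq (A (chart_inv c (zpart x))) (vpart x) (vpart x')"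
    if "zpart x \<in> base_dom c t" "zpart x = zpart x'" for x x'
    using A(2)[OF _ point_props(1)[OF that(1)], of "point B c t x'"] point_props that base_dom_chart_inv[OF that(1)]
    by simp
  ultimately have "herm_coord B c t h (\<lambda>z. A (chart_inv c z))"
    unfolding herm_coord_def using A(1) base_dom_chart_inv by auto
  thus ?thesis by blast
qed

context
  fixes h A
  assumes A: "herm_coord B c t h A"
begin

private abbreviation "D \<equiv> base_dom c t"

lemma herm_coord_pos_def: "y \<in> D \<Longrightarrow> pos_def_hermitian (A y)"
  using A by (simp add: herm_coord_def)

lemma herm_coord_C3: "C_k_on 3 D (\<lambda>y. A y $ i $ j)"
  using A by (simp add: herm_coord_def)

lemma herm_coord_C2: "C_k_on 2 D (\<lambda>y. A y $ i $ j)"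
  using C_k_on_pred[of 2 D "\<lambda>y. A y $ i $ j"] herm_coord_C3 by (simp add: eval_nat_numeral)

lemma herm_coord_det: "y \<in> D \<Longrightarrow> det (A y) \<noteq> 0"
  using det_pos_def_hermitian[OF herm_coord_pos_def] by fastforce

lemma herm_coord_matrix: "y \<in> D \<Longrightarrow> herm_matrix B c t h y = A y"
proof -
  assume y: "y \<in> D"
  have "h (point B c t (join y (axis i 1))) (point B c t (join y (axis j 1))) = A y $ i $ j" for i j
    using A y by (simp add: herm_coord_def sesq_axis_left axis_apply if_distrib[where f = cnj] sum_delta_mult cong: if_cong)
  thus ?thesis by (simp add: herm_matrix_def vec_eq_iff)
qed

lemma herm_coord_finsler:
  assumes "zpart x \<in> D"
  shows "sesq (A (zpart x)) (vpart x) (vpart x) = of_real (finsler_of h (point B c t x))"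
    "vpart x \<noteq> 0 \<Longrightarrow> 0 < finsler_of h (point B c t x)"
proof -
  have h: "h (point B c t x) (point B c t x) = sesq (A (zpart x)) (vpart x) (vpart x)"
    using A assms by (simp add: herm_coord_def)
  show "sesq (A (zpart x)) (vpart x) (vpart x) = of_real (finsler_of h (point B c t x))"
    unfolding finsler_of_def h
    by (rule hermitian_sesq_real) (rule pos_def_hermitian_cnj[OF herm_coord_pos_def[OF assms]])
  show "vpart x \<noteq> 0 \<Longrightarrow> 0 < finsler_of h (point B c t x)"
    unfolding finsler_of_def h by (rule pos_def_hermitian_pos[OF herm_coord_pos_def[OF assms]])
qed

lemma herm_coord_hform:
  assumes "zpart x \<in> D"
  shows "coord_expr B c t (finsler_of h) x = hform (\<lambda>i j y. A y $ i $ j) x"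
  using herm_coord_finsler(1)[OF assms] by (simp add: coord_expr_def hform_sesq)

text \<open>The product rule for -dbar (dA A^-1), with -A^-1 (dbar A) A^-1 for the derivative of the
  inverse. The second derivatives are then commuted into the order used by
  \<open>kobayashi_coeff\<close>.\<close>

lemma chern_curvature_eq:
  assumes z: "z \<in> D"
  shows "chern_curvature B c t h z a b =
    (wd_matrix a A z ** matrix_inv (A z) ** wdbar_matrix b A z - wd_matrix a (wdbar_matrix b A) z) ** matrix_inv (A z)"
proof -
  let ?I = "\<lambda>y. matrix_inv (A y)"
  note C2 = C_k_on_1_2[OF herm_coord_C2 z]
  let ?A' = "\<lambda>h. \<chi> i j. frechet_derivative (\<lambda>y. A y $ i $ j) (at z) h"
  have inv: "((\<lambda>y. ?I y $ k $ j) has_derivative (\<lambda>h. - (?I z ** ?A' h ** ?I z) $ k $ j)) (at z)" for k j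
  proof -
    have "((\<lambda>y. ?I y $ k $ j) has_derivative (\<lambda>h. - (?I z ** ?A' h ** ?I z) $ k $ j)) (at z within D)"
      by (rule matrix_inv_has_derivative[OF _ herm_coord_det z]) (simp_all add: C2(3) has_derivative_at_withinI)
    thus ?thesis using at_within_open[OF z open_base_dom] by simp
  qed
  have wI: "wdbar b (\<lambda>y. ?I y $ k $ j) z = - (?I z ** wdbar_matrix b A z ** ?I z) $ k $ j" for k j
    unfolding wdbar_eq[OF inv] unfolding matrix_mult_triple wdbar_matrix_def wdbar_def
    by (simp add: sum_negf[symmetric] sum_distrib_left sum.distrib[symmetric] sum_divide_distrib)
      (intro sum.cong refl, simp add: field_simps)
  have "chern_curvature B c t h z a b $ i $ j = ((wd_matrix a A z ** ?I z ** wdbar_matrix b A z - wd_matrix a (wdbar_matrix b A) z) ** ?I z) $ i $ j" for i j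
  proof -
    let ?w = "\<lambda>k. wd a (\<lambda>y. A y $ i $ k)"
    have w: "(?w k has_derivative frechet_derivative (?w k) (at z)) (at z)" for k
      using wd_differentiable(1)[OF herm_coord_C2 z] by (simp add: frechet_derivative_works)
    have conn: "chern_connection B c t h y a $ i $ j = (\<Sum>k\<in>UNIV. ?w k y * ?I y $ k $ j)" if y: "y \<in> D" for y
    proof -
      have "wd a (\<lambda>y. herm_matrix B c t h y $ i $ k) y = ?w k y" for k
        by (rule wd_cong_open[OF open_base_dom y]) (simp add: herm_coord_matrix)
      thus ?thesis unfolding chern_connection_def matrix_matrix_mult_def by (simp add: herm_coord_matrix[OF y])
    qed
    have der: "((\<lambda>y. \<Sum>k\<in>UNIV. ?w k y * ?I y $ k $ j) has_derivative
        (\<lambda>h. \<Sum>k\<in>UNIV. ?w k z * - (?I z ** ?A' h ** ?I z) $ k $ j + frechet_derivative (?w k) (at z) h * ?I z $ k $ j)) (at z)"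
      by (intro has_derivative_sum has_derivative_mult w inv)
    have "chern_curvature B c t h z a b $ i $ j = - wdbar b (\<lambda>y. \<Sum>k\<in>UNIV. ?w k y * ?I y $ k $ j) z"
      unfolding chern_curvature_def vec_lambda_beta
      by (intro arg_cong[where f = uminus] wd_cong_open[OF open_base_dom z] conn)
    also have "wdbar b (\<lambda>y. \<Sum>k\<in>UNIV. ?w k y * ?I y $ k $ j) z =
        (\<Sum>k\<in>UNIV. ?w k z * wdbar b (\<lambda>y. ?I y $ k $ j) z + wdbar b (?w k) z * ?I z $ k $ j)"
      unfolding wdbar_eq[OF der] unfolding wdbar_eq[OF inv] unfolding wdbar_def
      by (simp add: sum_distrib_left sum.distrib[symmetric] sum_divide_distrib)
        (intro sum.cong refl, simp add: field_simps)
    also have "\<dots> = (\<Sum>k\<in>UNIV. wd_matrix a A z $ i $ k * - (?I z ** wdbar_matrix b A z ** ?I z) $ k $ j + wd_matrix a (wdbar_matrix b A) z $ i $ k * ?I z $ k $ j)"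
      unfolding wI wd_wdbar_commute[OF open_base_dom z herm_coord_C2] by (simp add: wd_matrix_def wd_matrix_def wdbar_matrix_def)
    also have "\<dots> = - (wd_matrix a A z ** (?I z ** wdbar_matrix b A z ** ?I z)) $ i $ j + (wd_matrix a (wdbar_matrix b A) z ** ?I z) $ i $ j"
      unfolding matrix_matrix_mult_def[of "wd_matrix a A z"] matrix_matrix_mult_def[of "wd_matrix a (wdbar_matrix b A) z"] by (simp add: sum_subtractf)
    finally show ?thesis by (simp add: matrix_diff_rdistrib matrix_mul_assoc)
  qed
  thus ?thesis unfolding vec_eq_iff by blast
qed

lemma curvature_times_metric:
  assumes z: "z \<in> D"
  shows "chern_curvature B c t h z a b ** A z = wd_matrix a A z ** matrix_inv (A z) ** wdbar_matrix b A z - wd_matrix a (wdbar_matrix b A) z"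
  unfolding chern_curvature_eq[OF z]
  by (simp add: matrix_mul_assoc[symmetric] matrix_inv_both[OF herm_coord_det[OF z]])

lemma open_coord_dom: "open (zpart -` D :: (complex^('n + 'r)) set)"
  by (intro open_vimage open_base_dom bounded_linear.continuous_on[OF bounded_linear_zpart] continuous_on_id)

text \<open>A Hermitian metric is quadratic along the fibre, so two fibre derivatives strip off v
  and its conjugate and leave A or its base derivatives. The swapped indices in \<open>Gup\<close>
  turn the double sum into the matrix product dA A^-1 dbar A, the part of R A that is quadratic in
  first derivatives.\<close>

lemma kobayashi_coeff_eq:
  assumes x: "zpart x \<in> D"
  shows "kobayashi_coeff B c t (finsler_of h) x i j a b = (chern_curvature B c t h (zpart x) a b ** A (zpart x)) $ i $ j"
proof -
  let ?F = "coord_expr B c t (finsler_of h)" and ?M = "\<lambda>i j y. A y $ i $ j" and ?U = "zpart -` D :: (complex^('n + 'r)) set"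
  let ?z = "zpart x"
  have xU: "x \<in> ?U" using x by simp
  note d0 = C_k_on_1_2(1)[OF herm_coord_C2]
  note d1 = wd_differentiable[OF herm_coord_C2]
  have F: "?F y = hform ?M y" if "y \<in> ?U" for y using herm_coord_hform that by simp
  have F1: "wd (Inl a) ?F y = hform (\<lambda>i j. wd a (?M i j)) y" "wdbar (Inl b) ?F y = hform (\<lambda>i j. wdbar b (?M i j)) y" if y: "y \<in> ?U" for y
    using wd_cong_open[OF open_coord_dom y F] hform_derivatives(1,2)[of ?M y] d0 y by simp_all
  have F2: "wd (Inl a) (wdbar (Inl b) ?F) y = hform (\<lambda>i j. wd a (wdbar b (?M i j))) y" if y: "y \<in> ?U" for y
    using wd_cong_open(1)[OF open_coord_dom y F1(2)] hform_derivatives(1)[of "\<lambda>i j. wdbar b (?M i j)" y] d1(2) y by simp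
  have second: "wd (Inr p) (wdbar (Inr q) f) x = N p q ?z"
    if "\<And>y. y \<in> ?U \<Longrightarrow> f y = hform N y" "\<And>i j y. y \<in> D \<Longrightarrow> N i j differentiable (at y)" for f N p q
  proof -
    have "wdbar (Inr q) f y = wdbar (Inr q) (hform N) y" if "y \<in> ?U" for y
      by (rule wd_cong_open[OF open_coord_dom that]) fact
    hence "wd (Inr p) (wdbar (Inr q) f) x = wd (Inr p) (wdbar (Inr q) (hform N)) x"
      by (rule wd_cong_open[OF open_coord_dom xU])
    thus ?thesis using wd_wdbar_hform[OF open_base_dom x that(2)] by simp
  qed
  have G: "(\<chi> p q. wd (Inr p) (wdbar (Inr q) ?F) x) = A ?z"
    using second[OF F d0] by (simp add: vec_eq_iff)
  have K1: "wd (Inr p) (wdbar (Inr q) (wd (Inl a) ?F)) x = wd_matrix a A ?z $ p $ q" for p q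
    using second[OF F1(1) d1(1)] by (simp add: wd_matrix_def)
  have K2: "wd (Inr p) (wdbar (Inr q) (wdbar (Inl b) ?F)) x = wdbar_matrix b A ?z $ p $ q" for p q
    using second[OF F1(2) d1(2)] by (simp add: wdbar_matrix_def)
  \<comment> \<open>The mixed base derivative of A must itself be differentiable here, which uses
    the third derivative.\<close>
  have K3: "wd (Inr p) (wdbar (Inr q) (wd (Inl a) (wdbar (Inl b) ?F))) x = wd_matrix a (wdbar_matrix b A) ?z $ p $ q" for p q
  proof -
    have "C_k_on (Suc (Suc 1)) D (?M i j)" for i j
      using herm_coord_C3 by (simp add: numeral_3_eq_3)
    from C_k_on_wd(1)[OF open_base_dom C_k_on_wd(2)[OF open_base_dom this]]
    have "wd a (wdbar b (?M i j)) differentiable (at y)" if "y \<in> D" for i j y using that by auto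
    from second[OF F2 this] show ?thesis by (simp add: wd_matrix_def wdbar_matrix_def)
  qed
  have "(wd_matrix a A ?z ** matrix_inv (A ?z) ** wdbar_matrix b A ?z) $ i $ j =
     (\<Sum>k\<in>UNIV. \<Sum>l\<in>UNIV. matrix_inv (A ?z) $ l $ k * wd_matrix a A ?z $ i $ l * wdbar_matrix b A ?z $ k $ j)"
    unfolding matrix_mult_triple by (subst sum.swap) (simp add: mult_ac)
  thus ?thesis
    unfolding kobayashi_coeff_def Let_def G K1 K2 K3 curvature_times_metric[OF x] by simp
qed

end

end

section \<open>Integrals over the fibres\<close>

lemma det_mat_scale:
  fixes f :: "nat \<Rightarrow> nat \<Rightarrow> complex"
  shows "Determinant.det (Matrix.mat m m (\<lambda>(i, j). \<kappa> * f i j)) = \<kappa> ^ m * Determinant.det (Matrix.mat m m (\<lambda>(i, j). f i j))"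
proof -
  have "Matrix.mat m m (\<lambda>(i, j). \<kappa> * f i j) = \<kappa> \<cdot>\<^sub>m Matrix.mat m m (\<lambda>(i, j). f i j)"
    by (rule eq_matI) auto
  thus ?thesis by simp
qed

lemma wedge_join:
  assumes "length X = 2"
  shows "wedge 1 1 (dz (Inl a)) (dzbar (Inl b)) (map (\<lambda>Y. join Y 0) X) = wedge 1 1 (dz a) (dzbar b) X"
  unfolding wedge_dz_dzbar Det_pair using assms by simp

context
  fixes B :: "('m, 'n::finite, 'e, 'r::finite) vbundle" and c t h A z
  assumes M: "closed_complex_manifold B" and E: "holomorphic_vector_bundle B"
    and c: "c \<in> charts B" and t: "t \<in> trivs B" and A: "herm_coord B c t h A" and z: "z \<in> base_dom c t"
begin

private abbreviation "k \<equiv> proj_index :: 'r"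
private abbreviation "V \<equiv> vertical_frame (enumeration (UNIV - {k})) :: (complex^('n + 'r)) list"
private abbreviation "R \<equiv> \<lambda>a b. chern_curvature B c t h z a b"
private abbreviation "\<nu> \<equiv> \<Pi>\<^sub>M i\<in>UNIV - {k}. (lborel :: complex measure)"
private abbreviation "\<omega> \<equiv> \<lambda>a b. wedge 1 1 (dz a) (dzbar b)"
private abbreviation "dens \<equiv> fact (CARD('r) - 1) * det (A z) / of_real pi ^ (CARD('r) - 1)"

private lemma m_card: "card (UNIV - {k}) = (CARD('r) - 1)"
  by (simp add: card_Diff_singleton)

private lemma Suc_m: "Suc (CARD('r) - 1) = CARD('r)"
  by simp

text \<open>With F = A(v, v), each of the r - 1 fibre coordinates contributes (-2i) * i / (2 pi F) =
  1 / (pi F), and the minor contributes det A / F, so F enters with the power r in total.\<close>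

lemma Xi_power:
  assumes v: "v $ k = 1"
  shows "wedge_power (Xi B c t (finsler_of h) (join z v)) (CARD('r) - 1) V = dens / sesq (A z) v v ^ CARD('r)"
proof -
  define x :: "complex^('n + 'r)" where "x = join z v"
  have x: "zpart x = z" "vpart x = v" "\<And>i. x $ Inr i = v $ i" by (simp_all add: x_def)
  define F where "F = sesq (A z) v v"
  define xs where "xs = enumeration (UNIV - {k})"
  have xs: "distinct xs" "set xs = UNIV - {k}" "length xs = (CARD('r) - 1)"
    unfolding xs_def using enumeration_props m_card by metis+
  have v0: "v \<noteq> 0" using v by auto
  have F0: "F \<noteq> 0" and Fg: "F = of_real (finsler_of h (point B c t x))"
    using herm_coord_finsler[OF M E c t A, of x] x z v0 unfolding F_def by auto
  \<comment> \<open>The zero section is removed: the metric is positive on this open set, and its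
    logarithm can be differentiated there.\<close>
  let ?U = "(zpart -` base_dom c t) \<inter> (vpart -` (- {0})) :: (complex^('n + 'r)) set"
  let ?C = "\<lambda>a b. \<i> / (2 * of_real pi) * wd a (wdbar b (\<lambda>y. of_real (ln (finsler_of h (point B c t y))))) x"
  let ?e = "\<lambda>p q. A z $ p $ q - (\<Sum>l\<in>UNIV. A z $ p $ l * cnj (v $ l)) * (\<Sum>l\<in>UNIV. A z $ l $ q * v $ l) / F"
  have U: "open ?U"
    by (intro open_Int open_coord_dom[OF M E c t A] open_vimage bounded_linear.continuous_on[OF bounded_linear_vpart] continuous_on_id) auto
  have C: "?C (Inr p) (Inr q) = \<i> / (2 * of_real pi * F) * ?e p q" for p q
  proof -
    have "wd (Inr p) (wdbar (Inr q) (\<lambda>y. of_real (ln (finsler_of h (point B c t y))))) x = ?e p q / F"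
      using wd_wdbar_log_hform[OF U, of x "\<lambda>i j y. A y $ i $ j" "\<lambda>y. finsler_of h (point B c t y)" p q]
        herm_coord_finsler[OF M E c t A] C_k_on_1_2(1)[OF herm_coord_C2[OF M E c t A]] x z v0 Fg
      by (simp add: hform_sesq)
    thus ?thesis by simp
  qed
  have "wedge_power (Xi B c t (finsler_of h) x) (CARD('r) - 1) V = fact (CARD('r) - 1) * (- 2 * \<i>) ^ (CARD('r) - 1) *
      Determinant.det (Matrix.mat (CARD('r) - 1) (CARD('r) - 1) (\<lambda>(i, j). \<i> / (2 * of_real pi * F) * ?e (xs ! i) (xs ! j)))"
    unfolding Xi_def xs_def[symmetric] wedge_power_vertical_frame[OF xs(1,3)] C ..
  also have "\<dots> = fact (CARD('r) - 1) * ((- 2 * \<i>) ^ (CARD('r) - 1) * (\<i> / (2 * of_real pi * F)) ^ (CARD('r) - 1)) * (det (A z) / F)"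
    unfolding det_mat_scale using det_affine_minor[OF xs v, of "A z"] F0 by (simp add: F_def)
  also have "(- 2 * \<i>) ^ (CARD('r) - 1) * (\<i> / (2 * of_real pi * F)) ^ (CARD('r) - 1) = 1 / (of_real pi ^ (CARD('r) - 1) * F ^ (CARD('r) - 1))"
  proof -
    have "(- 2 * \<i>) * (\<i> / (2 * of_real pi * F)) = 1 / (of_real pi * F)" using F0 by (simp add: field_simps)
    thus ?thesis by (simp only: power_mult_distrib[symmetric] power_one_over)
  qed
  also have "fact (CARD('r) - 1) * (1 / (of_real pi ^ (CARD('r) - 1) * F ^ (CARD('r) - 1))) * (det (A z) / F) = dens / F ^ CARD('r)"
    using power_Suc[of F "CARD('r) - 1"] unfolding Suc_m by (simp add: mult_ac)
  finally show ?thesis by (simp add: x_def F_def)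
qed

lemma Psi_eq:
  assumes "v \<noteq> 0"
  shows "Psi B c t (finsler_of h) (join z v) = (\<lambda>X. \<Sum>a\<in>UNIV. \<Sum>b\<in>UNIV.
     (\<i> * (sesq (R a b ** A z) v v / sesq (A z) v v)) * wedge 1 1 (dz (Inl a)) (dzbar (Inl b)) X)"
proof -
  have "zpart (join z v :: complex^('n + 'r)) \<in> base_dom c t" using z by simp
  note K = kobayashi_coeff_eq[OF M E c t A this] and F = herm_coord_hform[OF M E c t A this]
  show ?thesis
    unfolding Psi_def K F hform_sesq by (simp add: sesq_def sum_divide_distrib)
qed

private lemma affine_vec_k: "affine_vec w $ k = 1" and affine_vec_nonzero: "affine_vec w \<noteq> 0"
  by (auto simp: affine_vec_def vec_eq_iff)

private lemma frame_eq: "map (join 0) (real_frame (enumeration (UNIV - {k}))) = V"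
  by (simp add: vertical_frame_def)

private lemma real_metric: "of_real (Re (sesq (A z) v v)) = sesq (A z) v v"
  by (rule hermitian_sesq_real[symmetric]) (rule pos_def_hermitian_cnj[OF herm_coord_pos_def[OF M E c t A z]])

private lemma nz: "det (A z) \<noteq> 0" by (rule herm_coord_det[OF M E c t A z])

private lemma Psi_wedge_Xi:
  assumes "length X = 2"
  shows "wedge 2 (2 * (CARD('r) - 1)) (Psi B c t (finsler_of h) (join z (affine_vec w)))
      (wedge_power (Xi B c t (finsler_of h) (join z (affine_vec w))) (CARD('r) - 1)) (map (\<lambda>Y. join Y 0) X @ V) =
    (\<Sum>a\<in>UNIV. \<Sum>b\<in>UNIV. \<i> * \<omega> a b X *
      (sesq (R a b ** A z) (affine_vec w) (affine_vec w) / sesq (A z) (affine_vec w) (affine_vec w))) *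
    (dens / sesq (A z) (affine_vec w) (affine_vec w) ^ CARD('r))"
proof -
  have "length V = 2 * (CARD('r) - 1)" using enumeration_props(3)[of "UNIV - {k}"] m_card by simp
  moreover have "u $ Inl a = 0" if "u \<in> set V" for u a using that by (auto simp: set_vertical_frame)
  ultimately have "wedge 2 (2 * (CARD('r) - 1)) (Psi B c t (finsler_of h) (join z (affine_vec w)))
      (wedge_power (Xi B c t (finsler_of h) (join z (affine_vec w))) (CARD('r) - 1)) (map (\<lambda>Y. join Y 0) X @ V) =
    (\<Sum>a\<in>UNIV. \<Sum>b\<in>UNIV. (\<i> * (sesq (R a b ** A z) (affine_vec w) (affine_vec w) / sesq (A z) (affine_vec w) (affine_vec w))) *
      wedge 1 1 (dz (Inl a)) (dzbar (Inl b)) (map (\<lambda>Y. join Y 0) X :: (complex^('n + 'r)) list)) *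
    wedge_power (Xi B c t (finsler_of h) (join z (affine_vec w))) (CARD('r) - 1) V"
    unfolding Psi_eq[OF affine_vec_nonzero] Xi_def by (intro wedge_horizontal) (use assms in auto)
  thus ?thesis
    unfolding Xi_power[OF affine_vec_k] wedge_join[OF assms] by (simp only: mult_ac)
qed

text \<open>The first moment with C = R_ab A, for which C A^-1 is the curvature itself;
  \<open>dens\<close> cancels the constant of the moment and leaves 1 / r.\<close>

lemma fibre_int_Psi_eq:
  assumes \<Gamma>: "\<Gamma> s = finsler_of h" and X: "length X = 2"
  shows "fibre_int_Psi B c t \<Gamma> s z X =
    (\<Sum>a\<in>UNIV. \<Sum>b\<in>UNIV. \<i> * trace (R a b) * \<omega> a b X) / of_nat CARD('r)"
proof -
  let ?v = "affine_point k (UNIV - {k})"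
  let ?Q = "\<lambda>w. Re (sesq (A z) (?v w) (?v w))"
  have tr: "trace (R a b ** A z ** matrix_inv (A z)) = trace (R a b)" for a b
    by (simp add: matrix_mul_assoc[symmetric] matrix_inv_both[OF nz])
  have "has_bochner_integral \<nu> (\<lambda>w. \<Sum>a\<in>UNIV. \<Sum>b\<in>UNIV. (\<i> * \<omega> a b X * dens) *
      (sesq (R a b ** A z) (?v w) (?v w) / of_real (?Q w ^ Suc CARD('r))))
    (\<Sum>a\<in>UNIV. \<Sum>b\<in>UNIV. (\<i> * \<omega> a b X * dens) *
      (of_real (pi ^ card (UNIV - {k}) / fact (card (UNIV - {k}))) / of_nat CARD('r) *
        trace (R a b ** A z ** matrix_inv (A z)) / det (A z)))"
    by (intro has_bochner_integral_sum bochner_integral_scale moment1 herm_coord_pos_def[OF M E c t A z])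
  note I = has_bochner_integral_integral_eq[OF this]
  have "fibre_int_Psi B c t \<Gamma> s z X = (\<integral>w. (\<Sum>a\<in>UNIV. \<Sum>b\<in>UNIV. (\<i> * \<omega> a b X * dens) *
      (sesq (R a b ** A z) (?v w) (?v w) / of_real (?Q w ^ Suc CARD('r)))) \<partial>\<nu>)"
    unfolding fibre_int_Psi_def fibre_integral_def frame_eq \<Gamma> Psi_wedge_Xi[OF X]
    unfolding of_real_power real_metric affine_vec_eq sum_distrib_right
    by (intro Bochner_Integration.integral_cong refl sum.cong) (simp add: mult_ac)
  also have "\<dots> = (\<Sum>a\<in>UNIV. \<Sum>b\<in>UNIV. \<i> * trace (R a b) * \<omega> a b X) / of_nat CARD('r)"
    unfolding I sum_divide_distrib tr m_card using nz by (intro sum.cong refl) (simp add: mult_ac)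
  finally show ?thesis .
qed

context
  fixes \<Gamma> :: "real \<Rightarrow> 'e \<Rightarrow> real" and s A'
  assumes \<Gamma>: "\<Gamma> s = finsler_of h"
    and vel: "\<And>v. v \<noteq> 0 \<Longrightarrow> complex_of_real (v_fun \<Gamma> s (point B c t (join z v))) = sesq A' v v / sesq (A z) v v"
begin

private abbreviation "W \<equiv> A' ** matrix_inv (A z)"

lemma fibre_int_v_eq: "fibre_int_v B c t \<Gamma> s z = trace W / of_nat CARD('r)"
proof -
  let ?v = "affine_point k (UNIV - {k})"
  let ?Q = "\<lambda>w. Re (sesq (A z) (?v w) (?v w))"
  have "has_bochner_integral \<nu> (\<lambda>w. dens * (sesq A' (?v w) (?v w) / of_real (?Q w ^ Suc CARD('r))))
      (dens * (of_real (pi ^ card (UNIV - {k}) / fact (card (UNIV - {k}))) / of_nat CARD('r) * trace W / det (A z)))"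
    by (intro bochner_integral_scale moment1 herm_coord_pos_def[OF M E c t A z])
  note I = has_bochner_integral_integral_eq[OF this]
  have "fibre_int_v B c t \<Gamma> s z = (\<integral>w. dens * (sesq A' (?v w) (?v w) / of_real (?Q w ^ Suc CARD('r))) \<partial>\<nu>)"
    unfolding fibre_int_v_def fibre_integral_def frame_eq \<Gamma> list.map append_Nil Xi_power[OF affine_vec_k] vel[OF affine_vec_nonzero]
    unfolding of_real_power real_metric affine_vec_eq
    by (intro Bochner_Integration.integral_cong refl) (simp add: mult_ac)
  also have "\<dots> = trace W / of_nat CARD('r)" unfolding I m_card using nz by simp
  finally show ?thesis .
qed

text \<open>The second moment with C = R_ab A and with the velocity \<open>A'\<close> as Hermitian
  direction; cyclicity of the trace puts the product into the order of \<open>tr_VR\<close>.\<close>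

lemma fibre_int_v_Psi_eq:
  assumes A': "\<And>i j. cnj (A' $ i $ j) = A' $ j $ i" and X: "length X = 2"
  shows "fibre_int_v_Psi B c t \<Gamma> s z X =
    (\<Sum>a\<in>UNIV. \<Sum>b\<in>UNIV. \<i> * (trace (W ** R a b) + trace W * trace (R a b)) * \<omega> a b X) /
      of_nat (CARD('r) * (CARD('r) + 1))"
proof -
  let ?v = "affine_point k (UNIV - {k})"
  let ?Q = "\<lambda>w. Re (sesq (A z) (?v w) (?v w))"
  have RA: "R a b ** A z ** matrix_inv (A z) = R a b" for a b
    by (simp add: matrix_mul_assoc[symmetric] matrix_inv_both[OF nz])
  have tr: "trace (R a b ** A z ** matrix_inv (A z) ** A' ** matrix_inv (A z)) = trace (W ** R a b)" for a b
    unfolding RA using trace_mul_sym[of "R a b" W] by (simp only: matrix_mul_assoc)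
  have "has_bochner_integral \<nu> (\<lambda>w. \<Sum>a\<in>UNIV. \<Sum>b\<in>UNIV. (\<i> * \<omega> a b X * dens) *
      (sesq (R a b ** A z) (?v w) (?v w) * sesq A' (?v w) (?v w) / of_real (?Q w ^ Suc (Suc CARD('r)))))
    (\<Sum>a\<in>UNIV. \<Sum>b\<in>UNIV. (\<i> * \<omega> a b X * dens) *
      (of_real (pi ^ card (UNIV - {k}) / fact (card (UNIV - {k}))) / of_nat (CARD('r) * Suc CARD('r)) *
        (trace (R a b ** A z ** matrix_inv (A z) ** A' ** matrix_inv (A z)) +
         trace (R a b ** A z ** matrix_inv (A z)) * trace (A' ** matrix_inv (A z))) / det (A z)))"
    by (intro has_bochner_integral_sum bochner_integral_scale moment2 herm_coord_pos_def[OF M E c t A z] A')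
  note I = has_bochner_integral_integral_eq[OF this]
  have "fibre_int_v_Psi B c t \<Gamma> s z X = (\<integral>w. (\<Sum>a\<in>UNIV. \<Sum>b\<in>UNIV. (\<i> * \<omega> a b X * dens) *
      (sesq (R a b ** A z) (?v w) (?v w) * sesq A' (?v w) (?v w) / of_real (?Q w ^ Suc (Suc CARD('r))))) \<partial>\<nu>)"
    unfolding fibre_int_v_Psi_def fibre_integral_def frame_eq \<Gamma> Psi_wedge_Xi[OF X] vel[OF affine_vec_nonzero]
    unfolding of_real_power real_metric affine_vec_eq sum_distrib_right sum_distrib_left
    by (intro Bochner_Integration.integral_cong refl sum.cong) (simp add: mult_ac)
  also have "\<dots> = (\<Sum>a\<in>UNIV. \<Sum>b\<in>UNIV. \<i> * (trace (W ** R a b) + trace W * trace (R a b)) * \<omega> a b X) /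
      of_nat (CARD('r) * (CARD('r) + 1))"
    unfolding I sum_divide_distrib tr unfolding RA m_card using nz
    by (intro sum.cong refl) (simp add: mult_ac)
  finally show ?thesis .
qed

end

end

section \<open>Dependence on the curve parameter and comparison of the functionals\<close>

section \<open>Curves of Hermitian metrics\<close>

lemma C_k_on_const: "C_k_on k S (\<lambda>x. c)"
  by (induction k arbitrary: c) auto

lemma C_k_on_bounded_linear:
  assumes "bounded_linear L"
  shows "C_k_on k S L"
proof (cases k)
  case 0
  thus ?thesis by (simp add: bounded_linear.continuous_on[OF assms])
next
  case (Suc n)
  have d: "(L has_derivative L) (at x)" for x by (rule bounded_linear_imp_has_derivative[OF assms])
  thus ?thesis by (auto simp: Suc frechet_derivative_eq[OF d] C_k_on_const differentiable_def)
qed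

lemma C_k_on_mult:
  fixes f g :: "'a::real_normed_vector \<Rightarrow> complex"
  assumes "open S"
  shows "C_k_on k S f \<Longrightarrow> C_k_on k S g \<Longrightarrow> C_k_on k S (\<lambda>x. f x * g x)"
proof (induction k arbitrary: f g)
  case 0
  thus ?case by (simp add: continuous_on_mult)
next
  case (Suc k)
  have d: "((\<lambda>x. f x * g x) has_derivative (\<lambda>h. f x * frechet_derivative g (at x) h + frechet_derivative f (at x) h * g x)) (at x)"
    if "x \<in> S" for x
    using Suc.prems that by (intro has_derivative_mult) (auto simp: frechet_derivative_works[symmetric])
  have "C_k_on k S (\<lambda>x. f x * frechet_derivative g (at x) v + frechet_derivative f (at x) v * g x)" for v
    using Suc.prems by (intro C_k_on_add[OF assms] Suc.IH C_k_on_pred[OF Suc.prems(1)] C_k_on_pred[OF Suc.prems(2)]) auto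
  hence "C_k_on k S (\<lambda>x. frechet_derivative (\<lambda>x. f x * g x) (at x) v)" for v
    by (subst C_k_on_cong[OF assms(1), of _ "\<lambda>x. f x * frechet_derivative g (at x) v + frechet_derivative f (at x) v * g x"])
      (auto simp: frechet_derivative_eq[OF d])
  with d show ?case by (auto simp: differentiable_def)
qed

text \<open>The derivative in y is presented as a function on the product
  \<open>I \<times> D\<close>, so that continuity in s can be read off and the lemma can be applied
  once more for mixed derivatives.\<close>

lemma partial_wd:
  fixes P :: "real \<times> (complex^'n::finite) \<Rightarrow> complex"
  assumes I: "open I" and D: "open D" and P: "C_k_on (Suc k) (I \<times> D) P"
  shows "\<exists>P'. C_k_on k (I \<times> D) P' \<and> (\<forall>s\<in>I. \<forall>y\<in>D. wd a (\<lambda>y. P (s, y)) y = P' (s, y))"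
    "\<exists>P'. C_k_on k (I \<times> D) P' \<and> (\<forall>s\<in>I. \<forall>y\<in>D. wdbar a (\<lambda>y. P (s, y)) y = P' (s, y))"
proof -
  have open_ID: "open (I \<times> D)" by (rule open_Times[OF I D])
  let ?D = "\<lambda>v p. frechet_derivative P (at p) (0, v)"
  have der: "((\<lambda>y. P (s, y)) has_derivative (\<lambda>v. ?D v (s, y))) (at y)" if "s \<in> I" "y \<in> D" for s y
  proof -
    have "(P has_derivative frechet_derivative P (at (s, y))) (at (s, y))"
      using P that by (auto simp: frechet_derivative_works[symmetric])
    moreover have "((\<lambda>y. (s, y)) has_derivative (\<lambda>v. (0, v))) (at y)"
      by (auto intro!: derivative_eq_intros)
    ultimately show ?thesis by (rule has_derivative_compose[rotated])
  qed
  have C: "C_k_on k (I \<times> D) (\<lambda>p. c * ?D v p)" for c v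
    using P by (intro C_k_on_linear[OF open_ID bounded_linear_mult_right]) simp
  show "\<exists>P'. C_k_on k (I \<times> D) P' \<and> (\<forall>s\<in>I. \<forall>y\<in>D. wd a (\<lambda>y. P (s, y)) y = P' (s, y))"
  proof (rule exI, rule conjI)
    show "C_k_on k (I \<times> D) (\<lambda>p. 1 / 2 * ?D (axis a 1) p + - \<i> / 2 * ?D (axis a \<i>) p)"
      by (intro C_k_on_add[OF open_ID] C)
  qed (simp add: wd_eq[OF der] diff_divide_distrib)
  show "\<exists>P'. C_k_on k (I \<times> D) P' \<and> (\<forall>s\<in>I. \<forall>y\<in>D. wdbar a (\<lambda>y. P (s, y)) y = P' (s, y))"
  proof (rule exI, rule conjI)
    show "C_k_on k (I \<times> D) (\<lambda>p. 1 / 2 * ?D (axis a 1) p + \<i> / 2 * ?D (axis a \<i>) p)"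
      by (intro C_k_on_add[OF open_ID] C)
  qed (simp add: wdbar_eq[OF der] add_divide_distrib)
qed

text \<open>The entries are required to extend to functions \<open>P i j\<close> over an open
  \<open>I\<close> because \<open>C_k_on\<close> uses two-sided derivatives. The extension need not
  be Hermitian or positive outside the unit interval, where it is not compared with
  \<open>A\<close>.\<close>

definition curve_coord :: "('m, 'n::finite, 'e, 'r::finite) vbundle \<Rightarrow> ('m, 'n) chart \<Rightarrow> ('e, 'm, 'r) triv
    \<Rightarrow> (real \<Rightarrow> 'e \<Rightarrow> 'e \<Rightarrow> complex) \<Rightarrow> (real \<Rightarrow> complex^'n \<Rightarrow> complex^'r^'r) \<Rightarrow> bool" where
  "curve_coord B c t \<Gamma> A \<longleftrightarrow> (\<forall>s\<in>{0..1}. herm_coord B c t (\<Gamma> s) (A s)) \<and>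
    (\<exists>I P. open I \<and> {0..1} \<subseteq> I \<and> (\<forall>i j. C_k_on 3 (I \<times> base_dom c t) (P i j)) \<and>
      (\<forall>s\<in>{0..1}. \<forall>y\<in>base_dom c t. \<forall>i j. A s y $ i $ j = P i j (s, y)))"

lemma vector_derivative_unit:
  "s \<in> {0..1} \<Longrightarrow> (f has_vector_derivative f') (at s within {0..1::real}) \<Longrightarrow> vector_derivative f (at s within {0..1}) = f'"
  using vector_derivative_within_cbox[of 0 1 s f f'] by simp

lemma has_vector_derivative_matrix:
  fixes A :: "real \<Rightarrow> complex^'k::finite^'k"
  assumes "\<And>i j. ((\<lambda>u. A u $ i $ j) has_vector_derivative A' $ i $ j) (at s within S)"
  shows "(A has_vector_derivative A') (at s within S)"
  unfolding has_vector_derivative_def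
proof (subst has_derivative_componentwise_within, rule ballI)
  fix b :: "complex^'k^'k" assume "b \<in> Basis"
  then obtain i j e where b: "b = axis i (axis j e)" by (auto simp: Basis_vec_def)
  have "((\<lambda>u. A u $ i $ j) has_derivative (\<lambda>h. h *\<^sub>R A' $ i $ j)) (at s within S)"
    using assms[of i j] unfolding has_vector_derivative_def .
  from has_derivative_inner_left[OF this, of e]
  show "((\<lambda>u. A u \<bullet> b) has_derivative (\<lambda>h. h *\<^sub>R A' \<bullet> b)) (at s within S)"
    unfolding b by (simp add: inner_axis)
qed

lemma has_vector_derivative_sesq:
  fixes A :: "real \<Rightarrow> complex^'k::finite^'k"
  assumes "\<And>i j. ((\<lambda>u. A u $ i $ j) has_vector_derivative A' $ i $ j) (at s within S)"
  shows "((\<lambda>u. sesq (A u) v v) has_vector_derivative sesq A' v v) (at s within S)"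
  unfolding sesq_def
  by (intro has_vector_derivative_sum has_vector_derivative_mult_left assms)

lemma continuous_on_matrix_mult:
  fixes X Y :: "real \<Rightarrow> complex^'k::finite^'k"
  assumes "\<And>i j. continuous_on S (\<lambda>s. X s $ i $ j)" "\<And>i j. continuous_on S (\<lambda>s. Y s $ i $ j)"
  shows "continuous_on S (\<lambda>s. (X s ** Y s) $ i $ j)"
  unfolding matrix_matrix_mult_def vec_lambda_beta by (intro continuous_intros assms)

lemma continuous_on_trace:
  fixes X :: "real \<Rightarrow> complex^'k::finite^'k"
  assumes "\<And>i j. continuous_on S (\<lambda>s. X s $ i $ j)"
  shows "continuous_on S (\<lambda>s. trace (X s))"
  unfolding trace_def by (intro continuous_intros assms)

context
  fixes B :: "('m, 'n::finite, 'e, 'r::finite) vbundle" and c t \<Gamma> A z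
  assumes M: "closed_complex_manifold B" and E: "holomorphic_vector_bundle B"
    and c: "c \<in> charts B" and t: "t \<in> trivs B" and curve: "curve_coord B c t \<Gamma> A" and z: "z \<in> base_dom c t"
begin

private abbreviation "J \<equiv> {0..1::real}"

private lemma coord: "s \<in> J \<Longrightarrow> herm_coord B c t (\<Gamma> s) (A s)"
  using curve by (simp add: curve_coord_def)

private lemma pos_def: "s \<in> J \<Longrightarrow> pos_def_hermitian (A s z)"
  by (rule herm_coord_pos_def[OF M E c t coord z])

private lemma det_nz: "s \<in> J \<Longrightarrow> det (A s z) \<noteq> 0"
  by (rule herm_coord_det[OF M E c t coord z])

private lemma curve_smooth:
  obtains I P where "open I" "J \<subseteq> I" "\<And>i j. C_k_on (Suc (Suc (Suc 0))) (I \<times> base_dom c t) (P i j)"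
    "\<And>s y i j. s \<in> J \<Longrightarrow> y \<in> base_dom c t \<Longrightarrow> A s y $ i $ j = P i j (s, y)"
proof -
  from curve[unfolded curve_coord_def, THEN conjunct2]
  obtain I P where IP: "open I \<and> J \<subseteq> I \<and> (\<forall>i j. C_k_on 3 (I \<times> base_dom c t) (P i j)) \<and>
      (\<forall>s\<in>J. \<forall>y\<in>base_dom c t. \<forall>i j. A s y $ i $ j = P i j (s, y))"
    by (elim exE)
  show ?thesis
    by (rule that[of I P]) (use IP in \<open>simp_all only: numeral_3_eq_3 simp_thms\<close>)
qed

text \<open>The derivative of the extension \<open>P\<close> in the direction (1, 0), restricted to
  the interval; this also provides the one-sided derivatives at its end points.\<close>

private lemma curve_derivative:
  obtains A' where
    "\<And>s i j. s \<in> J \<Longrightarrow> ((\<lambda>u. A u z $ i $ j) has_vector_derivative A' s $ i $ j) (at s within J)"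
    "\<And>i j. continuous_on J (\<lambda>s. A' s $ i $ j)"
proof -
  obtain I P where I: "open I" "J \<subseteq> I" and P: "\<And>i j. C_k_on (Suc (Suc (Suc 0))) (I \<times> base_dom c t) (P i j)"
    and AP: "\<And>s y i j. s \<in> J \<Longrightarrow> y \<in> base_dom c t \<Longrightarrow> A s y $ i $ j = P i j (s, y)"
    by (rule curve_smooth) (rule that; assumption)
  define A' where "A' s = (\<chi> i j. frechet_derivative (P i j) (at (s, z)) (1, 0))" for s
  have P2: "\<And>x. x \<in> I \<times> base_dom c t \<Longrightarrow> P i j differentiable (at x)"
    "\<And>v. C_k_on (Suc (Suc 0)) (I \<times> base_dom c t) (\<lambda>p. frechet_derivative (P i j) (at p) v)" for i j
    using P[of i j] by auto
  show ?thesis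
  proof (rule that[of A'])
    fix s i j assume s: "s \<in> J"
    have "(P i j has_derivative frechet_derivative (P i j) (at (s, z))) (at (s, z))"
      using P2(1)[of "(s, z)"] I(2) s z by (auto simp: frechet_derivative_works[symmetric])
    moreover have "((\<lambda>u. (u, z)) has_derivative (\<lambda>h. (h, 0))) (at s)"
      by (auto intro!: derivative_eq_intros)
    ultimately have "((\<lambda>u. P i j (u, z)) has_derivative (\<lambda>h. frechet_derivative (P i j) (at (s, z)) (h, 0))) (at s)"
      by (rule has_derivative_compose[rotated])
    from has_derivative_at_withinI[OF this, of J]
    have "((\<lambda>u. A u z $ i $ j) has_derivative (\<lambda>h. frechet_derivative (P i j) (at (s, z)) (h, 0))) (at s within J)"
      by (rule has_derivative_transform[OF s, rotated]) (simp add: AP z)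
    moreover have "frechet_derivative (P i j) (at (s, z)) (h, 0) = h *\<^sub>R A' s $ i $ j" for h
    proof -
      have "linear (frechet_derivative (P i j) (at (s, z)))"
        by (rule linear_frechet_derivative) (use P2(1) I(2) s z in auto)
      from linear_scale[OF this, of h "(1, 0)"] show ?thesis by (simp add: A'_def)
    qed
    ultimately show "((\<lambda>u. A u z $ i $ j) has_vector_derivative A' s $ i $ j) (at s within J)"
      by (simp add: has_vector_derivative_def)
  next
    fix i j
    have "continuous_on (I \<times> base_dom c t) (\<lambda>p. frechet_derivative (P i j) (at p) (1, 0))"
      using C_k_on_pred[OF C_k_on_pred[OF P2(2)]] by simp
    hence "continuous_on J (\<lambda>s. (\<lambda>p. frechet_derivative (P i j) (at p) (1, 0)) (s, z))"
      by (rule continuous_on_compose2[where f = "\<lambda>s. (s, z)"]) (use I(2) z in \<open>auto intro!: continuous_intros\<close>)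
    thus "continuous_on J (\<lambda>s. A' s $ i $ j)" by (simp add: A'_def)
  qed
qed

private lemma curve_continuous:
  "continuous_on J (\<lambda>s. wd_matrix a (A s) z $ i $ j)"
  "continuous_on J (\<lambda>s. wdbar_matrix b (A s) z $ i $ j)"
  "continuous_on J (\<lambda>s. wd_matrix a (wdbar_matrix b (A s)) z $ i $ j)"
proof -
  obtain I P where I: "open I" "J \<subseteq> I" and P: "\<And>i j. C_k_on (Suc (Suc (Suc 0))) (I \<times> base_dom c t) (P i j)"
    and AP: "\<And>s y i j. s \<in> J \<Longrightarrow> y \<in> base_dom c t \<Longrightarrow> A s y $ i $ j = P i j (s, y)"
    by (rule curve_smooth) (rule that; assumption)
  have D: "open (base_dom c t)" by (rule open_base_dom[OF M E c t])
  have P2: "C_k_on (Suc (Suc 0)) (I \<times> base_dom c t) (P i j)" "C_k_on (Suc 0) (I \<times> base_dom c t) (P i j)"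
    by (rule C_k_on_pred[OF P], rule C_k_on_pred[OF C_k_on_pred[OF P]])
  have slice: "continuous_on J (\<lambda>s. Q (s, z))" if "C_k_on 0 (I \<times> base_dom c t) Q" for Q :: "real \<times> (complex^'n) \<Rightarrow> complex"
  proof -
    have "continuous_on (I \<times> base_dom c t) Q" using that by simp
    thus ?thesis
      by (rule continuous_on_compose2[where f = "\<lambda>s. (s, z)"]) (use I(2) z in \<open>auto intro!: continuous_intros\<close>)
  qed
  have wdA: "wd a (\<lambda>y. A s y $ i $ j) y = wd a (\<lambda>y. P i j (s, y)) y" "wdbar b (\<lambda>y. A s y $ i $ j) y = wdbar b (\<lambda>y. P i j (s, y)) y"
    if "s \<in> J" "y \<in> base_dom c t" for s y
    by (rule wd_cong_open[OF D that(2)], rule AP[OF that(1)], assumption)+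
  obtain Q where Q: "C_k_on 0 (I \<times> base_dom c t) Q" "\<And>s y. s \<in> I \<Longrightarrow> y \<in> base_dom c t \<Longrightarrow> wd a (\<lambda>y. P i j (s, y)) y = Q (s, y)"
    using partial_wd(1)[OF I(1) D P2(2)] by blast
  have "continuous_on J (\<lambda>s. wd_matrix a (A s) z $ i $ j) \<longleftrightarrow> continuous_on J (\<lambda>s. Q (s, z))"
    using I(2) by (intro continuous_on_cong refl) (auto simp: wd_matrix_def wdA z Q(2))
  thus "continuous_on J (\<lambda>s. wd_matrix a (A s) z $ i $ j)" using slice[OF Q(1)] by simp
  \<comment> \<open>\<open>R\<close> keeps one more derivative than \<open>Q\<close>, since it is
    differentiated again for the mixed derivative.\<close>
  obtain R where R: "C_k_on (Suc 0) (I \<times> base_dom c t) R" "\<And>s y. s \<in> I \<Longrightarrow> y \<in> base_dom c t \<Longrightarrow> wdbar b (\<lambda>y. P i j (s, y)) y = R (s, y)"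
    using partial_wd(2)[OF I(1) D P2(1)] by blast
  have "continuous_on J (\<lambda>s. wdbar_matrix b (A s) z $ i $ j) \<longleftrightarrow> continuous_on J (\<lambda>s. R (s, z))"
    using I(2) by (intro continuous_on_cong refl) (auto simp: wdbar_matrix_def wdA z R(2))
  thus "continuous_on J (\<lambda>s. wdbar_matrix b (A s) z $ i $ j)" using slice[OF C_k_on_pred[OF R(1)]] by simp
  obtain T where T: "C_k_on 0 (I \<times> base_dom c t) T" "\<And>s y. s \<in> I \<Longrightarrow> y \<in> base_dom c t \<Longrightarrow> wd a (\<lambda>y. R (s, y)) y = T (s, y)"
    using partial_wd(1)[OF I(1) D R(1)] by blast
  have "wd_matrix a (wdbar_matrix b (A s)) z $ i $ j = T (s, z)" if s: "s \<in> J" for s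
  proof -
    have "wd a (\<lambda>y. wdbar b (\<lambda>y. A s y $ i $ j) y) z = wd a (\<lambda>y. R (s, y)) z"
      using I(2) s by (intro wd_cong_open(1)[OF D z]) (auto simp: wdA R(2))
    thus ?thesis using I(2) s z by (auto simp: wd_matrix_def wdbar_matrix_def T(2))
  qed
  hence "continuous_on J (\<lambda>s. wd_matrix a (wdbar_matrix b (A s)) z $ i $ j) \<longleftrightarrow> continuous_on J (\<lambda>s. T (s, z))"
    by (intro continuous_on_cong refl) simp
  thus "continuous_on J (\<lambda>s. wd_matrix a (wdbar_matrix b (A s)) z $ i $ j)" using slice[OF T(1)] by simp
qed

private abbreviation "K s a b \<equiv> chern_curvature B c t (\<Gamma> s) z a b"

lemma curve_forms:
  "of_nat CARD('r) * integral J (\<lambda>s. fibre_int_v B c t (\<lambda>s. finsler_of (\<Gamma> s)) s z) =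
     Ln (det (herm_matrix B c t (\<Gamma> 1) z) / det (herm_matrix B c t (\<Gamma> 0) z))" (is ?Q1)
  "length X = 2 \<Longrightarrow>
    of_nat (CARD('r) * (CARD('r) + 1)) * integral J (\<lambda>s. fibre_int_v_Psi B c t (\<lambda>s. finsler_of (\<Gamma> s)) s z X) +
    - (of_nat CARD('r))\<^sup>2 * integral J (\<lambda>s. fibre_int_v B c t (\<lambda>s. finsler_of (\<Gamma> s)) s z * fibre_int_Psi B c t (\<lambda>s. finsler_of (\<Gamma> s)) s z X) =
    integral J (\<lambda>s. tr_VR B c t \<Gamma> s z X)" (is "_ \<Longrightarrow> ?Q23")
proof -
  obtain A' where A': "\<And>s i j. s \<in> J \<Longrightarrow> ((\<lambda>u. A u z $ i $ j) has_vector_derivative A' s $ i $ j) (at s within J)"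
    and contA': "\<And>i j. continuous_on J (\<lambda>s. A' s $ i $ j)"
    by (rule curve_derivative) blast
  define W where "W s = A' s ** matrix_inv (A s z)" for s
  let ?G = "\<lambda>s. finsler_of (\<Gamma> s)"
  have herm: "herm_matrix B c t (\<Gamma> s) z = A s z" if "s \<in> J" for s
    by (rule herm_coord_matrix[OF M E c t coord[OF that] z])
  have contA: "continuous_on J (\<lambda>s. A s z $ i $ j)" for i j
    using A' by (meson continuous_on_eq_continuous_within has_vector_derivative_continuous)
  have hder: "((\<lambda>u. A u z $ i $ j) has_derivative (\<lambda>h. (h *\<^sub>R A' s) $ i $ j)) (at s within J)" if "s \<in> J" for s i j
    using A'[OF that] by (simp add: has_vector_derivative_def)
  have contI: "continuous_on J (\<lambda>s. matrix_inv (A s z) $ i $ j)" for i j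
    unfolding continuous_on_eq_continuous_within
  proof
    fix s assume s: "s \<in> J"
    show "continuous (at s within J) (\<lambda>s. matrix_inv (A s z) $ i $ j)"
      by (rule has_derivative_continuous[OF matrix_inv_has_derivative[where A' = "\<lambda>h. h *\<^sub>R A' s"]])
        (use hder[OF s] det_nz s in auto)
  qed
  have contW: "continuous_on J (\<lambda>s. W s $ i $ j)" for i j
    unfolding W_def by (rule continuous_on_matrix_mult[OF contA' contI])
  have contR: "continuous_on J (\<lambda>s. K s a b $ i $ j)" for a b i j
  proof -
    define X where "X s = wd_matrix a (A s) z ** matrix_inv (A s z) ** wdbar_matrix b (A s) z -
        wd_matrix a (wdbar_matrix b (A s)) z" for s
    have "continuous_on J (\<lambda>s. X s $ i $ j)" for i j
      unfolding X_def vector_minus_component by (intro continuous_on_diff continuous_on_matrix_mult contI curve_continuous)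
    hence "continuous_on J (\<lambda>s. (X s ** matrix_inv (A s z)) $ i $ j)"
      by (intro continuous_on_matrix_mult contI)
    moreover have "K s a b $ i $ j = (X s ** matrix_inv (A s z)) $ i $ j" if "s \<in> J" for s
      unfolding X_def by (simp only: chern_curvature_eq[OF M E c t coord[OF that] z])
    hence "continuous_on J (\<lambda>s. K s a b $ i $ j) \<longleftrightarrow> continuous_on J (\<lambda>s. (X s ** matrix_inv (A s z)) $ i $ j)"
      by (rule continuous_on_cong[OF refl])
    ultimately show ?thesis by blast
  qed
  \<comment> \<open>The velocity of a curve of Hermitian matrices is Hermitian, as the second moment
    requires; this follows from uniqueness of derivatives within the interval.\<close>
  have cnjA': "cnj (A' s $ i $ j) = A' s $ j $ i" if s: "s \<in> J" for s i j
  proof -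
    have "((\<lambda>u. cnj (A u z $ i $ j)) has_vector_derivative cnj (A' s $ i $ j)) (at s within J)"
      by (rule bounded_linear.has_vector_derivative[OF bounded_linear_cnj A'[OF s]])
    hence "((\<lambda>u. A u z $ j $ i) has_vector_derivative cnj (A' s $ i $ j)) (at s within J)"
      by (rule has_vector_derivative_transform[OF s, rotated]) (simp add: pos_def_hermitian_cnj[OF pos_def])
    thus ?thesis using vector_derivative_unit[OF s] A'[OF s] by metis
  qed
  have vel: "complex_of_real (v_fun ?G s (point B c t (join z v))) = sesq (A' s) v v / sesq (A s z) v v"
    if s: "s \<in> J" and v: "v \<noteq> 0" for s v
  proof -
    let ?e = "point B c t (join z v)"
    have g: "sesq (A u z) v v = of_real (?G u ?e)" "0 < ?G u ?e" if "u \<in> J" for u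
      using herm_coord_finsler[OF M E c t coord[OF that], of "join z v"] z v by auto
    have "((\<lambda>u. Re (sesq (A u z) v v)) has_vector_derivative Re (sesq (A' s) v v)) (at s within J)"
      by (rule bounded_linear.has_vector_derivative[OF bounded_linear_Re has_vector_derivative_sesq[OF A'[OF s]]])
    hence "((\<lambda>u. ?G u ?e) has_vector_derivative Re (sesq (A' s) v v)) (at s within J)"
      by (rule has_vector_derivative_transform[OF s, rotated]) (simp add: g)
    hence "((\<lambda>u. ?G u ?e) has_real_derivative Re (sesq (A' s) v v)) (at s within J)"
      by (simp only: has_real_derivative_iff_has_vector_derivative)
    hence "((\<lambda>u. ln (?G u ?e)) has_real_derivative (1 / ?G s ?e * Re (sesq (A' s) v v))) (at s within J)"
      using g(2)[OF s] by (auto intro!: derivative_eq_intros)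
    hence "v_fun ?G s ?e = Re (sesq (A' s) v v) / ?G s ?e"
      unfolding v_fun_def has_real_derivative_iff_has_vector_derivative
      using vector_derivative_unit[OF s] by simp
    moreover have "of_real (Re (sesq (A' s) v v)) = sesq (A' s) v v"
      by (rule hermitian_sesq_real[symmetric]) (rule cnjA'[OF s])
    ultimately show ?thesis by (simp add: g(1)[OF s])
  qed
  have fv: "fibre_int_v B c t ?G s z = trace (W s) / of_nat CARD('r)" if "s \<in> J" for s
    unfolding W_def by (rule fibre_int_v_eq[OF M E c t coord[OF that] z refl vel[OF that]])
  let ?N = "of_nat (CARD('r) * (CARD('r) + 1)) :: complex" and ?fv = "\<lambda>s. fibre_int_v B c t ?G s z"
  let ?w = "\<lambda>a b. wedge 1 1 (dz a) (dzbar b)"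
  show ?Q1
  proof -
    have "of_nat CARD('r) * integral J (\<lambda>s. ?fv s) = integral J (\<lambda>s. of_nat CARD('r) * ?fv s)"
      by simp
    also have "\<dots> = integral J (\<lambda>s. trace (W s))"
      by (rule integral_cong) (simp add: fv)
    \<comment> \<open>Division by the determinant at 0 keeps the argument of \<open>Ln\<close> real
      and positive, away from the branch cut, and makes the contribution of the lower end point Ln 1
      = 0.\<close>
    also have "\<dots> = Ln (det (A 1 z) / det (A 0 z)) - Ln (det (A 0 z) / det (A 0 z))"
    proof (rule integral_unique, rule fundamental_theorem_of_calculus)
      fix s assume s: "s \<in> J"
      let ?f = "\<lambda>u. det (A u z) / det (A 0 z)"
      have "((\<lambda>u. det (A u z)) has_derivative (\<lambda>h. det (A s z) * trace ((h *\<^sub>R A' s) ** matrix_inv (A s z)))) (at s within J)"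
        by (rule det_has_derivative_trace[OF hder[OF s] det_nz[OF s]])
      moreover have "trace ((h *\<^sub>R A' s) ** matrix_inv (A s z)) = of_real h * trace (W s)" for h
        unfolding W_def trace_def matrix_matrix_mult_def vec_lambda_beta scaleR_matrix_nth sum_distrib_left by (simp only: mult.assoc)
      ultimately have "((\<lambda>u. det (A u z)) has_vector_derivative (det (A s z) * trace (W s))) (at s within J)"
        by (simp add: has_vector_derivative_def scaleR_conv_of_real mult_ac)
      hence f: "(?f has_vector_derivative (det (A s z) * trace (W s) / det (A 0 z))) (at s within J)"
        by (rule has_vector_derivative_divide)
      have "0 \<in> J" by simp
      obtain d0 where d0: "det (A 0 z) = of_real d0" "d0 > 0"
        using det_pos_def_hermitian[OF pos_def[OF \<open>0 \<in> J\<close>]] by blast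
      obtain d where d: "det (A s z) = of_real d" "d > 0"
        using det_pos_def_hermitian[OF pos_def[OF s]] by blast
      have "?f s = of_real (d / d0)" "d / d0 > 0" using d d0 by simp_all
      hence "?f s \<notin> \<real>\<^sub>\<le>\<^sub>0" by (simp only: nonpos_Reals_of_real_iff not_le)
      hence "(Ln has_field_derivative inverse (?f s)) (at (?f s) within ?f ` J)"
        by (rule has_field_derivative_at_within[OF has_field_derivative_Ln])
      from field_vector_diff_chain_within[OF f this]
      have "((Ln \<circ> ?f) has_vector_derivative (det (A s z) * trace (W s) / det (A 0 z) * inverse (?f s))) (at s within J)" .
      moreover have "det (A s z) * trace (W s) / det (A 0 z) * inverse (?f s) = trace (W s)"
        using d d0 by (simp add: field_simps)
      ultimately show "((\<lambda>u. Ln (?f u)) has_vector_derivative trace (W s)) (at s within J)" by (simp add: o_def)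
    qed simp
    finally show ?thesis using det_nz[of 0] by (simp add: herm)
  qed
  show ?Q23 if X: "length X = 2"
  proof -
    let ?P = "\<lambda>s. fibre_int_Psi B c t ?G s z X" and ?vP = "\<lambda>s. fibre_int_v_Psi B c t ?G s z X"
    let ?S1 = "\<lambda>s. \<Sum>a\<in>UNIV. \<Sum>b\<in>UNIV. \<i> * trace (W s ** K s a b) * ?w a b X"
    let ?S2 = "\<lambda>s. \<Sum>a\<in>UNIV. \<Sum>b\<in>UNIV. \<i> * (trace (W s) * trace (K s a b)) * ?w a b X"
    \<comment> \<open>The traces of products and the products of traces are separated under the
      integral, so both need to be integrable; continuity of \<open>W\<close> and \<open>K\<close>
      in s provides this.\<close>
    have i1: "?S1 integrable_on J" and i2: "?S2 integrable_on J"
      by (intro integrable_continuous_interval continuous_intros continuous_on_trace continuous_on_matrix_mult contW contR)+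
    have "?N * integral J (\<lambda>s. ?vP s) =
        integral J (\<lambda>s. ?N * ?vP s)" by simp
    also have "\<dots> = integral J (\<lambda>s. ?S1 s + ?S2 s)"
    proof (rule integral_cong)
      fix s assume s: "s \<in> J"
      have f1: "?vP s = (\<Sum>a\<in>UNIV. \<Sum>b\<in>UNIV. \<i> * (trace (W s ** K s a b) + trace (W s) * trace (K s a b)) * ?w a b X) /
          of_nat (CARD('r) * (CARD('r) + 1))"
        unfolding W_def by (rule fibre_int_v_Psi_eq[OF M E c t coord[OF s] z refl vel[OF s] cnjA'[OF s] X])
      have f2: "(\<Sum>a\<in>UNIV. \<Sum>b\<in>UNIV. \<i> * (trace (W s ** K s a b) + trace (W s) * trace (K s a b)) * ?w a b X) = ?S1 s + ?S2 s"
        unfolding sum.distrib[symmetric] by (simp only: distrib_left distrib_right)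
      have nz: "complex_of_nat (CARD('r) * (CARD('r) + 1)) \<noteq> 0" by (simp del: of_nat_mult of_nat_add)
      show "?N * ?vP s = ?S1 s + ?S2 s"
        unfolding f1 f2 times_divide_eq_right by (rule nonzero_mult_div_cancel_left[OF nz])
    qed
    also have "\<dots> = integral J ?S1 + integral J ?S2" by (rule integral_add[OF i1 i2])
    finally have q2: "?N * integral J (\<lambda>s. ?vP s) = integral J ?S1 + integral J ?S2" .
    have "(of_nat CARD('r))\<^sup>2 * integral J (\<lambda>s. ?fv s * ?P s) =
        integral J (\<lambda>s. (of_nat CARD('r))\<^sup>2 * (?fv s * ?P s))" by simp
    also have "\<dots> = integral J ?S2"
    proof (rule integral_cong)
      fix s assume s: "s \<in> J"
      have "?P s = (\<Sum>a\<in>UNIV. \<Sum>b\<in>UNIV. \<i> * trace (K s a b) * ?w a b X) / of_nat CARD('r)"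
        by (rule fibre_int_Psi_eq[OF M E c t coord[OF s] z, where \<Gamma> = ?G and s = s, OF refl X])
      hence "(of_nat CARD('r))\<^sup>2 * (?fv s * ?P s) =
          trace (W s) * (\<Sum>a\<in>UNIV. \<Sum>b\<in>UNIV. \<i> * trace (K s a b) * ?w a b X)"
        unfolding fv[OF s] by (simp add: power2_eq_square)
      also have "\<dots> = ?S2 s" unfolding sum_distrib_left by (intro sum.cong refl) (simp only: mult_ac)
      finally show "(of_nat CARD('r))\<^sup>2 * (?fv s * ?P s) = ?S2 s" .
    qed
    finally have q3: "(of_nat CARD('r))\<^sup>2 * integral J (\<lambda>s. ?fv s * ?P s) = integral J ?S2" .
    have "integral J (\<lambda>s. tr_VR B c t \<Gamma> s z X) = integral J ?S1"
    proof (rule integral_cong)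
      fix s assume s: "s \<in> J"
      have "((\<lambda>u. herm_matrix B c t (\<Gamma> u) z) has_vector_derivative A' s) (at s within J)"
        by (rule has_vector_derivative_transform[OF s _ has_vector_derivative_matrix[OF A'[OF s]]]) (simp add: herm)
      from vector_derivative_unit[OF s this] have "velocity_endo B c t \<Gamma> s z = W s"
        unfolding velocity_endo_def W_def herm[OF s] by (simp only:)
      thus "tr_VR B c t \<Gamma> s z X = ?S1 s" by (simp add: tr_VR_def form11_def)
    qed
    thus ?thesis using q2 q3 by simp
  qed
qed

end

section \<open>The segment and general smooth curves\<close>

text \<open>\<open>integral_M\<close> is a definite description, so the defining predicates are
  shown to coincide: for each partition of unity both sums are equal, term by term.\<close>

lemma integral_M_cong:
  assumes "\<And>c z. c \<in> charts B \<Longrightarrow> z \<in> snd c ` fst c \<Longrightarrow>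
      \<eta> c z (real_frame (enumeration UNIV)) = \<theta> c z (real_frame (enumeration UNIV))"
  shows "integral_M B \<eta> = integral_M B \<theta>"
proof -
  let ?F = "real_frame (enumeration UNIV)"
  let ?S = "\<lambda>\<eta> P. \<Sum>(c, \<rho>)\<in>P. set_lebesgue_integral lborel (snd c ` fst c)
    (\<lambda>z. of_real (\<rho> (chart_inv c z)) * \<eta> c z ?F)"
  have "?S \<eta> P = ?S \<theta> P" if "partition_of_unity B P" for P
  proof (intro sum.cong refl, clarify)
    fix U \<phi> \<rho> assume "((U, \<phi>), \<rho>) \<in> P"
    hence c: "(U, \<phi>) \<in> charts B" using that by (auto simp: partition_of_unity_def)
    show "set_lebesgue_integral lborel (snd (U, \<phi>) ` fst (U, \<phi>)) (\<lambda>z. of_real (\<rho> (chart_inv (U, \<phi>) z)) * \<eta> (U, \<phi>) z ?F) =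
        set_lebesgue_integral lborel (snd (U, \<phi>) ` fst (U, \<phi>)) (\<lambda>z. of_real (\<rho> (chart_inv (U, \<phi>) z)) * \<theta> (U, \<phi>) z ?F)"
      unfolding set_lebesgue_integral_def
      by (intro Bochner_Integration.integral_cong refl) (auto simp: indicator_def assms[OF c])
  qed
  hence "(\<forall>P. partition_of_unity B P \<longrightarrow> I = ?S \<eta> P) \<longleftrightarrow> (\<forall>P. partition_of_unity B P \<longrightarrow> I = ?S \<theta> P)" for I
    by (intro iff_allI imp_cong refl) (simp only:)
  thus ?thesis unfolding integral_M_def by (simp only:)
qed

text \<open>The two-forms wedged with the power of the Kaehler form agree at each point, in the
  trivialisation picked by \<open>triv_at\<close>. The curve enters only through a coordinate
  description, so that the segment and arbitrary smooth curves are covered alike.\<close>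

lemma donaldson_along_eq:
  fixes B :: "('m, 'n::finite, 'e, 'r::finite) vbundle"
  assumes M: "closed_complex_manifold B" and E: "holomorphic_vector_bundle B"
    and curve: "\<And>c t. c \<in> charts B \<Longrightarrow> t \<in> trivs B \<Longrightarrow> \<exists>A. curve_coord B c t \<Gamma> A"
  shows "donaldson_type_along B g (\<lambda>s. finsler_of (\<Gamma> s)) = donaldson_along B g \<Gamma>"
  unfolding donaldson_type_along_def donaldson_along_def
proof (rule integral_M_cong, rule arg_cong[where f = "\<lambda>x. x / _"], rule wedge_cong[OF _ refl])
  fix c z and Y :: "(complex^'n) list"
  assume c: "c \<in> charts B" and z: "z \<in> snd c ` fst c" and Y: "length Y = 2"
  note t = triv_at_mem[OF M E c z]
  obtain A where A: "curve_coord B c (triv_at B c z) \<Gamma> A" using curve[OF c t(1)] by blast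
  note forms = curve_forms[OF M E c t(1) A t(2)]
  show "Q2 B (\<lambda>s. finsler_of (\<Gamma> s)) c z Y + Q3 B (\<lambda>s. finsler_of (\<Gamma> s)) c z Y -
      einstein_constant B g / of_nat CARD('n) * Q1 B (\<lambda>s. finsler_of (\<Gamma> s)) c z * kaehler_form g c z Y =
    integral {0..1} (\<lambda>s. tr_VR B c (triv_at B c z) \<Gamma> s z Y) -
      einstein_constant B g / of_nat CARD('n) * log_det B (\<Gamma> 1) (\<Gamma> 0) c z * kaehler_form g c z Y"
    unfolding Q1_def Q2_def Q3_def log_det_def forms(1) forms(2)[OF Y] ..
qed

lemma C_k_on_compose_snd:
  assumes "open D" "C_k_on k D f"
  shows "C_k_on k (UNIV \<times> D) (\<lambda>p. f (snd p))"
  by (rule C_k_on_compose_affine[OF assms(1) open_Times[OF open_UNIV assms(1)] bounded_linear_snd _ _ assms(2), where c = 0]) auto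

lemma sesq_linear_matrix:
  assumes "\<And>i j. A $ i $ j = c * A1 $ i $ j + d * A2 $ i $ j"
  shows "sesq A X Y = c * sesq A1 X Y + d * sesq A2 X Y"
  unfolding sesq_def assms sum_distrib_left sum.distrib[symmetric]
  by (intro sum.cong refl) (simp add: algebra_simps)

text \<open>The entries are affine in s and hence extend to all real parameters, while positivity is
  a convexity argument on the unit interval.\<close>

lemma curve_coord_segment:
  fixes B :: "('m, 'n::finite, 'e, 'r::finite) vbundle"
  assumes M: "closed_complex_manifold B" and E: "holomorphic_vector_bundle B"
    and c: "c \<in> charts B" and t: "t \<in> trivs B" and "hermitian_metric B G" "hermitian_metric B H"
  shows "\<exists>A. curve_coord B c t (\<lambda>s e e'. of_real (1 - s) * H e e' + of_real s * G e e') A"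
proof -
  let ?D = "base_dom c t"
  have D: "open ?D" by (rule open_base_dom[OF M E c t])
  obtain AG where AG: "herm_coord B c t G AG" using hermitian_metric_herm_coord[OF M E c t assms(5)] by blast
  obtain AH where AH: "herm_coord B c t H AH" using hermitian_metric_herm_coord[OF M E c t assms(6)] by blast
  define A where "A s y = (\<chi> i j. of_real (1 - s) * AH y $ i $ j + of_real s * AG y $ i $ j)" for s y
  have Aij: "A s y $ i $ j = of_real (1 - s) * AH y $ i $ j + of_real s * AG y $ i $ j" for s y i j
    by (simp add: A_def)
  note sesqA = sesq_linear_matrix[of "A _ _", OF Aij]
  have "herm_coord B c t (\<lambda>e e'. of_real (1 - s) * H e e' + of_real s * G e e') (A s)" if s: "s \<in> {0..1}" for s
    unfolding herm_coord_def
  proof (intro conjI ballI allI impI)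
    fix y assume y: "y \<in> ?D"
    note pH = herm_coord_pos_def[OF M E c t AH y] and pG = herm_coord_pos_def[OF M E c t AG y]
    show "pos_def_hermitian (A s y)"
      unfolding pos_def_hermitian_def
    proof (intro conjI allI impI)
      show "A s y $ a $ b = cnj (A s y $ b $ a)" for a b
        by (simp add: Aij pos_def_hermitian_cnj[OF pH] pos_def_hermitian_cnj[OF pG])
      fix X :: "complex^'r" assume "X \<noteq> 0"
      hence p: "0 < Re (sesq (AH y) X X)" "0 < Re (sesq (AG y) X X)"
        using pos_def_hermitian_pos[OF pH] pos_def_hermitian_pos[OF pG] by auto
      have "0 < (1 - s) * Re (sesq (AH y) X X) + s * Re (sesq (AG y) X X)"
      proof (cases "s = 0")
        case False
        thus ?thesis using s p by (intro add_nonneg_pos mult_nonneg_nonneg mult_pos_pos) auto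
      qed (use p in simp)
      thus "0 < Re (sesq (A s y) X X)" by (simp add: sesqA)
    qed
  next
    fix x x' :: "complex^('n + 'r)" assume "zpart x \<in> ?D" "zpart x = zpart x'"
    thus "of_real (1 - s) * H (point B c t x) (point B c t x') + of_real s * G (point B c t x) (point B c t x') =
        sesq (A s (zpart x)) (vpart x) (vpart x')"
      using AG AH unfolding sesqA by (simp add: herm_coord_def)
  next
    fix i j
    show "C_k_on 3 ?D (\<lambda>y. A s y $ i $ j)"
      unfolding Aij
      by (intro C_k_on_add[OF D] C_k_on_linear[OF D bounded_linear_mult_right] herm_coord_C3[OF M E c t AG] herm_coord_C3[OF M E c t AH])
  qed
  moreover have "C_k_on 3 (UNIV \<times> ?D) (\<lambda>p. of_real (1 - fst p) * AH (snd p) $ i $ j + of_real (fst p) * AG (snd p) $ i $ j)" for i j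
  proof -
    have o: "open (UNIV \<times> ?D :: (real \<times> (complex^'n)) set)" by (rule open_Times[OF open_UNIV D])
    have l: "C_k_on 3 (UNIV \<times> ?D) (\<lambda>p. complex_of_real (fst p))"
      by (rule C_k_on_bounded_linear) (rule bounded_linear_compose[OF bounded_linear_of_real bounded_linear_fst])
    have "C_k_on 3 (UNIV \<times> ?D) (\<lambda>p. 1 + (- 1) * complex_of_real (fst p))"
      by (intro C_k_on_add[OF o] C_k_on_const C_k_on_linear[OF o bounded_linear_mult_right] l)
    hence l': "C_k_on 3 (UNIV \<times> ?D) (\<lambda>p. complex_of_real (1 - fst p))" by simp
    show ?thesis
      by (intro C_k_on_add[OF o] C_k_on_mult[OF o] l l' C_k_on_compose_snd[OF D] herm_coord_C3[OF M E c t AG] herm_coord_C3[OF M E c t AH])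
  qed
  ultimately have "curve_coord B c t (\<lambda>s e e'. of_real (1 - s) * H e e' + of_real s * G e e') A"
    unfolding curve_coord_def
    by (intro conjI ballI exI[of _ UNIV] exI[of _ "\<lambda>i j p. of_real (1 - fst p) * AH (snd p) $ i $ j + of_real (fst p) * AG (snd p) $ i $ j"])
      (auto simp: Aij simp del: of_real_diff)
  thus ?thesis by blast
qed

text \<open>A form of polarization that avoids e_i - e_j, which is zero for i = j: it is applied to
  functions whose smoothness is known only for nonzero vectors.\<close>

lemma sesq_polarization:
  fixes A :: "complex^'k::finite^'k"
  defines "q \<equiv> \<lambda>v. sesq A v v" and "e \<equiv> \<lambda>i. axis i (1 :: complex)"
  shows "A $ i $ j = (q (e i + e j) + \<i> * q (e i + axis j \<i>) - (1 + \<i>) * (q (e i) + q (e j))) / 2"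
proof -
  have "sesq A (axis a x) (axis b y) = A $ a $ b * x * cnj y" for a b x y
    by (simp add: sesq_axis_left axis_apply if_distrib[where f = cnj] sum_delta_mult cong: if_cong)
  thus ?thesis unfolding q_def e_def sesq_add_add by (simp add: algebra_simps)
qed

lemma bounded_linear_join: "bounded_linear (\<lambda>p. (fst p, join (snd p) 0) :: real \<times> (complex^('n::finite + 'r::finite)))"
proof -
  have "bounded_linear (\<lambda>z :: complex^'n. join z 0 :: complex^('n + 'r))"
    unfolding linear_conv_bounded_linear[symmetric]
  proof (rule linearI)
    fix x y :: "complex^'n" and r :: real
    have "(join (x + y) 0 :: complex^('n + 'r)) $ k = (join x 0 + join y 0) $ k"
      "(join (r *\<^sub>R x) 0 :: complex^('n + 'r)) $ k = (r *\<^sub>R join x 0) $ k" for k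
      by (cases k; simp)+
    thus "(join (x + y) 0 :: complex^('n + 'r)) = join x 0 + join y 0"
      "(join (r *\<^sub>R x) 0 :: complex^('n + 'r)) = r *\<^sub>R join x 0"
      unfolding vec_eq_iff by blast+
  qed
  thus ?thesis
    by (intro bounded_linear_Pair bounded_linear_fst bounded_linear_compose[OF _ bounded_linear_snd])
qed

text \<open>A smooth curve is given through its Finsler functions off the zero section, not through
  matrices. Polarization at nonzero constant fibre vectors turns the extended functions
  \<open>\<Gamma>'\<close> into the required extension \<open>P\<close> of the matrix entries;
  outside the unit interval \<open>\<Gamma>'\<close> need not be quadratic, and \<open>P\<close> is
  just defined by the same formula.\<close>

lemma curve_coord_smooth:
  fixes B :: "('m, 'n::finite, 'e, 'r::finite) vbundle"
  assumes M: "closed_complex_manifold B" and E: "holomorphic_vector_bundle B"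
    and c: "c \<in> charts B" and t: "t \<in> trivs B" and \<Gamma>: "smooth_hermitian_curve B \<Gamma>"
  shows "\<exists>A. curve_coord B c t \<Gamma> A"
proof -
  let ?D = "base_dom c t"
  have D: "open ?D" by (rule open_base_dom[OF M E c t])
  have "\<exists>A. herm_coord B c t (\<Gamma> s) A" if "s \<in> {0..1}" for s
    using hermitian_metric_herm_coord[OF M E c t] \<Gamma> that by (simp add: smooth_hermitian_curve_def)
  then obtain A where A: "\<And>s. s \<in> {0..1} \<Longrightarrow> herm_coord B c t (\<Gamma> s) (A s)" by metis
  obtain I \<Gamma>' where I: "open I" "{0..1} \<subseteq> I"
    and \<Gamma>': "\<And>s e. s \<in> {0..1} \<Longrightarrow> e \<in> total B \<Longrightarrow> \<Gamma>' s e = finsler_of (\<Gamma> s) e"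
    and smooth: "smooth_on (I \<times> coord_dom_o c t) (\<lambda>(s, x). coord_expr B c t (\<Gamma>' s) x)"
    using \<Gamma> c t unfolding smooth_hermitian_curve_def smooth_finsler_curve_def by blast
  have dom: "coord_dom_o c t = (zpart -` ?D) \<inter> (vpart -` (- {0}))"
    by (auto simp: coord_dom_o_def coord_dom_def base_dom_def)
  have "open (zpart -` ?D :: (complex^('n + 'r)) set)"
    by (intro open_vimage D bounded_linear.continuous_on[OF bounded_linear_zpart] continuous_on_id)
  moreover have "open (vpart -` (- {0}) :: (complex^('n + 'r)) set)"
    by (intro open_vimage bounded_linear.continuous_on[OF bounded_linear_vpart] continuous_on_id) auto
  ultimately have "open (coord_dom_o c t :: (complex^('n + 'r)) set)"
    unfolding dom by (rule open_Int)
  hence oS: "open (I \<times> (coord_dom_o c t :: (complex^('n + 'r)) set))" by (rule open_Times[OF I(1)])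
  have oT: "open (I \<times> ?D)" by (rule open_Times[OF I(1) D])
  define q where "q v p = coord_expr B c t (\<Gamma>' (fst p)) (join (snd p) v)" for v p
  have Cq: "C_k_on 3 (I \<times> ?D) (q v)" if v: "v \<noteq> 0" for v
  proof -
    have "C_k_on 3 (I \<times> ?D) (\<lambda>p. (\<lambda>(s, x). coord_expr B c t (\<Gamma>' s) x) (fst p, join (snd p) v))"
    proof (rule C_k_on_compose_affine[OF oS oT bounded_linear_join])
      fix p :: "real \<times> (complex^'n)"
      have "join (snd p) v $ k = (join 0 v + join (snd p) 0) $ k" for k :: "'n + 'r" by (cases k) simp_all
      thus "(fst p, join (snd p) v) = (0, join 0 v) + (fst p, join (snd p) 0)" by (simp add: vec_eq_iff)
      show "p \<in> I \<times> ?D \<Longrightarrow> (fst p, join (snd p) v) \<in> I \<times> coord_dom_o c t" using v by (auto simp: dom)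
      show "C_k_on 3 (I \<times> coord_dom_o c t) (\<lambda>(s, x). coord_expr B c t (\<Gamma>' s) x)"
        using smooth by (simp add: smooth_on_def)
    qed
    thus ?thesis by (simp add: q_def[abs_def])
  qed
  have qA: "q v (s, y) = sesq (A s y) v v" if s: "s \<in> {0..1}" and y: "y \<in> ?D" for s y v
  proof -
    have y': "zpart (join y v :: complex^('n + 'r)) \<in> ?D" using y by simp
    have "point B c t (join y v) \<in> total B" using point_props(1)[OF M E c t y'] by (simp add: fibre_def)
    thus ?thesis
      using herm_coord_finsler(1)[OF M E c t A[OF s] y'] by (simp add: q_def coord_expr_def \<Gamma>'[OF s])
  qed
  let ?e = "\<lambda>i. axis i (1 :: complex) :: complex^'r"
  define P where "P i j p = 1 / 2 * (q (?e i + ?e j) p + \<i> * q (?e i + axis j \<i>) p) +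
     - (1 + \<i>) / 2 * (q (?e i) p + q (?e j) p)" for i j p
  have ne: "?e i + axis j b \<noteq> 0" if "b = 1 \<or> b = \<i>" for i j b
  proof
    assume "?e i + axis j b = 0"
    hence "(?e i + axis j b) $ i = 0" by simp
    thus False using that by (auto simp: axis_apply complex_eq_iff split: if_splits)
  qed
  have ne': "?e i \<noteq> 0" for i by (simp add: axis_eq_0_iff)
  have CP: "C_k_on 3 (I \<times> ?D) (P i j)" for i j
    unfolding P_def[abs_def]
    by (intro C_k_on_add[OF oT] C_k_on_linear[OF oT bounded_linear_mult_right] Cq ne ne') auto
  have AP: "A s y $ i $ j = P i j (s, y)" if "s \<in> {0..1}" "y \<in> ?D" for s y i j
  proof -
    have "(a + b - d * e) / 2 = 1 / 2 * (a + b) + - d / 2 * e" for a b d e :: complex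
      by (simp add: diff_divide_distrib)
    thus ?thesis unfolding P_def qA[OF that] sesq_polarization[of "A s y" i j] .
  qed
  have "curve_coord B c t \<Gamma> A"
    unfolding curve_coord_def
  proof (intro conjI ballI exI[of _ I] exI[of _ P] allI)
    show "herm_coord B c t (\<Gamma> s) (A s)" if "s \<in> {0..1}" for s by (rule A[OF that])
    show "open I" "{0..1} \<subseteq> I" by (rule I)+
    show "C_k_on 3 (I \<times> ?D) (P i j)" for i j by (rule CP)
    show "A s y $ i $ j = P i j (s, y)" if "s \<in> {0..1}" "y \<in> ?D" for s y i j by (rule AP[OF that])
  qed
  thus ?thesis by blast
qed

text \<open>\<open>donaldson_type\<close> and \<open>donaldson\<close> are defined by the segment
  from H to G. The second conjunct therefore adds the agreement along every smooth curve of
  Hermitian metrics joining H to G.\<close>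

theorem proposition3p3:
  fixes B :: "('m, 'n::finite, 'e, 'r::finite) vbundle"
    and g :: "('m, 'n) chart \<Rightarrow> complex^'n \<Rightarrow> complex^'n^'n"
    and G H :: "'e \<Rightarrow> 'e \<Rightarrow> complex"
  assumes "closed_complex_manifold B"
    and "kaehler_metric B g"
    and "holomorphic_vector_bundle B"
    and "hermitian_metric B H"
    and "hermitian_metric B G"
  shows "donaldson_type B g (finsler_of G) (finsler_of H) = donaldson B g G H \<and>
    (\<forall>\<Gamma>. smooth_hermitian_curve B \<Gamma> \<and> \<Gamma> 0 = H \<and> \<Gamma> 1 = G \<longrightarrow>
       donaldson_type_along B g (\<lambda>s. finsler_of (\<Gamma> s)) = donaldson_along B g \<Gamma>)"
proof (intro conjI allI impI)
  let ?\<Gamma> = "\<lambda>s e e'. of_real (1 - s) * H e e' + of_real s * G e e'"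
  \<comment> \<open>The segment between two Hermitian metrics in the space of Finsler metrics
    consists of Hermitian metrics, so both functionals are computed along the same curve.\<close>
  have "finsler_of (?\<Gamma> s) = (\<lambda>e. (1 - s) * finsler_of H e + s * finsler_of G e)" for s
    by (simp add: finsler_of_def fun_eq_iff)
  thus "donaldson_type B g (finsler_of G) (finsler_of H) = donaldson B g G H"
    unfolding donaldson_type_def donaldson_def
    using donaldson_along_eq[OF assms(1,3) curve_coord_segment[OF assms(1,3) _ _ assms(5,4)], of g] by simp
next
  fix \<Gamma> assume "smooth_hermitian_curve B \<Gamma> \<and> \<Gamma> 0 = H \<and> \<Gamma> 1 = G"
  thus "donaldson_type_along B g (\<lambda>s. finsler_of (\<Gamma> s)) = donaldson_along B g \<Gamma>"
    by (intro donaldson_along_eq[OF assms(1,3)] curve_coord_smooth[OF assms(1,3)]) auto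
qed

end
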